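(* (Weierstrass condition.) Suppose that $\mathbf{n}\in\mathcal{A}\cap W^{1,\infty}(\Omega,M)$ is a strong local minimizer of $I$. Then for a.e. $x\in\Omega$, $$\mathcal{E}_F\big(x,\mathbf{n}(x),\nabla\mathbf{n}(x),\nabla\mathbf{n}(x)+[\nabla P(\mathbf{n}(x))\zeta]\otimes\eta\big)\geqslant 0$$ for any $\zeta\in\mathbb{R}^k$ and $\eta\in\mathbb{R}^d$.
   Context: $\Omega\subset\mathbb{R}^d$ is a bounded Lipschitz domain whose boundary has two disjoint, relatively open, measurable components $\partial\Omega_1,\partial\Omega_2$ with $\partial\Omega=\overline{\partial\Omega_1}\cup\overline{\partial\Omega_2}$. $M\subset\mathbb{R}^k$ is a closed, bounded manifold of class $C^4$. There is an open set $U\supset M$ on which the nearest point projection $P:U\to M$ is uniquely defined and of class $C^3$; $\nabla P$ denotes its $k\times k$ derivative matrix. For $1\leqslant p\leqslant\infty$, $W^{1,p}(\Omega,M)=\{\mathbf{n}\in W^{1,p}(\Omega,\mathbb{R}^k): \mathbf{n}(x)\in M\text{ a.e.}\}$. Given $\mathbf{n}_0\in W^{1,1}(\Omega,M)$, the admissible set is $\mathcal{A}=\{\mathbf{n}\in W^{1,1}(\Omega,M):\mathbf{n}=\mathbf{n}_0\text{ on }\partial\Omega_1\}$. The functional is $I(\mathbf{n})=\int_\Omega F(x,\mathbf{n}(x),\nabla\mathbf{n}(x))\,dx$, where $F\in C(\overline{\Omega}\times M\times\mathbb{R}^{k\times d})$ and there is an open neighbourhood $O$ of $M$ (with $O\subset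 U$) such that $F(x,\cdot,\cdot)\in C^2(O\times\mathbb{R}^{k\times d})$ for every $x\in\Omega$. The Weierstrass excess function of $F$ is $\mathcal{E}_F(x,z,p,q)=F(x,z,q)-F(x,z,p)-F_p(x,z,p):(q-p)$, where $F_p$ is the derivative of $F$ in its matrix argument and $:$ is the Frobenius inner product. $\mathbf{n}\in\mathcal{A}$ is a strong local minimizer of $I$ if there is $\epsilon>0$ such that $I(\mathbf{m})\geqslant I(\mathbf{n})$ for all $\mathbf{m}\in\mathcal{A}$ with $\|\mathbf{n}-\mathbf{m}\|_\infty<\epsilon$. *)

theory Defs
  imports "HOL-Analysis.Analysis" "HOL-Probability.Essential_Supremum"
begin

section \<open>Functions of class $C^r$\<close>

text \<open>Meant for an open set \<open>S\<close> in a finite-dimensional space, where continuity of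
  all directional derivatives amounts to continuity of the Frechet derivative.\<close>

primrec class_C_on ::
  "nat \<Rightarrow> 'a::real_normed_vector set \<Rightarrow> ('a \<Rightarrow> 'b::real_normed_vector) \<Rightarrow> bool"
where
  "class_C_on 0 S f \<longleftrightarrow> continuous_on S f"
| "class_C_on (Suc r) S f \<longleftrightarrow> (\<forall>x\<in>S. f differentiable (at x)) \<and>
     (\<forall>v. class_C_on r S (\<lambda>x. frechet_derivative f (at x) v))"

definition test_functions :: "'a::real_normed_vector set \<Rightarrow> ('a \<Rightarrow> real) set" where
  "test_functions \<Omega> = {\<phi>. (\<forall>r. class_C_on r UNIV \<phi>) \<and>
     (\<exists>K. compact K \<and> K \<subseteq> \<Omega> \<and> (\<forall>x. x \<notin> K \<longrightarrow> \<phi> x = 0))}"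


section \<open>Sobolev spaces\<close>

definition Linf_norm :: "'a::euclidean_space set \<Rightarrow> ('a \<Rightarrow> 'b::euclidean_space) \<Rightarrow> ereal" where
  "Linf_norm \<Omega> f = esssup (lebesgue_on \<Omega>) (\<lambda>x. ereal (norm (f x)))"

definition Lp_space :: "ennreal \<Rightarrow> 'a::euclidean_space set \<Rightarrow> ('a \<Rightarrow> 'b::euclidean_space) set" where
  "Lp_space p \<Omega> = {f. f \<in> borel_measurable (lebesgue_on \<Omega>) \<and>
     (if p = \<infinity> then Linf_norm \<Omega> f < \<infinity>
      else integrable (lebesgue_on \<Omega>) (\<lambda>x. norm (f x) powr enn2real p))}"

definition locally_integrable_on ::
  "('a::euclidean_space \<Rightarrow> 'b::euclidean_space) \<Rightarrow> 'a set \<Rightarrow> bool" where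
  "locally_integrable_on f \<Omega> \<longleftrightarrow>
     (\<forall>K. compact K \<and> K \<subseteq> \<Omega> \<longrightarrow> integrable (lebesgue_on K) f)"

definition has_weak_gradient ::
  "(real^'d \<Rightarrow> real^'k) \<Rightarrow> (real^'d \<Rightarrow> real^'d^'k) \<Rightarrow> (real^'d) set \<Rightarrow> bool" where
  "has_weak_gradient u G \<Omega> \<longleftrightarrow>
     locally_integrable_on u \<Omega> \<and> locally_integrable_on G \<Omega> \<and>
     (\<forall>\<phi>\<in>test_functions \<Omega>. \<forall>i j.
        (LINT x|lebesgue_on \<Omega>. u x $ i * frechet_derivative \<phi> (at x) (axis j 1))
          = - (LINT x|lebesgue_on \<Omega>. G x $ i $ j * \<phi> x))"

text \<open>On an open set the weak gradient is unique up to a null set; every use below is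
  insensitive to the choice of representative.\<close>

definition weak_gradient :: "(real^'d) set \<Rightarrow> (real^'d \<Rightarrow> real^'k) \<Rightarrow> real^'d \<Rightarrow> real^'d^'k" where
  "weak_gradient \<Omega> u = (SOME G. has_weak_gradient u G \<Omega>)"

definition sobolev_space :: "ennreal \<Rightarrow> (real^'d) set \<Rightarrow> (real^'d \<Rightarrow> real^'k) set" where
  "sobolev_space p \<Omega> = {u. u \<in> Lp_space p \<Omega> \<and>
     (\<exists>G. has_weak_gradient u G \<Omega> \<and> G \<in> Lp_space p \<Omega>)}"

definition sobolev_maps ::
  "ennreal \<Rightarrow> (real^'d) set \<Rightarrow> (real^'k) set \<Rightarrow> (real^'d \<Rightarrow> real^'k) set" where
  "sobolev_maps p \<Omega> M = {u \<in> sobolev_space p \<Omega>. AE x in lebesgue_on \<Omega>. u x \<in> M}"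


section \<open>Lipschitz domains, surface measure and traces\<close>

text \<open>The unit vector \<open>e\<close> plays the role of the last coordinate direction of a rotated
  coordinate system centred at the boundary point \<open>a\<close>, and \<open>\<gamma>\<close> is a Lipschitz function of
  the remaining coordinates, i.e. on the hyperplane orthogonal to \<open>e\<close>.\<close>

definition lipschitz_domain :: "'a::euclidean_space set \<Rightarrow> bool" where
  "lipschitz_domain \<Omega> \<longleftrightarrow> open \<Omega> \<and> connected \<Omega> \<and> \<Omega> \<noteq> {} \<and>
     (\<forall>a\<in>frontier \<Omega>. \<exists>e r L \<gamma>. norm e = 1 \<and> 0 < r \<and> L-lipschitz_on {y. y \<bullet> e = 0} \<gamma> \<and>
        (\<forall>x\<in>ball a r. x \<in> \<Omega> \<longleftrightarrow> \<gamma> ((x - a) - ((x - a) \<bullet> e) *\<^sub>R e) < (x - a) \<bullet> e))"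

text \<open>The $s$-dimensional Hausdorff measure, normalised to agree with Lebesgue measure on
  $s$-dimensional planes. The constraint \<open>bounded\<close> is needed because \<open>diameter\<close> has
  no meaning on unbounded sets, and the empty set has to be singled out because \<open>0 ^ 0 = 1\<close>.\<close>

definition hausdorff_measure :: "nat \<Rightarrow> 'a::metric_space measure" where
  "hausdorff_measure s = measure_of UNIV (sets borel)
     (\<lambda>A. SUP \<delta>\<in>{0<..}.
        INF C\<in>{C :: nat \<Rightarrow> 'a set. A \<subseteq> (\<Union>i. C i) \<and>
                  (\<forall>i. bounded (C i) \<and> diameter (C i) \<le> \<delta>)}.
          (\<Sum>i. if C i = {} then 0
                else ennreal (unit_ball_vol (real s) * (diameter (C i) / 2) ^ s)))"

abbreviation surface_measure :: "(real^'d) measure" where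
  "surface_measure \<equiv> hausdorff_measure (CARD('d) - 1)"

text \<open>The trace operator on $W^{1,1}$ is the continuous extension to $L^1(\partial\Omega)$ of
  the restriction $u \mapsto u|_{\partial\Omega}$ of functions in $W^{1,1}(\Omega) \cap
  C(\overline\Omega)$, so its graph is described by approximating sequences. On a bounded
  Lipschitz domain each \<open>u\<close> has a trace, which is unique almost everywhere.\<close>

definition has_trace ::
  "(real^'d) set \<Rightarrow> (real^'d \<Rightarrow> real^'k) \<Rightarrow> (real^'d \<Rightarrow> real^'k) \<Rightarrow> bool" where
  "has_trace \<Omega> u g \<longleftrightarrow> u \<in> sobolev_space 1 \<Omega> \<and> g \<in> borel_measurable borel \<and>
     (\<exists>v :: nat \<Rightarrow> real^'d \<Rightarrow> real^'k.
        (\<forall>i. v i \<in> sobolev_space 1 \<Omega> \<and> continuous_on (closure \<Omega>) (v i)) \<and>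
        (\<lambda>i. LINT x|lebesgue_on \<Omega>. norm (v i x - u x)) \<longlonglongrightarrow> 0 \<and>
        (\<lambda>i. LINT x|lebesgue_on \<Omega>. norm (weak_gradient \<Omega> (v i) x - weak_gradient \<Omega> u x))
          \<longlonglongrightarrow> 0 \<and>
        (\<lambda>i. \<integral>\<^sup>+x\<in>frontier \<Omega>. ennreal (norm (v i x - g x)) \<partial>surface_measure) \<longlonglongrightarrow> 0)"

definition trace_eq_on ::
  "(real^'d) set \<Rightarrow> (real^'d) set \<Rightarrow> (real^'d \<Rightarrow> real^'k) \<Rightarrow> (real^'d \<Rightarrow> real^'k) \<Rightarrow> bool" where
  "trace_eq_on \<Omega> \<Gamma> u v \<longleftrightarrow> (\<exists>g h. has_trace \<Omega> u g \<and> has_trace \<Omega> v h \<and>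
     (AE x in surface_measure. x \<in> \<Gamma> \<longrightarrow> g x = h x))"


section \<open>Submanifolds and the nearest point projection\<close>

text \<open>Embedded \<open>m\<close>-dimensional submanifolds without boundary, in terms of slice charts \<open>\<psi>\<close>
  with inverse \<open>\<theta>\<close>.\<close>

definition C_submanifold :: "nat \<Rightarrow> nat \<Rightarrow> 'a::euclidean_space set \<Rightarrow> bool" where
  "C_submanifold r m M \<longleftrightarrow> (\<forall>z\<in>M. \<exists>V W S (\<psi> :: 'a \<Rightarrow> 'a) \<theta>.
     open V \<and> z \<in> V \<and> open W \<and> homeomorphism V W \<psi> \<theta> \<and>
     class_C_on r V \<psi> \<and> class_C_on r W \<theta> \<and>
     subspace S \<and> dim S = m \<and> \<psi> ` (M \<inter> V) = W \<inter> S)"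

definition nearest_point_projection ::
  "'a::metric_space set \<Rightarrow> 'a set \<Rightarrow> ('a \<Rightarrow> 'a) \<Rightarrow> bool" where
  "nearest_point_projection M U P \<longleftrightarrow>
     (\<forall>z\<in>U. P z \<in> M \<and> (\<forall>w\<in>M. w \<noteq> P z \<longrightarrow> dist z (P z) < dist z w))"


section \<open>The variational problem\<close>

definition admissible_maps ::
  "(real^'d) set \<Rightarrow> (real^'d) set \<Rightarrow> (real^'k) set \<Rightarrow> (real^'d \<Rightarrow> real^'k)
     \<Rightarrow> (real^'d \<Rightarrow> real^'k) set" where
  "admissible_maps \<Omega> \<Gamma> M n\<^sub>0 = {u \<in> sobolev_maps 1 \<Omega> M. trace_eq_on \<Omega> \<Gamma> u n\<^sub>0}"

text \<open>The integrand need not be integrable for every admissible map, so the integral is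
  taken in the extended reals, as the difference of the integrals of the positive and the
  negative part. For \<open>ereal\<close> we have \<open>\<infinity> - \<infinity> = \<infinity>\<close>: a map whose energy is undefined never
  competes with one of finite energy.\<close>

definition energy ::
  "(real^'d \<Rightarrow> real^'k \<Rightarrow> real^'d^'k \<Rightarrow> real) \<Rightarrow> (real^'d) set \<Rightarrow> (real^'d \<Rightarrow> real^'k) \<Rightarrow> ereal"
where
  "energy F \<Omega> u =
     enn2ereal (\<integral>\<^sup>+x. ennreal (F x (u x) (weak_gradient \<Omega> u x)) \<partial>lebesgue_on \<Omega>)
     - enn2ereal (\<integral>\<^sup>+x. ennreal (- F x (u x) (weak_gradient \<Omega> u x)) \<partial>lebesgue_on \<Omega>)"

definition strong_local_minimizer ::
  "((real^'d \<Rightarrow> real^'k) \<Rightarrow> ereal) \<Rightarrow> (real^'d) set \<Rightarrow> (real^'d \<Rightarrow> real^'k) set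
     \<Rightarrow> (real^'d \<Rightarrow> real^'k) \<Rightarrow> bool" where
  "strong_local_minimizer I \<Omega> A n \<longleftrightarrow> n \<in> A \<and>
     (\<exists>\<epsilon>>0. \<forall>m\<in>A. Linf_norm \<Omega> (\<lambda>x. n x - m x) < ereal \<epsilon> \<longrightarrow> I n \<le> I m)"

definition matrix_gradient :: "(real^'d^'k \<Rightarrow> real) \<Rightarrow> real^'d^'k \<Rightarrow> real^'d^'k" where
  "matrix_gradient f p = (\<chi> i j. frechet_derivative f (at p) (axis i (axis j 1)))"

text \<open>On matrices the inner product \<open>\<bullet>\<close> is the Frobenius inner product.\<close>

definition weierstrass_excess ::
  "(real^'d \<Rightarrow> real^'k \<Rightarrow> real^'d^'k \<Rightarrow> real)
     \<Rightarrow> real^'d \<Rightarrow> real^'k \<Rightarrow> real^'d^'k \<Rightarrow> real^'d^'k \<Rightarrow> real" where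
  "weierstrass_excess F x z p q = F x z q - F x z p - matrix_gradient (F x z) p \<bullet> (q - p)"

definition outer_product :: "real^'k \<Rightarrow> real^'d \<Rightarrow> real^'d^'k" where
  "outer_product a b = (\<chi> i j. a $ i * b $ j)"

end

theory Submission
  imports Defs
begin

text \<open>
  The inequality is obtained at almost every point \<open>a\<close> by comparing \<open>n\<close> with competitors that
  differ from it only in a ball of radius \<open>r\<close> around \<open>a\<close>, and by letting \<open>r\<close> tend to \<open>0\<close>.

  The competitors come from the function \<open>tent \<eta> \<kappa> x = max 0 (min (x \<bullet> \<eta>) (\<kappa> * (1 - norm x)))\<close>, which
  lives in the unit ball. Its gradient equals \<open>\<eta>\<close> on a thin region next to the hyperplane orthogonal
  to \<open>\<eta>\<close> and has length at most \<open>\<kappa>\<close> elsewhere. The competitor is \<open>P (n + \<phi>)\<close> with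
  \<open>\<phi> x = (r * tent \<eta> \<kappa> ((x - a) /\<^sub>R r)) *\<^sub>R \<zeta>\<close>. It has values in \<open>M\<close>, it is uniformly close to \<open>n\<close>, and it
  differs from \<open>n\<close> by a continuous function with compact support in the domain, so it has the same
  trace (\<open>admissible_maps_add_compactly_supported\<close>). With \<open>J\<close> the Jacobian of \<open>P\<close>, its gradient is
  \<open>J (n + \<phi>) ** (G + D)\<close>, where \<open>G\<close> and \<open>D\<close> are the gradients of \<open>n\<close> and \<open>\<phi>\<close>. Since \<open>P\<close> fixes \<open>M\<close>, the
  matrix \<open>J n ** G\<close> is \<open>G\<close> itself (\<open>projected_gradient\<close>). After rescaling to the unit ball, minimality
  therefore gives in the limit that \<open>f (tent_grad \<eta> \<kappa> y) - f 0\<close> has a nonnegative integral over the unit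
  ball, where \<open>f t\<close> is the value of the integrand with gradient argument
  \<open>G a + outer_product (J (n a) *v \<zeta>) t\<close> and all else frozen at \<open>a\<close>.

  This yields the sign of the excess (\<open>excess_nonneg_if_tent_integrals_nonneg\<close>). The integral of the gradient of
  the tent is zero, so the linear part of \<open>f\<close> at \<open>0\<close> may be subtracted. What remains is the excess of
  \<open>f\<close> at \<open>\<eta>\<close> times the volume of the thin region, plus an error of order \<open>o(\<kappa>)\<close>. The vanishing
  integral, tested with \<open>\<eta>\<close>, also shows that this volume is at least a constant times \<open>\<kappa>\<close>.
  Letting \<open>\<kappa>\<close> tend to \<open>0\<close> gives the claim.

  The map \<open>n\<close> has only a bounded weak gradient, and two facts make the computation above
  rigorous. First, the increment of \<open>n\<close> along a short segment is the integral of the weak gradient over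
  the segment (\<open>increment_eq_segment_integral_of_weak_gradient\<close>). So \<open>n\<close> has a Lipschitz representative on
  balls, and its difference quotients converge almost everywhere along suitable step sizes;
  conversely, such a convergence identifies weak gradients
  (\<open>has_weak_gradient_if_difference_quotients_converge\<close>). The chain rule for \<open>P (n + \<phi>)\<close> thereby becomes
  a pointwise statement about difference quotients. Second, by continuity of translations in \<open>L\<^sup>1\<close> there
  are radii \<open>r l\<close> tending to \<open>0\<close> such that \<open>G (a + r l *\<^sub>R y)\<close> tends to \<open>G a\<close> for almost all \<open>a\<close> and \<open>y\<close>
  (\<open>AE_blow_up_sequence\<close>), which is what the passage to the limit needs.
\<close>

section \<open>Smooth bump functions\<close>

lemma class_C_on_Suc_imp: "class_C_on (Suc r) S f \<Longrightarrow> class_C_on r S f"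
proof (induction r arbitrary: f)
  case 0
  then show ?case
    by (auto simp: continuous_on_eq_continuous_at intro!: continuous_at_imp_continuous_on
        differentiable_imp_continuous_within)
next
  case (Suc r)
  then show ?case by simp
qed

lemma class_C_on_const: "class_C_on r UNIV (\<lambda>x. c)"
  by (induction r arbitrary: c) auto

lemma class_C_on_add:
  assumes "class_C_on r UNIV f" "class_C_on r UNIV g"
  shows "class_C_on r UNIV (\<lambda>x. f x + g x)"
  using assms
proof (induction r arbitrary: f g)
  case 0
  then show ?case by (auto intro: continuous_intros)
next
  case (Suc r)
  have "frechet_derivative (\<lambda>x. f x + g x) (at x) v =
      frechet_derivative f (at x) v + frechet_derivative g (at x) v" for x v
  proof -
    have "(f has_derivative frechet_derivative f (at x)) (at x)"
      "(g has_derivative frechet_derivative g (at x)) (at x)"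
      using Suc.prems by (auto simp: frechet_derivative_works[symmetric])
    then have "((\<lambda>x. f x + g x) has_derivative
        (\<lambda>v. frechet_derivative f (at x) v + frechet_derivative g (at x) v)) (at x)"
      by (rule has_derivative_add)
    from frechet_derivative_at[OF this] show ?thesis by metis
  qed
  then show ?case using Suc by auto
qed

lemma class_C_on_mult:
  fixes f g :: "'a::real_normed_vector \<Rightarrow> real"
  assumes "class_C_on r UNIV f" "class_C_on r UNIV g"
  shows "class_C_on r UNIV (\<lambda>x. f x * g x)"
  using assms
proof (induction r arbitrary: f g)
  case 0
  then show ?case by (auto intro: continuous_intros)
next
  case (Suc r)
  have d: "f differentiable (at x)" "g differentiable (at x)" for x
    using Suc.prems by auto
  have "frechet_derivative (\<lambda>x. f x * g x) (at x) v =
      f x * frechet_derivative g (at x) v + frechet_derivative f (at x) v * g x" for x v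
    using frechet_derivative_at[OF has_derivative_mult[OF d(1)[of x, unfolded frechet_derivative_works]
        d(2)[of x, unfolded frechet_derivative_works]]] by metis
  moreover have "class_C_on r UNIV f" "class_C_on r UNIV g"
    using Suc.prems class_C_on_Suc_imp by blast+
  ultimately show ?case using Suc d by (auto intro!: class_C_on_add)
qed

lemma class_C_on_prod:
  fixes f :: "'i \<Rightarrow> 'a::real_normed_vector \<Rightarrow> real"
  assumes "finite I" "\<And>i. i \<in> I \<Longrightarrow> class_C_on r UNIV (f i)"
  shows "class_C_on r UNIV (\<lambda>x. \<Prod>i\<in>I. f i x)"
  using assms by (induction I) (auto intro: class_C_on_const class_C_on_mult)

lemma frechet_derivative_translate:
  assumes "f differentiable (at (x + a))"
  shows "frechet_derivative (\<lambda>x. f (x + a)) (at x) = frechet_derivative f (at (x + a))"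
proof -
  have "((\<lambda>x. f (x + a)) has_derivative frechet_derivative f (at (x + a))) (at x)"
    by (rule has_derivative_compose[of "\<lambda>x. x + a" "\<lambda>h. h" x UNIV f])
       (use assms in \<open>auto simp: frechet_derivative_works[symmetric] intro!: derivative_eq_intros\<close>)
  from frechet_derivative_at[OF this] show ?thesis by simp
qed

lemma class_C_on_translate:
  assumes "class_C_on r UNIV f"
  shows "class_C_on r UNIV (\<lambda>x. f (x + a))"
  using assms
proof (induction r arbitrary: f)
  case 0
  then show ?case by (auto intro!: continuous_on_compose2[of UNIV f] continuous_intros)
next
  case (Suc r)
  have f: "f differentiable (at x)" for x using Suc.prems by simp
  have "(\<lambda>x. f (x + a)) differentiable (at x)" for x
    by (rule differentiable_compose[OF f]) simp
  moreover have "frechet_derivative (\<lambda>x. f (x + a)) (at x) = frechet_derivative f (at (x + a))" for x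
    by (rule frechet_derivative_translate[OF f])
  moreover have "class_C_on r UNIV (\<lambda>x. frechet_derivative f (at (x + a)) v)" for v
    using Suc.prems by (intro Suc.IH[of "\<lambda>x. frechet_derivative f (at x) v"]) simp
  ultimately show ?case by auto
qed

text \<open>For \<open>k = 0\<close> this is the classical smooth function that is flat at \<open>0\<close>. The other members are
  the terms that occur in its derivatives: the family spans a space that is closed under
  differentiation, so that smoothness becomes an induction on the order.\<close>

definition flat_exp :: "nat \<Rightarrow> real \<Rightarrow> real" where
  "flat_exp k t = (if 0 < t then inverse t ^ k * exp (- inverse t) else 0)"

lemma flat_exp_div_tendsto: "((\<lambda>t. flat_exp k t / t) \<longlongrightarrow> 0) (at 0)"
proof -
  have "((\<lambda>t. inverse t ^ Suc k / exp (inverse t)) \<longlongrightarrow> 0) (at_right (0::real))"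
    by (rule filterlim_compose[OF tendsto_power_div_exp_0 filterlim_inverse_at_top_right])
  then have "((\<lambda>t. flat_exp k t / t) \<longlongrightarrow> 0) (at_right 0)"
    by (rule Lim_transform_eventually)
       (auto simp: eventually_at_right_field flat_exp_def exp_minus field_simps intro!: exI[of _ 1])
  moreover have "((\<lambda>t. flat_exp k t / t) \<longlongrightarrow> 0) (at_left 0)"
    by (rule Lim_transform_eventually[OF tendsto_const])
       (auto simp: eventually_at_left_field flat_exp_def intro!: exI[of _ "-1"])
  ultimately show ?thesis by (simp add: filterlim_split_at)
qed

lemma flat_exp_deriv:
  "(flat_exp k has_real_derivative flat_exp (k + 2) t - real k * flat_exp (k + 1) t) (at t)"
proof (cases t "0::real" rule: linorder_cases)
  case less
  have "((\<lambda>_. 0) has_real_derivative 0) (at t)" by simp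
  then show ?thesis using less
    by (subst DERIV_cong_ev[OF refl, where g="\<lambda>_. 0" and v=0])
       (auto simp: flat_exp_def eventually_nhds intro!: exI[of _ "{..<0}"])
next
  case equal
  then show ?thesis using flat_exp_div_tendsto[of k]
    by (auto simp: has_field_derivative_iff flat_exp_def)
next
  case greater
  have "((\<lambda>t. inverse t ^ k * exp (- inverse t)) has_real_derivative
      flat_exp (k + 2) t - real k * flat_exp (k + 1) t) (at t)"
    using greater
    by (auto intro!: derivative_eq_intros simp: flat_exp_def field_simps power2_eq_square)
       (cases k; simp add: field_simps)
  then show ?thesis using greater
    by (subst DERIV_cong_ev[OF refl _ refl, where g="\<lambda>t. inverse t ^ k * exp (- inverse t)"])
       (auto simp: flat_exp_def eventually_nhds intro!: exI[of _ "{0<..}"])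
qed

lemma class_C_on_flat_exp_affine:
  fixes a :: "'a::real_inner"
  shows "class_C_on r UNIV (\<lambda>x. flat_exp k (a \<bullet> x + b))"
proof (induction r arbitrary: k)
  case 0
  have "continuous_on UNIV (flat_exp k)"
    by (intro continuous_at_imp_continuous_on ballI DERIV_isCont[OF flat_exp_deriv])
  then show ?case by (auto intro!: continuous_on_compose2[of UNIV "flat_exp k"] continuous_intros)
next
  case (Suc r)
  let ?D = "\<lambda>x v. (flat_exp (k + 2) (a \<bullet> x + b) - real k * flat_exp (k + 1) (a \<bullet> x + b)) * (a \<bullet> v)"
  have D: "((\<lambda>x. flat_exp k (a \<bullet> x + b)) has_derivative ?D x) (at x)" for x
    by (rule has_derivative_compose[OF _ flat_exp_deriv[unfolded has_field_derivative_def],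
          where f="\<lambda>x. a \<bullet> x + b" and f'="\<lambda>v. a \<bullet> v"])
       (auto intro!: derivative_eq_intros)
  have "frechet_derivative (\<lambda>x. flat_exp k (a \<bullet> x + b)) (at x) = ?D x" for x
    using frechet_derivative_at[OF D] by simp
  moreover have "class_C_on r UNIV (\<lambda>x. ?D x v)" for v
    using Suc[of "k+2"] Suc[of "k+1"]
      class_C_on_add[OF class_C_on_mult[OF class_C_on_const[of r "a \<bullet> v"] Suc[of "k+2"]]
        class_C_on_mult[OF class_C_on_const[of r "- real k * (a \<bullet> v)"] Suc[of "k+1"]]]
    by (simp add: algebra_simps)
  ultimately show ?case using D by (auto simp: differentiable_def)
qed

text \<open>A product of one-dimensional flat functions of affine arguments. The parameter \<open>c\<close> sharpens the
  bump: as \<open>c\<close> grows, it approaches the indicator of the open box.\<close>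

definition box_bump :: "real \<Rightarrow> 'a::euclidean_space \<Rightarrow> 'a \<Rightarrow> 'a \<Rightarrow> real" where
  "box_bump c a b x = (\<Prod>i\<in>Basis. flat_exp 0 (c * (x \<bullet> i - a \<bullet> i)) * flat_exp 0 (c * (b \<bullet> i - x \<bullet> i)))"

lemma flat_exp_0_bounds: "0 \<le> flat_exp 0 t" "flat_exp 0 t \<le> 1"
  by (auto simp: flat_exp_def)

lemma box_bump_bounds: "0 \<le> box_bump c a b x" "box_bump c a b x \<le> 1"
  unfolding box_bump_def
  by (auto intro!: prod_nonneg prod_le_1 mult_nonneg_nonneg mult_le_one flat_exp_0_bounds)

lemma box_bump_outside: 
  assumes "0 < c" "x \<notin> box a b" shows "box_bump c a b x = 0"
proof -
  obtain i where "i \<in> Basis" "\<not> (a \<bullet> i < x \<bullet> i \<and> x \<bullet> i < b \<bullet> i)"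
    using assms by (auto simp: mem_box)
  moreover from this have "flat_exp 0 (c * (x \<bullet> i - a \<bullet> i)) = 0 \<or> flat_exp 0 (c * (b \<bullet> i - x \<bullet> i)) = 0"
    using assms by (auto simp: flat_exp_def zero_less_mult_iff)
  ultimately show ?thesis unfolding box_bump_def by (auto simp: prod_zero_iff)
qed

lemma class_C_on_box_bump: "class_C_on r UNIV (box_bump c a b)"
proof -
  have "class_C_on r UNIV (\<lambda>x. \<Prod>i\<in>Basis. flat_exp 0 ((c *\<^sub>R i) \<bullet> x + - c * (a \<bullet> i)) *
      flat_exp 0 ((- c *\<^sub>R i) \<bullet> x + c * (b \<bullet> i)))"
    by (intro class_C_on_prod class_C_on_mult class_C_on_flat_exp_affine) auto
  then show ?thesis
    by (simp add: box_bump_def[abs_def] algebra_simps inner_commute)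
qed

lemma box_bump_in_test_functions:
  assumes "0 < c" "cbox a b \<subseteq> \<Omega>"
  shows "box_bump c a b \<in> test_functions \<Omega>"
  unfolding test_functions_def
proof (intro CollectI conjI allI exI[of _ "cbox a b"] impI)
  show "box_bump c a b x = 0" if "x \<notin> cbox a b" for x
    using that box_subset_cbox[of a b] by (intro box_bump_outside[OF assms(1)]) auto
qed (use assms class_C_on_box_bump in auto)

lemma box_bump_tendsto_indicator:
  "(\<lambda>l. box_bump (real (Suc l)) a b x) \<longlonglongrightarrow> indicator (box a b) x"
proof (cases "x \<in> box a b")
  case True
  have lim: "(\<lambda>l. flat_exp 0 (real (Suc l) * t)) \<longlonglongrightarrow> 1" if "t > 0" for t
  proof -
    have "(\<lambda>l. exp (- (inverse t * inverse (real (Suc l))))) \<longlonglongrightarrow> exp (- (inverse t * 0))"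
      by (intro tendsto_intros LIMSEQ_inverse_real_of_nat)
    then show ?thesis using that by (simp add: flat_exp_def mult.commute del: of_nat_Suc)
  qed
  have "(\<lambda>l. box_bump (real (Suc l)) a b x) \<longlonglongrightarrow> (\<Prod>i\<in>(Basis::'a set). 1 * 1)"
    unfolding box_bump_def using True by (intro tendsto_intros lim) (auto simp: mem_box)
  then show ?thesis using True by simp
next
  case False
  then show ?thesis by (simp add: box_bump_outside del: of_nat_Suc)
qed

section \<open>The fundamental lemma of the calculus of variations\<close>

text \<open>Open boxes generate the Borel sets and are stable under intersection, so that the integral
  vanishes over all Borel sets by Dynkin's argument.\<close>

lemma AE_zero_if_box_integrals_zero:
  fixes f :: "'a::euclidean_space \<Rightarrow> real"
  assumes f: "integrable lborel f"
    and box: "\<And>a b. (\<integral>x. indicator (box a b) x * f x \<partial>lborel) = 0"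
  shows "AE x in lborel. f x = 0"
proof -
  have f': "integrable lborel (\<lambda>x. indicator A x * f x)" if "A \<in> sets borel" for A
    using integrable_mult_indicator[OF _ f, of A] that by simp
  have total: "(\<integral>x. f x \<partial>lborel) = 0"
  proof -
    let ?B = "\<lambda>n::nat. box (- (real n *\<^sub>R One)) (real n *\<^sub>R One) :: 'a set"
    have "(\<lambda>n. \<integral>x. indicator (?B n) x * f x \<partial>lborel) \<longlonglongrightarrow> (\<integral>x. f x \<partial>lborel)"
    proof (rule integral_dominated_convergence[where w="\<lambda>x. norm (f x)"])
      show "AE x in lborel. (\<lambda>n. indicator (?B n) x * f x) \<longlonglongrightarrow> f x"
      proof (rule AE_I2)
        fix x :: 'a
        obtain n where n: "x \<in> ?B n" using UN_box_eq_UNIV by blast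
        have "x \<in> ?B k" if "n \<le> k" for k
          using n that by (fastforce simp: mem_box)
        then have "\<forall>\<^sub>F k in sequentially. f x = indicator (?B k) x * f x"
          by (auto simp: eventually_sequentially indicator_def intro!: exI[of _ n])
        then show "(\<lambda>n. indicator (?B n) x * f x) \<longlonglongrightarrow> f x"
          by (rule Lim_transform_eventually[OF tendsto_const])
      qed
    qed (use f in \<open>auto simp: indicator_def\<close>)
    then show ?thesis by (simp add: box LIMSEQ_const_iff)
  qed
  let ?E = "range (\<lambda>(a, b). box a b :: 'a set)"
  have "(\<integral>x. indicator A x * f x \<partial>lborel) = 0" if "A \<in> sets borel" for A
  proof -
    have "Int_stable ?E" "?E \<subseteq> Pow UNIV"
      by (auto simp: Int_stable_def box_Int_box)
    moreover have "A \<in> sigma_sets UNIV ?E"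
      using that by (simp add: borel_eq_box)
    moreover have borel_eq: "sigma_sets UNIV ?E = sets borel"
      by (simp add: borel_eq_box)
    ultimately show ?thesis
    proof (induction rule: sigma_sets_induct_disjoint)
      case (basic A)
      then show ?case using box by auto
    next
      case empty
      then show ?case by simp
    next
      case (compl A)
      then have A: "A \<in> sets borel" using borel_eq by simp
      have "indicator (UNIV - A) x * f x = f x - indicator A x * f x" for x
        by (auto simp: indicator_def)
      then show ?case using total compl f f'[OF A] by simp
    next
      case (union A)
      then have A: "\<And>i. A i \<in> sets borel" using borel_eq by auto
      have "(\<integral>x\<in>(\<Union>i. A i). f x \<partial>lborel) = (\<Sum>i. (\<integral>x\<in>A i. f x \<partial>lborel))"
        using union.hyps(1) A f' f by (intro lebesgue_integral_countable_add)
          (auto simp: set_integrable_def disjoint_family_on_def)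
      then show ?case using union.IH[OF borel_eq] by (simp add: set_lebesgue_integral_def)
    qed
  qed
  then show ?thesis
    using density_unique_real[OF f, of "\<lambda>_. 0"] by (auto simp: set_lebesgue_integral_def)
qed

text \<open>Sobolev functions are only Lebesgue measurable, while translations and Fubini's theorem are best
  applied to Borel functions.\<close>

lemma lebesgue_borel_representative:
  fixes f :: "'a::euclidean_space \<Rightarrow> 'b::euclidean_space"
  assumes "f \<in> borel_measurable lebesgue"
  obtains g where "g \<in> borel_measurable borel" "AE x in lborel. f x = g x"
proof -
  have "\<exists>g\<in>borel_measurable lborel. AE x in lborel. f x \<bullet> b = g x" for b
    using assms by (intro completion_ex_borel_measurable_real) auto
  then obtain G where G: "\<And>b. G b \<in> borel_measurable lborel" "\<And>b. AE x in lborel. f x \<bullet> b = G b x"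
    by metis
  show thesis
  proof
    show "(\<lambda>x. \<Sum>b\<in>Basis. G b x *\<^sub>R b) \<in> borel_measurable borel"
      using G(1) by (simp add: measurable_lborel1)
    have "AE x in lborel. \<forall>b\<in>Basis. f x \<bullet> b = G b x"
      by (rule AE_ball_countable'[OF G(2)]) (auto simp: uncountable_infinite countable_finite)
    then show "AE x in lborel. f x = (\<Sum>b\<in>Basis. G b x *\<^sub>R b)"
      by eventually_elim (metis (mono_tags, lifting) euclidean_representation sum.cong)
  qed
qed

text \<open>Bump functions of a box inside \<open>\<Omega>\<close> converge boundedly to its indicator, so that \<open>f\<close> has integral
  zero over all small boxes; countably many boxes cover \<open>\<Omega>\<close>.\<close>

lemma fundamental_lemma_of_calculus_of_variations:
  fixes f :: "'a::euclidean_space \<Rightarrow> real"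
  assumes "open \<Omega>" "locally_integrable_on f \<Omega>"
    and test: "\<And>\<psi>. \<psi> \<in> test_functions \<Omega> \<Longrightarrow> (LINT x|lebesgue_on \<Omega>. f x * \<psi> x) = 0"
  shows "AE x in lebesgue_on \<Omega>. f x = 0"
proof -
  have \<Omega>: "\<Omega> \<in> sets lebesgue" using \<open>open \<Omega>\<close> by auto
  have on_box: "AE x in lebesgue. x \<in> box p q \<longrightarrow> f x = 0" if "cbox p q \<subseteq> \<Omega>" for p q
  proof -
    have "integrable (lebesgue_on (cbox p q)) f"
      using assms(2) that by (auto simp: locally_integrable_on_def)
    then have "integrable lebesgue (\<lambda>x. indicator (cbox p q) x *\<^sub>R f x)"
      by (simp add: integrable_restrict_space)
    from integrable_mult_indicator[OF _ this, of "box p q"]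
    have g: "integrable lebesgue (\<lambda>x. indicator (box p q) x * f x)"
      by (rule Bochner_Integration.integrable_cong[THEN iffD1, rotated -1])
         (use box_subset_cbox[of p q] in \<open>auto simp: indicator_def\<close>)
    then obtain g where [measurable]: "g \<in> borel_measurable borel"
      and fg: "AE x in lborel. indicator (box p q) x * f x = g x"
      using lebesgue_borel_representative[of "\<lambda>x. indicator (box p q) x * f x"] by blast
    have fg': "AE x in lebesgue. indicator (box p q) x * f x = g x"
      using fg by (rule AE_completion)
    have [measurable]: "g \<in> borel_measurable lebesgue"
      by (rule measurable_completion) simp
    have "integrable lebesgue g"
      using g fg' by (subst integrable_cong_AE[of g _ "\<lambda>x. indicator (box p q) x * f x"]) auto
    then have gi: "integrable lborel g" by (simp add: integrable_completion)
    have gb: "AE x in lborel. x \<notin> box p q \<longrightarrow> g x = 0"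
      using fg by eventually_elim (auto split: split_indicator_asm)
    have "(\<integral>x. indicator (box a b) x * g x \<partial>lborel) = 0" for a b
    proof -
      obtain a' b' where ab': "box a b \<inter> box p q = box a' b'" by (auto simp: box_Int_box)
      have "(\<integral>x. indicator (box a b) x * g x \<partial>lborel) = (\<integral>x. indicator (box a' b') x * g x \<partial>lborel)"
        using gb by (intro integral_cong_AE) (auto simp: indicator_def ab'[symmetric])
      also have "\<dots> = 0"
      proof (cases "box a' b' = {}")
        case False
        then have "cbox a' b' = closure (box a' b')" by simp
        also have "\<dots> \<subseteq> cbox p q" using ab' box_subset_cbox[of p q]
          by (intro closure_minimal) auto
        finally have sub: "cbox a' b' \<subseteq> \<Omega>" using that by simp
        have "(\<integral>x. box_bump (real (Suc l)) a' b' x * g x \<partial>lborel) = 0" for l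
        proof -
          let ?\<psi> = "box_bump (real (Suc l)) a' b'"
          have [measurable]: "?\<psi> \<in> borel_measurable borel"
            using class_C_on_box_bump[of 0] by (intro borel_measurable_continuous_onI) (simp del: of_nat_Suc)
          have "(\<integral>x. ?\<psi> x * g x \<partial>lborel) = (\<integral>x. ?\<psi> x * g x \<partial>lebesgue)"
            by (subst integral_completion) (simp_all del: of_nat_Suc)
          also have "\<dots> = (\<integral>x. indicator \<Omega> x * (f x * ?\<psi> x) \<partial>lebesgue)"
          proof (rule integral_cong_AE)
            show "AE x in lebesgue. ?\<psi> x * g x = indicator \<Omega> x * (f x * ?\<psi> x)"
              using fg'
            proof eventually_elim
              case (elim x)
              have "x \<in> box p q \<and> x \<in> \<Omega>" if "?\<psi> x \<noteq> 0"
              proof -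
                have "x \<in> box a' b'" using that box_bump_outside[of "real (Suc l)" x a' b'] by fastforce
                then show ?thesis using sub ab' box_subset_cbox[of a' b'] by blast
              qed
              then show ?case using elim[symmetric] by (cases "?\<psi> x = 0") auto
            qed
            have [measurable]: "?\<psi> \<in> borel_measurable lebesgue"
              by (rule measurable_completion) (simp del: of_nat_Suc)
            show 1: "(\<lambda>x. ?\<psi> x * g x) \<in> borel_measurable lebesgue" by measurable
            have "(\<lambda>x. indicator (box p q) x * f x * ?\<psi> x) \<in> borel_measurable lebesgue"
              by (rule borel_measurable_times[OF borel_measurable_integrable[OF g] \<open>?\<psi> \<in> borel_measurable lebesgue\<close>])
            also have "(\<lambda>x. indicator (box p q) x * f x * ?\<psi> x) = (\<lambda>x. indicator \<Omega> x * (f x * ?\<psi> x))"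
            proof
              fix x
              have "x \<in> box p q \<and> x \<in> \<Omega>" if "?\<psi> x \<noteq> 0"
              proof -
                have "x \<in> box a' b'" using that box_bump_outside[of "real (Suc l)" x a' b'] by fastforce
                then show ?thesis using sub ab' box_subset_cbox[of a' b'] by blast
              qed
              then show "indicator (box p q) x * f x * ?\<psi> x = indicator \<Omega> x * (f x * ?\<psi> x)"
                by (cases "?\<psi> x = 0") auto
            qed
            finally show "(\<lambda>x. indicator \<Omega> x * (f x * ?\<psi> x)) \<in> borel_measurable lebesgue" .
          qed
          also have "\<dots> = (LINT x|lebesgue_on \<Omega>. f x * ?\<psi> x)"
            using \<Omega> by (subst integral_restrict_space) auto
          also have "\<dots> = 0"
            by (rule test) (rule box_bump_in_test_functions[OF _ sub], simp)
          finally show ?thesis .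
        qed
        moreover have "(\<lambda>l. \<integral>x. box_bump (real (Suc l)) a' b' x * g x \<partial>lborel)
            \<longlonglongrightarrow> (\<integral>x. indicator (box a' b') x * g x \<partial>lborel)"
        proof (rule integral_dominated_convergence[where w="\<lambda>x. norm (g x)"])
          show "AE x in lborel. (\<lambda>l. box_bump (real (Suc l)) a' b' x * g x) \<longlonglongrightarrow> indicator (box a' b') x * g x"
            by (intro AE_I2 tendsto_mult box_bump_tendsto_indicator tendsto_const)
          show "AE x in lborel. norm (box_bump (real (Suc l)) a' b' x * g x) \<le> norm (g x)" for l
            using box_bump_bounds[of "real (Suc l)" a' b']
            by (auto simp: abs_mult intro!: mult_left_le_one_le simp del: of_nat_Suc)
          show "(\<lambda>x. box_bump (real (Suc l)) a' b' x * g x) \<in> borel_measurable lborel" for l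
            using class_C_on_box_bump[of 0]
            by (intro borel_measurable_times) (auto intro!: borel_measurable_continuous_onI simp del: of_nat_Suc)
        qed (use gi in auto)
        ultimately show ?thesis by (simp add: LIMSEQ_const_iff)
      qed simp
      finally show ?thesis .
    qed
    then have "AE x in lborel. g x = 0" by (rule AE_zero_if_box_integrals_zero[OF gi])
    then have "AE x in lborel. x \<in> box p q \<longrightarrow> f x = 0"
      using fg by eventually_elim auto
    then show ?thesis by (rule AE_completion)
  qed
  obtain D where D: "countable D" "D \<subseteq> Pow \<Omega>" "\<And>X. X \<in> D \<Longrightarrow> \<exists>a b. X = cbox a b" "\<Union>D = \<Omega>"
    by (rule open_countable_Union_open_cbox[OF \<open>open \<Omega>\<close>]) (rule that)
  have "AE x in lebesgue. x \<in> X \<longrightarrow> f x = 0" if "X \<in> D" for X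
  proof -
    obtain a b where X: "X = cbox a b" using D(3)[OF \<open>X \<in> D\<close>] by blast
    have "AE x in lebesgue. x \<notin> cbox a b - box a b"
      using negligible_frontier_interval[of a b] by (intro AE_not_in) (simp add: negligible_iff_null_sets)
    moreover have "cbox a b \<subseteq> \<Omega>" using D(2) that X by blast
    note on_box[OF this]
    ultimately show ?thesis unfolding X by eventually_elim blast
  qed
  then have "AE x in lebesgue. \<forall>X\<in>D. x \<in> X \<longrightarrow> f x = 0"
    by (intro AE_ball_countable'[OF _ D(1)])
  then have "AE x in lebesgue. x \<in> \<Omega> \<longrightarrow> f x = 0"
    by eventually_elim (use D(4) in auto)
  then show ?thesis using \<Omega> by (subst AE_restrict_space_iff) auto
qed

lemma locally_integrable_on_component:
  fixes G :: "real^'d \<Rightarrow> real^'d^'k"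
  assumes "locally_integrable_on G \<Omega>"
  shows "locally_integrable_on (\<lambda>x. G x $ i $ j) \<Omega>"
proof -
  have "(\<lambda>x. G x $ i $ j) = (\<lambda>x. G x \<bullet> axis i (axis j 1))"
    by (simp add: inner_axis)
  then show ?thesis using assms by (auto simp: locally_integrable_on_def)
qed

lemma test_function_continuous:
  assumes "\<psi> \<in> test_functions \<Omega>"
  shows "continuous_on UNIV \<psi>" "\<And>v. continuous_on UNIV (\<lambda>x. frechet_derivative \<psi> (at x) v)"
    "(\<psi> has_derivative frechet_derivative \<psi> (at x)) (at x)"
proof -
  have "class_C_on 0 UNIV \<psi>" "class_C_on (Suc 0) UNIV \<psi>"
    using assms by (auto simp only: test_functions_def mem_Collect_eq)
  then show "continuous_on UNIV \<psi>" "\<And>v. continuous_on UNIV (\<lambda>x. frechet_derivative \<psi> (at x) v)"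
    "(\<psi> has_derivative frechet_derivative \<psi> (at x)) (at x)"
    by (auto simp: frechet_derivative_works[symmetric])
qed

lemma integrable_mult_compact_support:
  fixes f \<psi> :: "'a::euclidean_space \<Rightarrow> real"
  assumes "open \<Omega>" "locally_integrable_on f \<Omega>" "continuous_on UNIV \<psi>"
    "compact K" "K \<subseteq> \<Omega>" "\<And>x. x \<notin> K \<Longrightarrow> \<psi> x = 0"
  shows "integrable (lebesgue_on \<Omega>) (\<lambda>x. f x * \<psi> x)"
proof -
  have "integrable (lebesgue_on K) f" using assms by (auto simp: locally_integrable_on_def)
  then have f: "integrable lebesgue (\<lambda>x. indicator K x * f x)"
    using \<open>compact K\<close> by (subst (asm) integrable_restrict_space) (auto dest: compact_imp_closed)
  have "bounded (range \<psi>)"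
  proof -
    have "bounded (\<psi> ` K)"
      using assms by (intro compact_imp_bounded compact_continuous_image) (auto intro: continuous_on_subset)
    then have "bounded (insert 0 (\<psi> ` K))" by simp
    then show ?thesis by (rule bounded_subset) (use assms in auto)
  qed
  then obtain C where C: "\<And>x. norm (\<psi> x) \<le> C" by (auto simp: bounded_iff)
  have [measurable]: "\<psi> \<in> borel_measurable borel"
    using assms by (intro borel_measurable_continuous_onI)
  have "integrable lebesgue (\<lambda>x. \<psi> x * (indicator K x * f x))"
  proof (rule Bochner_Integration.integrable_bound)
    show "integrable lebesgue (\<lambda>x. C * (indicator K x * f x))" using f by simp
    show "AE x in lebesgue. norm (\<psi> x * (indicator K x * f x)) \<le> norm (C * (indicator K x * f x))"
      using order.trans[OF C abs_ge_self] by (auto simp: abs_mult intro!: mult_right_mono)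
    show "(\<lambda>x. \<psi> x * (indicator K x * f x)) \<in> borel_measurable lebesgue"
      by (rule borel_measurable_times[OF measurable_completion borel_measurable_integrable[OF f]]) simp
  qed
  also have "(\<lambda>x. \<psi> x * (indicator K x * f x)) = (\<lambda>x. indicator \<Omega> x * (f x * \<psi> x))"
    using assms by (auto simp: indicator_def fun_eq_iff)
  finally show ?thesis using \<open>open \<Omega>\<close> by (subst integrable_restrict_space) auto
qed

text \<open>The choice made in the definition of \<open>weak_gradient\<close> is thus immaterial up to null sets.\<close>

lemma weak_gradient_unique:
  assumes "open \<Omega>" "has_weak_gradient u G \<Omega>" "has_weak_gradient u H \<Omega>"
  shows "AE x in lebesgue_on \<Omega>. G x = H x"
proof -
  have "AE x in lebesgue_on \<Omega>. G x $ i $ j - H x $ i $ j = 0" for i j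
  proof (rule fundamental_lemma_of_calculus_of_variations[OF \<open>open \<Omega>\<close>])
    have li: "locally_integrable_on (\<lambda>x. G x $ i $ j) \<Omega>" "locally_integrable_on (\<lambda>x. H x $ i $ j) \<Omega>"
      using assms by (auto simp: has_weak_gradient_def intro: locally_integrable_on_component)
    then show "locally_integrable_on (\<lambda>x. G x $ i $ j - H x $ i $ j) \<Omega>"
      by (auto simp: locally_integrable_on_def)
    fix \<psi> assume \<psi>: "\<psi> \<in> test_functions \<Omega>"
    then obtain K where K: "compact K" "K \<subseteq> \<Omega>" "\<And>x. x \<notin> K \<Longrightarrow> \<psi> x = 0"
      by (auto simp: test_functions_def)
    note int = integrable_mult_compact_support[OF \<open>open \<Omega>\<close> _ test_function_continuous(1)[OF \<psi>] K]
    have "(LINT x|lebesgue_on \<Omega>. G x $ i $ j * \<psi> x) = (LINT x|lebesgue_on \<Omega>. H x $ i $ j * \<psi> x)"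
    proof -
      have "- (LINT x|lebesgue_on \<Omega>. G x $ i $ j * \<psi> x) = - (LINT x|lebesgue_on \<Omega>. H x $ i $ j * \<psi> x)"
        using assms(2,3) \<psi> unfolding has_weak_gradient_def by auto
      then show ?thesis by simp
    qed
    then show "(LINT x|lebesgue_on \<Omega>. (G x $ i $ j - H x $ i $ j) * \<psi> x) = 0"
      using int[OF li(1)] int[OF li(2)] by (simp add: left_diff_distrib)
  qed
  then have "AE x in lebesgue_on \<Omega>. \<forall>i j. G x $ i $ j - H x $ i $ j = 0"
    by (simp add: AE_all_countable)
  then show ?thesis by eventually_elim (simp add: vec_eq_iff)
qed

lemma has_weak_gradient_weak_gradient:
  "has_weak_gradient u G \<Omega> \<Longrightarrow> has_weak_gradient u (weak_gradient \<Omega> u) \<Omega>"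
  unfolding weak_gradient_def by (rule someI[of "\<lambda>G. has_weak_gradient u G \<Omega>"])

section \<open>Translations in the mean and blow-up sequences\<close>

lemma AE_lborel_notin_negligible:
  assumes "negligible N"
  shows "AE x in lborel. x \<notin> N"
  using AE_not_in[of N lebesgue] assms by (simp add: negligible_iff_null_sets AE_completion_iff)

lemma lborel_integral_translate:
  fixes f :: "'a::euclidean_space \<Rightarrow> 'b::{banach, second_countable_topology}"
  assumes "f \<in> borel_measurable borel"
  shows "(\<integral>x. f (x + a) \<partial>lborel) = (\<integral>x. f x \<partial>lborel)"
    and "integrable lborel (\<lambda>x. f (x + a)) \<longleftrightarrow> integrable lborel f"
proof -
  have "(\<integral>x. f x \<partial>distr lborel borel ((+) a)) = (\<integral>x. f (a + x) \<partial>lborel)"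
    using assms by (subst integral_distr) auto
  then show "(\<integral>x. f (x + a) \<partial>lborel) = (\<integral>x. f x \<partial>lborel)"
    by (simp add: lborel_distr_plus add.commute)
  have "integrable (distr lborel borel ((+) a)) f \<longleftrightarrow> integrable lborel (\<lambda>x. f (a + x))"
    using assms by (subst integrable_distr_eq) auto
  then show "integrable lborel (\<lambda>x. f (x + a)) \<longleftrightarrow> integrable lborel f"
    by (simp add: lborel_distr_plus add.commute)
qed

lemma integrable_bounded_support:
  fixes f :: "'a::euclidean_space \<Rightarrow> 'b::euclidean_space"
  assumes "f \<in> borel_measurable borel" "\<And>x. norm (f x) \<le> C" "\<And>x. x \<notin> cball 0 \<rho> \<Longrightarrow> f x = 0"
  shows "integrable lborel f"
proof (rule Bochner_Integration.integrable_bound)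
  show "integrable lborel (\<lambda>x. C * indicat_real (cball 0 \<rho>) x)"
    by (intro integrable_mult_right integrable_real_indicator emeasure_lborel_cball_finite) simp
  show "AE x in lborel. norm (f x) \<le> norm (C * indicat_real (cball 0 \<rho>) x)"
    using assms(2,3) order.trans[OF assms(2) abs_ge_self] by (auto simp: indicator_def)
qed (use assms in auto)

text \<open>The claim is clear for bounded continuous functions. The function \<open>g\<close> is the limit in the mean,
  on bounded sets, of such functions, and translations preserve integrals.\<close>

lemma L1_translation_continuous:
  fixes g :: "'a::euclidean_space \<Rightarrow> 'b::euclidean_space"
  assumes g[measurable]: "g \<in> borel_measurable borel" and C: "\<And>x. norm (g x) \<le> C"
    and supp: "\<And>x. x \<notin> cball 0 \<rho> \<Longrightarrow> g x = 0" and z: "z \<longlonglongrightarrow> 0"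
  shows "(\<lambda>l. \<integral>x. norm (g (x + z l) - g x) \<partial>lborel) \<longlonglongrightarrow> 0"
proof -
  have "0 \<le> C" using C[of 0] norm_ge_zero order.trans by blast
  have "g \<in> borel_measurable lebesgue" by (rule measurable_completion) simp
  then have "g measurable_on UNIV" by (intro lebesgue_measurable_imp_measurable_on) auto
  then obtain N f where N: "negligible N" and f: "\<And>n. continuous_on UNIV (f n)"
    and lim: "\<And>x. x \<notin> N \<Longrightarrow> (\<lambda>n. f n x) \<longlonglongrightarrow> g x"
    unfolding measurable_on_def by auto
  \<comment> \<open>projecting onto the ball of radius \<open>C\<close> makes the approximations bounded\<close>
  define h where "h n x = closest_point (cball 0 C) (f n x)" for n x
  have cp: "continuous_on UNIV (closest_point (cball (0::'b) C))"
    using \<open>0 \<le> C\<close> by (intro continuous_on_closest_point) auto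
  have h: "continuous_on UNIV (h n)" for n
    unfolding h_def by (intro continuous_on_compose2[OF cp f]) auto
  have hm[measurable]: "h n \<in> borel_measurable borel" for n
    using h by (rule borel_measurable_continuous_onI)
  have hC: "norm (h n x) \<le> C" for n x
    using closest_point_in_set[of "cball 0 C" "f n x"] \<open>0 \<le> C\<close> by (auto simp: h_def)
  have hlim: "(\<lambda>n. h n x) \<longlonglongrightarrow> g x" if "x \<notin> N" for x
  proof -
    have "(\<lambda>n. h n x) \<longlonglongrightarrow> closest_point (cball 0 C) (g x)"
      unfolding h_def using cp by (intro isCont_tendsto_compose[OF _ lim[OF that]])
        (simp add: continuous_on_eq_continuous_at)
    then show ?thesis using C by (simp add: closest_point_self)
  qed
  let ?K = "cball (0::'a) (\<rho> + 2)" and ?K1 = "cball (0::'a) (\<rho> + 1)"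
  have [measurable]: "cball (0::'a) r \<in> sets borel" for r by simp
  define e where "e n x = indicat_real ?K x * norm (h n x - g x)" for n x
  have em[measurable]: "e n \<in> borel_measurable borel" for n
    unfolding e_def by measurable
  have K: "integrable lborel (\<lambda>x. 2 * C * indicat_real (cball (0::'a) r) x)" for r
    by (intro integrable_mult_right integrable_real_indicator emeasure_lborel_cball_finite) simp
  have bd: "norm (a - b) \<le> 2 * C" if "norm a \<le> C" "norm b \<le> C" for a b :: 'b
    using norm_triangle_ineq4[of a b] that by simp
  have ei: "integrable lborel (e n)" for n
    by (rule Bochner_Integration.integrable_bound[OF K[of "\<rho> + 2"]])
       (use bd[OF hC C] \<open>0 \<le> C\<close> in \<open>auto simp: e_def indicator_def\<close>)
  have "(\<lambda>n. \<integral>x. e n x \<partial>lborel) \<longlonglongrightarrow> (\<integral>x. 0 \<partial>(lborel :: 'a measure))"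
  proof (rule integral_dominated_convergence[OF _ _ K[of "\<rho> + 2"]])
    show "AE x in lborel. (\<lambda>n. e n x) \<longlonglongrightarrow> 0"
      using AE_lborel_notin_negligible[OF N]
    proof eventually_elim
      case (elim x)
      have "(\<lambda>n. indicat_real ?K x * norm (h n x - g x)) \<longlonglongrightarrow> indicat_real ?K x * norm (g x - g x)"
        by (intro tendsto_intros hlim elim)
      then show ?case by (simp add: e_def)
    qed
    show "AE x in lborel. norm (e n x) \<le> 2 * C * indicat_real ?K x" for n
      using bd[OF hC C] by (auto simp: e_def indicator_def)
  qed auto
  then have elim: "(\<lambda>n. \<integral>x. e n x \<partial>lborel) \<longlonglongrightarrow> 0" by simp
  show ?thesis
  proof (rule LIMSEQ_I)
    fix \<epsilon> :: real assume "0 < \<epsilon>"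
    obtain n where n: "(\<integral>x. e n x \<partial>lborel) < \<epsilon> / 3"
      using order_tendstoD(2)[OF elim, of "\<epsilon> / 3"] \<open>0 < \<epsilon>\<close> by (auto simp: eventually_sequentially)
    define d where "d l x = indicat_real ?K1 x * norm (h n (x + z l) - h n x)" for l x
    have dm[measurable]: "d l \<in> borel_measurable borel" for l
      unfolding d_def by measurable
    have db: "norm (d l x) \<le> 2 * C * indicat_real ?K1 x" for l x
      using bd[OF hC[of n "x + z l"] hC[of n x]] by (auto simp: d_def indicator_def)
    have di: "integrable lborel (d l)" for l
    proof (rule Bochner_Integration.integrable_bound[OF K[of "\<rho> + 1"]])
      show "AE x in lborel. norm (d l x) \<le> norm (2 * C * indicat_real ?K1 x)"
        using db[of l] by (intro AE_I2) (simp add: order.trans[OF _ abs_ge_self])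
    qed simp
    have "(\<lambda>l. \<integral>x. d l x \<partial>lborel) \<longlonglongrightarrow> (\<integral>x. 0 \<partial>(lborel :: 'a measure))"
    proof (rule integral_dominated_convergence[OF _ _ K[of "\<rho> + 1"]])
      show "AE x in lborel. (\<lambda>l. d l x) \<longlonglongrightarrow> 0"
      proof (rule AE_I2)
        fix x
        have "(\<lambda>l. x + z l) \<longlonglongrightarrow> x + 0" by (intro tendsto_intros z)
        then have "(\<lambda>l. h n (x + z l)) \<longlonglongrightarrow> h n x"
          by (intro isCont_tendsto_compose[of x "h n"])
            (use h[of n] in \<open>auto simp: continuous_on_eq_continuous_at\<close>)
        from tendsto_mult[OF tendsto_const[of "indicat_real ?K1 x"]
            tendsto_norm[OF tendsto_diff[OF this tendsto_const[of "h n x"]]]]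
        show "(\<lambda>l. d l x) \<longlonglongrightarrow> 0" by (simp add: d_def)
      qed
      show "AE x in lborel. norm (d l x) \<le> 2 * C * indicat_real ?K1 x" for l
        by (intro AE_I2 db)
    qed auto
    then have "(\<lambda>l. \<integral>x. d l x \<partial>lborel) \<longlonglongrightarrow> 0" by simp
    then have "\<forall>\<^sub>F l in sequentially. (\<integral>x. d l x \<partial>lborel) < \<epsilon> / 3"
      using \<open>0 < \<epsilon>\<close> order_tendstoD(2)[of _ 0 sequentially "\<epsilon> / 3"] by simp
    moreover have "\<forall>\<^sub>F l in sequentially. norm (z l) < 1"
      using order_tendstoD(2)[OF tendsto_norm[OF z], of 1] by simp
    ultimately have "\<forall>\<^sub>F l in sequentially. norm ((\<integral>x. norm (g (x + z l) - g x) \<partial>lborel) - 0) < \<epsilon>"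
    proof eventually_elim
      case (elim l)
      have et: "integrable lborel (\<lambda>x. e n (x + z l))" "(\<integral>x. e n (x + z l) \<partial>lborel) = (\<integral>x. e n x \<partial>lborel)"
        using lborel_integral_translate[of "e n" "z l"] ei em by auto
      have "(\<integral>x. norm (g (x + z l) - g x) \<partial>lborel) \<le> (\<integral>x. e n (x + z l) + d l x + e n x \<partial>lborel)"
      proof (rule integral_mono')
        show "integrable lborel (\<lambda>x. e n (x + z l) + d l x + e n x)"
          by (intro Bochner_Integration.integrable_add et di ei)
        fix x
        show "norm (g (x + z l) - g x) \<le> e n (x + z l) + d l x + e n x"
        proof (cases "x \<in> ?K1")
          case True
          then have "x \<in> ?K" "x + z l \<in> ?K" using elim(2) norm_triangle_ineq[of x "z l"] by auto
          moreover have "norm (g (x + z l) - g x) \<le>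
              norm (h n (x + z l) - g (x + z l)) + norm (h n (x + z l) - h n x) + norm (h n x - g x)"
            by norm
          ultimately show ?thesis using True by (simp add: e_def d_def)
        next
          case False
          then have "x + z l \<notin> cball 0 \<rho>" using elim(2) norm_triangle_ineq4[of "x + z l" "z l"] by auto
          moreover have "x \<notin> cball 0 \<rho>" using False by auto
          ultimately have "g (x + z l) = 0" "g x = 0" using supp by blast+
          then show ?thesis by (simp add: e_def d_def)
        qed
        then show "0 \<le> e n (x + z l) + d l x + e n x" using norm_ge_zero order.trans by blast
      qed
      also have "\<dots> = (\<integral>x. e n x \<partial>lborel) + (\<integral>x. d l x \<partial>lborel) + (\<integral>x. e n x \<partial>lborel)"
        using et di[of l] ei[of n] by simp
      finally have "(\<integral>x. norm (g (x + z l) - g x) \<partial>lborel) < \<epsilon>" using n elim(1) by simp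
      moreover have "0 \<le> (\<integral>x. norm (g (x + z l) - g x) \<partial>lborel)" by simp
      ultimately show ?case by simp
    qed
    then show "\<exists>no. \<forall>l\<ge>no. norm ((\<integral>x. norm (g (x + z l) - g x) \<partial>lborel) - 0) < \<epsilon>"
      by (simp add: eventually_sequentially)
  qed
qed

text \<open>A replacement for Lebesgue points. For each \<open>y\<close> the functions \<open>x \<mapsto> g (x + t *\<^sub>R \<nu> y) - g x\<close> tend to
  zero in the mean as \<open>t\<close> tends to \<open>0\<close>; integrating over \<open>y\<close> gives convergence to zero in the mean on
  the product space, and a subsequence converges almost everywhere. Two instances matter: \<open>\<nu> y = y\<close>
  on the unit ball, for blowing up at a point, and \<open>\<nu> t = t *\<^sub>R e\<close> on the unit interval, for averages
  over short segments.\<close>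

lemma AE_blow_up_sequence:
  fixes g :: "'a::euclidean_space \<Rightarrow> 'b::euclidean_space" and \<nu> :: "'y \<Rightarrow> 'a"
  assumes g[measurable]: "g \<in> borel_measurable borel" and C: "\<And>x. norm (g x) \<le> C"
    and supp: "\<And>x. x \<notin> cball 0 \<rho> \<Longrightarrow> g x = 0"
    and "finite_measure \<mu>" and \<nu>[measurable]: "\<nu> \<in> borel_measurable \<mu>"
  obtains r where "\<And>l::nat. 0 < r l" "r \<longlonglongrightarrow> 0"
    "AE x in lborel. AE y in \<mu>. (\<lambda>l. g (x + r l *\<^sub>R \<nu> y)) \<longlonglongrightarrow> g x"
proof -
  interpret \<mu>: finite_measure \<mu> by fact
  interpret pair_sigma_finite \<mu> lborel ..
  interpret swap: pair_sigma_finite lborel \<mu> ..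
  define t where "t l = inverse (real (Suc l))" for l
  define u where "u l = (\<lambda>(y, x). g (x + t l *\<^sub>R \<nu> y) - g x)" for l
  have um[measurable]: "u l \<in> borel_measurable (\<mu> \<Otimes>\<^sub>M lborel)" for l
    unfolding u_def by measurable
  have gi: "integrable lborel g" using g C supp by (rule integrable_bounded_support)
  then have gi': "integrable lborel (\<lambda>x. g (x + a))" for a
    using lborel_integral_translate(2)[OF g] by simp
  have ui: "integrable lborel (\<lambda>x. u l (y, x))" for l y
    unfolding u_def using gi gi' by simp
  have b: "norm (\<integral>x. norm (u l (y, x)) \<partial>lborel) \<le> 2 * (\<integral>x. norm (g x) \<partial>lborel)" for l y
  proof -
    have "(\<integral>x. norm (u l (y, x)) \<partial>lborel) \<le> (\<integral>x. norm (g (x + t l *\<^sub>R \<nu> y)) + norm (g x) \<partial>lborel)"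
      using ui[of l y] gi gi' by (intro integral_mono) (auto simp: u_def norm_triangle_ineq4)
    also have "\<dots> = 2 * (\<integral>x. norm (g x) \<partial>lborel)"
      using gi gi' lborel_integral_translate(1)[of "\<lambda>x. norm (g x)"] by simp
    finally show ?thesis by simp
  qed
  have int: "integrable (\<mu> \<Otimes>\<^sub>M lborel) (u l)" for l
  proof (rule Fubini_integrable)
    show "integrable \<mu> (\<lambda>y. \<integral>x. norm (u l (y, x)) \<partial>lborel)"
      using b by (intro \<mu>.integrable_const_bound[where B="2 * (\<integral>x. norm (g x) \<partial>lborel)"]) auto
  qed (use ui in auto)
  have "(\<lambda>l. \<integral>y. (\<integral>x. norm (u l (y, x)) \<partial>lborel) \<partial>\<mu>) \<longlonglongrightarrow> (\<integral>y. 0 \<partial>\<mu>)"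
  proof (rule integral_dominated_convergence[where w="\<lambda>_. 2 * (\<integral>x. norm (g x) \<partial>lborel)"])
    show "AE y in \<mu>. (\<lambda>l. \<integral>x. norm (u l (y, x)) \<partial>lborel) \<longlonglongrightarrow> 0"
    proof (rule AE_I2)
      fix y
      have "(\<lambda>l. t l *\<^sub>R \<nu> y) \<longlonglongrightarrow> 0 *\<^sub>R \<nu> y"
        unfolding t_def by (intro tendsto_intros LIMSEQ_inverse_real_of_nat)
      then show "(\<lambda>l. \<integral>x. norm (u l (y, x)) \<partial>lborel) \<longlonglongrightarrow> 0"
        using L1_translation_continuous[OF g C supp, where z="\<lambda>l. t l *\<^sub>R \<nu> y"] by (simp add: u_def)
    qed
  qed (use b in auto)
  also have "(\<lambda>l. \<integral>y. (\<integral>x. norm (u l (y, x)) \<partial>lborel) \<partial>\<mu>) = (\<lambda>l. \<integral>p. norm (u l p) \<partial>(\<mu> \<Otimes>\<^sub>M lborel))"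
    using integral_fst'[OF integrable_norm[OF int]] by simp
  also have "\<dots> = (\<lambda>l. \<integral>(x, y). norm (u l (y, x)) \<partial>(lborel \<Otimes>\<^sub>M \<mu>))"
    using int by (intro ext) (subst integral_product_swap[symmetric], auto)
  finally have lim: "(\<lambda>l. \<integral>p. norm (u l (snd p, fst p)) \<partial>(lborel \<Otimes>\<^sub>M \<mu>)) \<longlonglongrightarrow> 0"
    by (simp add: case_prod_unfold)
  have "integrable (lborel \<Otimes>\<^sub>M \<mu>) (\<lambda>p. u l (snd p, fst p))" for l
    using integrable_product_swap[OF int[of l]] by (simp add: case_prod_unfold)
  from tendsto_L1_AE_subseq[OF this lim] obtain \<phi> where \<phi>: "strict_mono \<phi>"
    "AE p in lborel \<Otimes>\<^sub>M \<mu>. (\<lambda>l. u (\<phi> l) (snd p, fst p)) \<longlonglongrightarrow> 0" by blast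
  show thesis
  proof
    show "0 < t (\<phi> l)" for l by (simp add: t_def)
    have "t \<longlonglongrightarrow> 0" unfolding t_def by (rule LIMSEQ_inverse_real_of_nat)
    from LIMSEQ_subseq_LIMSEQ[OF this \<phi>(1)] show "(\<lambda>l. t (\<phi> l)) \<longlonglongrightarrow> 0" by (simp add: o_def)
    show "AE x in lborel. AE y in \<mu>. (\<lambda>l. g (x + t (\<phi> l) *\<^sub>R \<nu> y)) \<longlonglongrightarrow> g x"
      using swap.AE_pair[OF \<phi>(2)] by (simp add: u_def LIM_zero_iff)
  qed
qed

section \<open>Increments of functions with a weak gradient\<close>

lemma test_functions_translate:
  assumes "\<psi> \<in> test_functions B" "\<And>x. x \<in> B \<Longrightarrow> x - a \<in> \<Omega>"
  shows "(\<lambda>x. \<psi> (x + a)) \<in> test_functions \<Omega>"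
proof -
  obtain K where K: "compact K" "K \<subseteq> B" "\<And>x. x \<notin> K \<Longrightarrow> \<psi> x = 0"
    using assms(1) by (auto simp: test_functions_def)
  have "compact ((\<lambda>x. - a + x) ` K)" using K(1) by (rule compact_translation)
  moreover have "\<psi> (x + a) = 0" if "x \<notin> (\<lambda>x. - a + x) ` K" for x
  proof -
    have "x + a \<notin> K" using that by (force simp: image_iff)
    then show ?thesis by (rule K(3))
  qed
  moreover have "(\<lambda>x. - a + x) ` K \<subseteq> \<Omega>" using K(2) assms(2) by auto
  moreover have "class_C_on r UNIV (\<lambda>x. \<psi> (x + a))" for r
    using assms(1) by (intro class_C_on_translate) (auto simp: test_functions_def)
  ultimately show ?thesis unfolding test_functions_def by blast
qed

lemma compact_subset_centred_cball:
  fixes K :: "'a::real_normed_vector set"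
  assumes "compact K"
  obtains \<rho> where "K \<subseteq> cball 0 \<rho>"
  using compact_imp_bounded[OF assms] unfolding bounded_iff by (auto simp: subset_iff)

lemma continuous_compact_support_bounded:
  fixes f :: "'a::euclidean_space \<Rightarrow> real"
  assumes "continuous_on UNIV f" "compact K" "\<And>x. x \<notin> K \<Longrightarrow> f x = 0"
  obtains D where "0 \<le> D" "\<And>x. \<bar>f x\<bar> \<le> D"
proof -
  have "bounded (f ` K)"
    using assms by (intro compact_imp_bounded compact_continuous_image) (auto intro: continuous_on_subset)
  then obtain D where D: "\<And>x. x \<in> K \<Longrightarrow> \<bar>f x\<bar> \<le> D" by (auto simp: bounded_iff)
  have "\<bar>f x\<bar> \<le> max 0 D" for x
    using D[of x] assms(3)[of x] by (cases "x \<in> K") auto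
  then show thesis using that[of "max 0 D"] by simp
qed

lemma test_function_support:
  assumes "\<psi> \<in> test_functions \<Omega>"
  obtains K where "compact K" "K \<subseteq> \<Omega>" "\<And>x. x \<notin> K \<Longrightarrow> \<psi> x = 0"
    "\<And>x v. x \<notin> K \<Longrightarrow> frechet_derivative \<psi> (at x) v = 0"
proof -
  obtain K where K: "compact K" "K \<subseteq> \<Omega>" "\<And>x. x \<notin> K \<Longrightarrow> \<psi> x = 0"
    using assms by (auto simp: test_functions_def)
  have "frechet_derivative \<psi> (at x) v = 0" if "x \<notin> K" for x v
  proof -
    have "(\<psi> has_derivative (\<lambda>_. 0)) (at x)"
      by (rule has_derivative_transform_within_open[of "\<lambda>_. 0" _ _ _ "- K"])
         (use K that in \<open>auto intro: compact_imp_closed\<close>)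
    from frechet_derivative_at[OF this] show ?thesis by metis
  qed
  with K show thesis by (rule that)
qed

lemma integrable_product_bounded_support:
  fixes f :: "'a::euclidean_space \<times> real \<Rightarrow> real"
  assumes "f \<in> borel_measurable (lborel \<Otimes>\<^sub>M lborel)"
    and "\<And>x t. \<bar>f (x, t)\<bar> \<le> D * (indicator (cball 0 \<rho>) x * indicator {0..1} t)"
  shows "integrable (lborel \<Otimes>\<^sub>M lborel) f"
proof (rule Bochner_Integration.integrable_bound)
  have "emeasure (lborel \<Otimes>\<^sub>M lborel) (cball (0::'a) \<rho> \<times> {0..1::real}) < \<infinity>"
    using emeasure_lborel_cball_finite[of "0::'a" \<rho>]
    by (subst lborel.emeasure_pair_measure_Times) (auto simp: ennreal_mult_less_top less_top[symmetric])
  then show "integrable (lborel \<Otimes>\<^sub>M lborel)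
      (\<lambda>p. D * indicat_real (cball (0::'a) \<rho> \<times> {0..1::real}) p)"
    by (intro integrable_mult_right integrable_real_indicator) auto
  show "AE p in lborel \<Otimes>\<^sub>M lborel. norm (f p) \<le> norm (D * indicat_real (cball (0::'a) \<rho> \<times> {0..1::real}) p)"
  proof (rule AE_I2)
    fix p :: "'a \<times> real"
    obtain x t where p: "p = (x, t)" by fastforce
    show "norm (f p) \<le> norm (D * indicat_real (cball (0::'a) \<rho> \<times> {0..1::real}) p)"
      using order.trans[OF assms(2)[of x t] abs_ge_self] unfolding p
      by (simp add: indicator_times mult.assoc)
  qed
qed fact

text \<open>Tested against \<open>\<psi>\<close>, the increment of \<open>u\<close> can be shifted onto \<open>\<psi>\<close>. There it is an integral of
  \<open>frechet_derivative \<psi>\<close> along the segment; by Fubini's theorem, and since \<open>\<psi>\<close> moved along the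
  segment stays a test function of \<open>\<Omega>\<close>, the derivative can be passed to \<open>g\<close>. The fundamental lemma
  then removes \<open>\<psi>\<close>.\<close>

lemma increment_eq_segment_integral_of_weak_gradient:
  fixes u :: "'a::euclidean_space \<Rightarrow> real" and g :: "'a \<Rightarrow> 'a"
  assumes u[measurable]: "u \<in> borel_measurable borel" and g[measurable]: "g \<in> borel_measurable borel"
    and C: "\<And>x. \<bar>u x\<bar> \<le> C" "\<And>x. norm (g x) \<le> C"
    and weak: "\<And>\<psi> v. \<psi> \<in> test_functions \<Omega> \<Longrightarrow>
      (\<integral>x. u x * frechet_derivative \<psi> (at x) v \<partial>lborel) = - (\<integral>x. (g x \<bullet> v) * \<psi> x \<partial>lborel)"
    and B: "open B" "\<And>x t. x \<in> B \<Longrightarrow> t \<in> {0..1} \<Longrightarrow> x + t *\<^sub>R h \<in> \<Omega>"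
  shows "AE x in lborel. x \<in> B \<longrightarrow>
    u (x + h) - u x = (\<integral>t. indicator {0..1} t * (g (x + t *\<^sub>R h) \<bullet> h) \<partial>lborel)"
proof -
  have C0: "0 \<le> C" using C(2)[of 0] norm_ge_zero order.trans by blast
  define I where "I x = (\<integral>t. indicator {0..1} t * (g (x + t *\<^sub>R h) \<bullet> h) \<partial>lborel)" for x
  define f where "f x = u (x + h) - u x - I x" for x
  have Im[measurable]: "I \<in> borel_measurable borel"
  proof -
    have "I \<in> borel_measurable lborel" unfolding I_def by measurable
    then show ?thesis by simp
  qed
  have fm[measurable]: "f \<in> borel_measurable borel" unfolding f_def by measurable
  have gh: "\<bar>g x \<bullet> h\<bar> \<le> C * norm h" for x
    using Cauchy_Schwarz_ineq2[of "g x" h] C(2)[of x] by (meson mult_right_mono norm_ge_zero order.trans)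
  have Ib: "\<bar>I x\<bar> \<le> C * norm h" for x
  proof -
    have "\<bar>I x\<bar> \<le> (\<integral>t. \<bar>indicator {0..1} t * (g (x + t *\<^sub>R h) \<bullet> h)\<bar> \<partial>lborel)"
      unfolding I_def by (rule integral_abs_bound)
    also have "\<dots> \<le> (\<integral>t. C * norm h * indicator {0..1::real} t \<partial>lborel)"
    proof (rule integral_mono')
      show "integrable lborel (\<lambda>t. C * norm h * indicator {0..1::real} t)"
        by (intro integrable_mult_right integrable_real_indicator) auto
    qed (use gh C0 in \<open>auto simp: indicator_def\<close>)
    finally have "\<bar>I x\<bar> \<le> (\<integral>t. C * norm h * indicator {0..1::real} t \<partial>lborel)" .
    then show ?thesis by simp
  qed
  have fb: "\<bar>f x\<bar> \<le> 2 * C + C * norm h" for x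
    using C(1)[of x] C(1)[of "x + h"] Ib[of x] by (simp add: f_def)
  have "AE x in lebesgue_on B. f x = 0"
  proof (rule fundamental_lemma_of_calculus_of_variations[OF B(1)])
    show "locally_integrable_on f B"
      unfolding locally_integrable_on_def
    proof (intro allI impI)
      fix K assume K: "compact K \<and> K \<subseteq> B"
      have "integrable lborel (\<lambda>x. indicator K x * f x)"
      proof -
        obtain \<rho> where "K \<subseteq> cball 0 \<rho>"
          using K compact_subset_centred_cball by blast
        moreover have "\<bar>indicator K x * f x\<bar> \<le> 2 * C + C * norm h" for x
          using fb[of x] C0 by (auto simp: indicator_def)
        moreover have "K \<in> sets borel" using K by (auto intro: borel_compact)
        ultimately show ?thesis
          by (intro integrable_bounded_support[of _ "2 * C + C * norm h" \<rho>]) (auto simp: indicator_def)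
      qed
      then have "integrable lebesgue (\<lambda>x. indicator K x * f x)"
        using K by (subst integrable_completion) (auto intro!: borel_measurable_times borel_measurable_indicator borel_compact)
      then show "integrable (lebesgue_on K) f"
        using K by (subst integrable_restrict_space) (auto dest: compact_imp_closed)
    qed
  next
    fix \<psi> assume \<psi>: "\<psi> \<in> test_functions B"
    obtain K where K: "compact K" "K \<subseteq> B" "\<And>x. x \<notin> K \<Longrightarrow> \<psi> x = 0"
      "\<And>x v. x \<notin> K \<Longrightarrow> frechet_derivative \<psi> (at x) v = 0"
      using test_function_support[OF \<psi>] by metis
    note \<psi>' = test_function_continuous[OF \<psi>]
    obtain D1 where D1: "0 \<le> D1" "\<And>x. \<bar>\<psi> x\<bar> \<le> D1"
      using continuous_compact_support_bounded[OF \<psi>'(1) K(1,3)] by metis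
    obtain D2 where D2: "0 \<le> D2" "\<And>x. \<bar>frechet_derivative \<psi> (at x) h\<bar> \<le> D2"
      using continuous_compact_support_bounded[OF \<psi>'(2) K(1,4)] by metis
    obtain \<rho>0 where \<rho>0: "K \<subseteq> cball 0 \<rho>0"
      by (rule compact_subset_centred_cball[OF K(1)])
    \<comment> \<open>a ball that contains the support of all \<open>\<psi>\<close> moved along the segment\<close>
    define \<rho> where "\<rho> = \<rho>0 + norm h"
    have far: "x - t *\<^sub>R h \<notin> K" if "x \<notin> cball 0 \<rho>" "t \<in> {0..1}" for x t
    proof
      assume "x - t *\<^sub>R h \<in> K"
      then have "norm (x - t *\<^sub>R h) \<le> \<rho>0" using \<rho>0 by auto
      moreover have "norm (t *\<^sub>R h) \<le> norm h" using that(2) by (auto intro: mult_left_le_one_le)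
      ultimately have "norm x \<le> \<rho>" unfolding \<rho>_def
        using norm_triangle_ineq[of "x - t *\<^sub>R h" "t *\<^sub>R h"] by simp
      then show False using that(1) by simp
    qed
    have far0: "x \<notin> K" if "x \<notin> cball 0 \<rho>" for x using far[OF that, of 0] by simp
    have [measurable]: "\<psi> \<in> borel_measurable borel"
      "(\<lambda>x. frechet_derivative \<psi> (at x) h) \<in> borel_measurable borel"
      using \<psi>' by (auto intro: borel_measurable_continuous_onI)
    let ?i = "indicator {0..1} :: real \<Rightarrow> real" and ?g = "\<lambda>x t. g (x + t *\<^sub>R h) \<bullet> h"
    let ?d = "\<lambda>x t. frechet_derivative \<psi> (at (x - t *\<^sub>R h)) h"
    have int: "integrable lborel (\<lambda>x. a x * \<psi> (x - t *\<^sub>R h))"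
      if [measurable]: "a \<in> borel_measurable borel" and "\<And>x. \<bar>a x\<bar> \<le> E" "t \<in> {0..1}" for a E t
    proof (rule integrable_bounded_support[of _ "E * D1" \<rho>])
      show "norm (a x * \<psi> (x - t *\<^sub>R h)) \<le> E * D1" for x
        using that(2)[of x] D1(2)[of "x - t *\<^sub>R h"] by (auto simp: abs_mult intro!: mult_mono)
      show "a x * \<psi> (x - t *\<^sub>R h) = 0" if "x \<notin> cball 0 \<rho>" for x
        using far[OF that] K(3) \<open>t \<in> {0..1}\<close> by simp
    qed measurable
    have "(\<integral>x. u (x + h) * \<psi> x \<partial>lborel) = (\<integral>x. u (x - h + h) * \<psi> (x - h) \<partial>lborel)"
      using lborel_integral_translate(1)[of "\<lambda>x. u (x + h) * \<psi> x" "- h"] by simp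
    then have "(\<integral>x. u (x + h) * \<psi> x \<partial>lborel) - (\<integral>x. u x * \<psi> x \<partial>lborel) =
        (\<integral>x. u x * \<psi> (x - h) - u x * \<psi> x \<partial>lborel)"
      using int[OF u C(1), of 1] int[OF u C(1), of 0] by simp
    also have "\<dots> = (\<integral>x. (\<integral>t. - u x * (?i t * ?d x t) \<partial>lborel) \<partial>lborel)"
    proof (rule Bochner_Integration.integral_cong[OF refl])
      fix x
      have "(\<integral>t. indicator {0..1} t *\<^sub>R (- ?d x t) \<partial>lborel)
          = \<psi> (x - 1 *\<^sub>R h) - \<psi> (x - 0 *\<^sub>R h)"
      proof (rule integral_FTC_atLeastAtMost)
        show "((\<lambda>t. \<psi> (x - t *\<^sub>R h)) has_vector_derivative - ?d x t)
            (at t within {0..1})" for t :: real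
        proof -
          have "((\<lambda>t. \<psi> (x - t *\<^sub>R h)) has_derivative
              (\<lambda>s. frechet_derivative \<psi> (at (x - t *\<^sub>R h)) (- (s *\<^sub>R h)))) (at t within {0..1})"
            by (rule has_derivative_compose[OF _ \<psi>'(3), where f="\<lambda>t. x - t *\<^sub>R h"])
               (auto intro!: derivative_eq_intros)
          moreover have "linear (frechet_derivative \<psi> (at (x - t *\<^sub>R h)))"
            using \<psi>'(3) has_derivative_linear by blast
          ultimately show ?thesis
            by (simp add: has_vector_derivative_def linear_neg linear_scale)
        qed
        show "continuous_on {0..1} (\<lambda>t. - ?d x t)"
          by (intro continuous_on_minus continuous_on_compose2[OF \<psi>'(2)[of h]] continuous_intros) auto
      qed simp
      then show "u x * \<psi> (x - h) - u x * \<psi> x =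
          (\<integral>t. - u x * (?i t * ?d x t) \<partial>lborel)"
        by (subst integral_mult_right_zero, simp, metis mult_minus_right right_diff_distrib)
    qed
    also have "\<dots> = (\<integral>t. (\<integral>x. - u x * (?i t * ?d x t) \<partial>lborel) \<partial>lborel)"
    proof (rule lborel_pair.Fubini_integral[symmetric], rule integrable_product_bounded_support[of _ "C * D2" \<rho>])
      show "(\<lambda>(x, t). - u x * (?i t * ?d x t))
        \<in> borel_measurable (lborel \<Otimes>\<^sub>M lborel)" by measurable
      show "\<bar>case (x, t) of (x, t) \<Rightarrow> - u x * (?i t * ?d x t)\<bar>
        \<le> C * D2 * (indicator (cball 0 \<rho>) x * indicator {0..1} t)" for x and t :: real
        using C(1)[of x] D2(2)[of "x - t *\<^sub>R h"] far[of x t] K(4) C0 D2(1)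
        by (auto simp: indicator_def abs_mult intro!: mult_mono)
    qed
    also have "\<dots> = (\<integral>t. (\<integral>x. ?i t * ?g x t * \<psi> x \<partial>lborel) \<partial>lborel)"
    proof (rule Bochner_Integration.integral_cong[OF refl])
      fix t :: real
      show "(\<integral>x. - u x * (?i t * ?d x t) \<partial>lborel) =
          (\<integral>x. ?i t * ?g x t * \<psi> x \<partial>lborel)"
      proof (cases "t \<in> {0..1}")
        case True
        have \<psi>t: "(\<lambda>x. \<psi> (x + - (t *\<^sub>R h))) \<in> test_functions \<Omega>"
          using B(2)[OF _ True] by (intro test_functions_translate[OF \<psi>]) auto
        have "frechet_derivative (\<lambda>x. \<psi> (x + - (t *\<^sub>R h))) (at x) = frechet_derivative \<psi> (at (x - t *\<^sub>R h))" for x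
          using \<psi>'(3) by (subst frechet_derivative_translate) (auto simp: differentiable_def)
        with weak[OF \<psi>t, of h]
        have "- (\<integral>x. u x * ?d x t \<partial>lborel) = (\<integral>x. (g x \<bullet> h) * \<psi> (x - t *\<^sub>R h) \<partial>lborel)"
          by simp
        also have "\<dots> = (\<integral>x. ?g x t * \<psi> x \<partial>lborel)"
          using lborel_integral_translate(1)[of "\<lambda>x. (g x \<bullet> h) * \<psi> (x - t *\<^sub>R h)" "t *\<^sub>R h"] by simp
        finally show ?thesis using True by simp
      qed simp
    qed
    also have "\<dots> = (\<integral>x. (\<integral>t. ?i t * ?g x t * \<psi> x \<partial>lborel) \<partial>lborel)"
    proof (rule lborel_pair.Fubini_integral, rule integrable_product_bounded_support[of _ "C * norm h * D1" \<rho>])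
      show "(\<lambda>(x, t). ?i t * ?g x t * \<psi> x)
        \<in> borel_measurable (lborel \<Otimes>\<^sub>M lborel)" by measurable
      show "\<bar>case (x, t) of (x, t) \<Rightarrow> ?i t * ?g x t * \<psi> x\<bar>
        \<le> C * norm h * D1 * (indicator (cball 0 \<rho>) x * indicator {0..1} t)" for x and t :: real
        using gh[of "x + t *\<^sub>R h"] D1(2)[of x] far0[of x] K(3) C0 D1(1)
        by (auto simp: indicator_def abs_mult intro!: mult_mono)
    qed
    also have "\<dots> = (\<integral>x. I x * \<psi> x \<partial>lborel)"
      by (simp add: I_def)
    finally have eq: "(\<integral>x. u (x + h) * \<psi> x \<partial>lborel) - (\<integral>x. u x * \<psi> x \<partial>lborel) = (\<integral>x. I x * \<psi> x \<partial>lborel)" .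
    have i: "integrable lborel (\<lambda>x. u (x + h) * \<psi> x)" "integrable lborel (\<lambda>x. u x * \<psi> x)"
      "integrable lborel (\<lambda>x. I x * \<psi> x)"
      using int[of "\<lambda>x. u (x + h)" C 0] int[OF u C(1), of 0] int[OF Im Ib, of 0] C(1) by simp_all
    have "\<psi> x = 0" if "x \<notin> B" for x
      using that K(2,3) by blast
    then have "(LINT x|lebesgue_on B. f x * \<psi> x) = (\<integral>x. f x * \<psi> x \<partial>lebesgue)"
      using B(1) by (subst integral_restrict_space)
        (auto intro!: Bochner_Integration.integral_cong simp: indicator_def)
    also have "\<dots> = (\<integral>x. f x * \<psi> x \<partial>lborel)" by (rule integral_completion) simp
    also have "\<dots> = (\<integral>x. u (x + h) * \<psi> x - u x * \<psi> x - I x * \<psi> x \<partial>lborel)"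
      by (simp add: f_def left_diff_distrib)
    also have "\<dots> = 0" using eq i by simp
    finally show "(LINT x|lebesgue_on B. f x * \<psi> x) = 0" .
  qed
  then have "AE x in lebesgue. x \<in> B \<longrightarrow> f x = 0"
    using B(1) by (subst (asm) AE_restrict_space_iff) auto
  then have "AE x in lborel. x \<in> B \<longrightarrow> f x = 0" by (simp add: AE_completion_iff)
  then show ?thesis by eventually_elim (auto simp: f_def I_def)
qed

section \<open>Lipschitz representatives and difference quotients\<close>

lemma AE_lborel_affine:
  fixes a :: "'a::euclidean_space"
  assumes "AE x in lborel. P x" "c \<noteq> 0"
  shows "AE x in lborel. P (a + c *\<^sub>R x)"
proof -
  obtain N where N: "N \<in> null_sets lborel" "{x. \<not> P x} \<subseteq> N"
    using assms(1) by (auto simp: eventually_ae_filter)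
  have [measurable]: "N \<in> sets borel" using N(1) by auto
  let ?D = "distr lborel borel (\<lambda>x. a + c *\<^sub>R x)"
  have "emeasure lborel N = \<bar>c\<bar> ^ DIM('a) * emeasure ?D N"
    by (subst lborel_affine[OF assms(2), of a]) (simp add: emeasure_density_const)
  then have "emeasure ?D N = 0"
    using N(1) assms(2) by auto
  then have "(\<lambda>x. a + c *\<^sub>R x) -` N \<in> null_sets lborel"
    by (subst (asm) emeasure_distr) (auto simp: null_sets_def intro!: measurable_sets_borel[of _ borel])
  then have "AE x in lborel. x \<notin> (\<lambda>x. a + c *\<^sub>R x) -` N" by (rule AE_not_in)
  then show ?thesis by eventually_elim (use N(2) in auto)
qed

lemma AE_lborel_meets_open:
  fixes S :: "'a::euclidean_space set"
  assumes "AE x in lborel. P x" "open S" "S \<noteq> {}"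
  obtains x where "x \<in> S" "P x"
proof -
  obtain N where N: "N \<in> null_sets lborel" "{x. \<not> P x} \<subseteq> N"
    using assms(1) by (auto simp: eventually_ae_filter)
  have "negligible N" using N(1) by (simp add: negligible_iff_null_sets null_sets_completionI)
  then have "\<not> S \<subseteq> N" using open_not_negligible[OF assms(2,3)] negligible_subset by blast
  then show thesis using N(2) that by blast
qed

lemma borel_measurable_vec_nth[measurable]:
  "(\<lambda>x :: 'b::euclidean_space ^ 'n. x $ i) \<in> borel_measurable borel"
  by (intro borel_measurable_continuous_onI continuous_intros)

text \<open>The functions are defined and bounded on the whole space, so that they can be translated
  freely, but \<open>G\<close> is the gradient of \<open>u\<close> only as seen by test functions supported in \<open>\<Omega>\<close>.\<close>

locale bounded_weak_gradient =
  fixes \<Omega> :: "(real^'d) set" and u :: "real^'d \<Rightarrow> real^'k" and G :: "real^'d \<Rightarrow> real^'d^'k" and C \<rho> :: real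
  assumes u_measurable[measurable]: "u \<in> borel_measurable borel"
    and G_measurable[measurable]: "G \<in> borel_measurable borel"
    and u_bound: "\<And>x. norm (u x) \<le> C" and G_bound: "\<And>x. norm (G x) \<le> C"
    and G_support: "\<And>x. x \<notin> cball 0 \<rho> \<Longrightarrow> G x = 0"
    and weak: "\<And>\<psi> i v. \<psi> \<in> test_functions \<Omega> \<Longrightarrow>
      (\<integral>x. u x $ i * frechet_derivative \<psi> (at x) v \<partial>lborel) = - (\<integral>x. (G x $ i \<bullet> v) * \<psi> x \<partial>lborel)"
begin

lemma increment:
  assumes "ball c R \<subseteq> \<Omega>"
  shows "AE x in lborel. x \<in> ball c R \<and> x + h \<in> ball c R \<longrightarrow>
    (\<forall>i. u (x + h) $ i - u x $ i = (\<integral>t. indicator {0..1} t * (G (x + t *\<^sub>R h) $ i \<bullet> h) \<partial>lborel))"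
proof -
  let ?B = "{x. x \<in> ball c R \<and> x + h \<in> ball c R}"
  have "?B = ball c R \<inter> ball (c - h) R" by (auto simp: dist_norm algebra_simps)
  then have "open ?B" by (metis open_Int open_ball)
  have in\<Omega>: "x + t *\<^sub>R h \<in> \<Omega>" if "x \<in> ?B" "t \<in> {0..1}" for x t
  proof -
    have "(1 - t) *\<^sub>R x + t *\<^sub>R (x + h) \<in> ball c R"
      using that by (intro convexD[OF convex_ball]) auto
    moreover have "(1 - t) *\<^sub>R x + t *\<^sub>R (x + h) = x + t *\<^sub>R h" by (simp add: algebra_simps)
    ultimately show ?thesis using assms by auto
  qed
  have "AE x in lborel. x \<in> ?B \<longrightarrow>
    u (x + h) $ i - u x $ i = (\<integral>t. indicator {0..1} t * (G (x + t *\<^sub>R h) $ i \<bullet> h) \<partial>lborel)" for i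
  proof (rule increment_eq_segment_integral_of_weak_gradient[where C=C])
    show "\<bar>u x $ i\<bar> \<le> C" for x using component_le_norm_cart[of "u x" i] u_bound[of x] by linarith
    show "norm (G x $ i) \<le> C" for x using Finite_Cartesian_Product.norm_nth_le[of "G x" i] G_bound[of x] by linarith
    show "(\<lambda>x. u x $ i) \<in> borel_measurable borel" "(\<lambda>x. G x $ i) \<in> borel_measurable borel"
      by measurable
  qed (use weak \<open>open ?B\<close> in\<Omega> in auto)
  then have "AE x in lborel. \<forall>i. x \<in> ?B \<longrightarrow>
    u (x + h) $ i - u x $ i = (\<integral>t. indicator {0..1} t * (G (x + t *\<^sub>R h) $ i \<bullet> h) \<partial>lborel)"
    unfolding AE_all_countable by blast
  then show ?thesis by eventually_elim auto
qed

lemma C_nonneg: "0 \<le> C"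
  using u_bound[of 0] norm_ge_zero order.trans by blast

lemma G_row_inner_bound: "\<bar>G x $ i \<bullet> h\<bar> \<le> C * norm h"
  using Cauchy_Schwarz_ineq2[of "G x $ i" h] G_bound[of x] Finite_Cartesian_Product.norm_nth_le[of "G x" i]
  by (meson mult_right_mono norm_ge_zero order.trans)

text \<open>By the formula for increments, \<open>norm (u y - u x) \<le> L * norm (y - x)\<close> holds for almost all pairs.
  Hence almost every \<open>x\<close> satisfies this for almost every \<open>y\<close>, and two such points can be compared
  through a third one. So \<open>u\<close> is Lipschitz on a set of full measure, which is dense in the ball.\<close>

lemma lipschitz_representative:
  assumes "ball c R \<subseteq> \<Omega>"
  obtains v L where "L-lipschitz_on (ball c R) v" "AE x in lborel. x \<in> ball c R \<longrightarrow> v x = u x"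
proof -
  define L where "L = real CARD('k) * C"
  have L: "0 \<le> L" using C_nonneg by (simp add: L_def)
  have "AE x in lborel. x \<in> ball c R \<and> x + h \<in> ball c R \<longrightarrow> norm (u (x + h) - u x) \<le> L * norm h" for h
    using increment[OF assms, of h]
  proof eventually_elim
    case (elim x)
    show ?case
    proof
      assume x: "x \<in> ball c R \<and> x + h \<in> ball c R"
      have "\<bar>(u (x + h) - u x) $ i\<bar> \<le> C * norm h" for i
      proof -
        have "\<bar>\<integral>t. indicator {0..1} t * (G (x + t *\<^sub>R h) $ i \<bullet> h) \<partial>lborel\<bar> \<le>
            (\<integral>t. \<bar>indicator {0..1} t * (G (x + t *\<^sub>R h) $ i \<bullet> h)\<bar> \<partial>lborel)"
          by (rule integral_abs_bound)
        also have "\<dots> \<le> (\<integral>t. C * norm h * indicator {0..1::real} t \<partial>lborel)"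
        proof (rule integral_mono')
          show "integrable lborel (\<lambda>t. C * norm h * indicator {0..1::real} t)"
            by (intro integrable_mult_right integrable_real_indicator) auto
        qed (use G_row_inner_bound C_nonneg in \<open>auto simp: indicator_def\<close>)
        finally show ?thesis using elim x by simp
      qed
      then have "(\<Sum>i\<in>UNIV. \<bar>(u (x + h) - u x) $ i\<bar>) \<le> (\<Sum>i\<in>(UNIV::'k set). C * norm h)"
        by (intro sum_mono) auto
      then show "norm (u (x + h) - u x) \<le> L * norm h"
        using norm_le_l1_cart[of "u (x + h) - u x"] by (simp add: L_def)
    qed
  qed
  then have "AE h in lborel. AE x in lborel. x \<in> ball c R \<and> x + h \<in> ball c R \<longrightarrow> norm (u (x + h) - u x) \<le> L * norm h"
    by simp
  then have "AE x in lborel. AE h in lborel. x \<in> ball c R \<and> x + h \<in> ball c R \<longrightarrow> norm (u (x + h) - u x) \<le> L * norm h"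
  proof (subst lborel_pair.AE_commute)
    have [measurable]: "ball c R \<in> sets borel" by simp
    show "{p \<in> space (lborel \<Otimes>\<^sub>M lborel). fst p \<in> ball c R \<and> fst p + snd p \<in> ball c R \<longrightarrow>
        norm (u (fst p + snd p) - u (fst p)) \<le> L * norm (snd p)} \<in> sets (lborel \<Otimes>\<^sub>M lborel)"
      by measurable
  qed
  then have ae: "AE x in lborel. AE y in lborel. x \<in> ball c R \<and> y \<in> ball c R \<longrightarrow> norm (u y - u x) \<le> L * norm (y - x)"
  proof eventually_elim
    case (elim x)
    from AE_lborel_affine[OF elim, of 1 "- x"] show ?case by simp
  qed
  define S where "S = {x \<in> ball c R. AE y in lborel. y \<in> ball c R \<longrightarrow> norm (u y - u x) \<le> L * norm (y - x)}"
  have aeS: "AE x in lborel. x \<in> ball c R \<longrightarrow> x \<in> S"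
    using ae by eventually_elim (auto simp: S_def)
  have "dist (u x) (u y) \<le> L * dist x y" if "x \<in> S" "y \<in> S" for x y
  proof (rule field_le_epsilon)
    fix e :: real assume "0 < e"
    \<comment> \<open>the summand \<open>1\<close> only avoids a division by zero\<close>
    define d where "d = e / (2 * L + 1)"
    have "0 < d" using \<open>0 < e\<close> L by (simp add: d_def)
    have "open (ball c R \<inter> ball x d)" "x \<in> ball c R \<inter> ball x d"
      using that \<open>0 < d\<close> by (auto simp: S_def)
    moreover have "AE z in lborel. (z \<in> ball c R \<longrightarrow> norm (u z - u x) \<le> L * norm (z - x)) \<and>
        (z \<in> ball c R \<longrightarrow> norm (u z - u y) \<le> L * norm (z - y))"
      using that by (auto simp: S_def)
    ultimately obtain z where z: "z \<in> ball c R \<inter> ball x d" "norm (u z - u x) \<le> L * norm (z - x)"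
      "norm (u z - u y) \<le> L * norm (z - y)"
      using AE_lborel_meets_open by (metis (no_types, lifting) IntD1 empty_iff)
    have "norm (z - x) \<le> d" using z(1) by (auto simp: dist_norm norm_minus_commute)
    moreover have "norm (z - y) \<le> d + dist x y"
      using \<open>norm (z - x) \<le> d\<close> norm_triangle_ineq[of "z - x" "x - y"] by (simp add: dist_norm)
    ultimately have "norm (u z - u x) + norm (u z - u y) \<le> L * d + L * (d + dist x y)"
      using z(2,3) L by (meson add_mono mult_left_mono order.trans)
    moreover have "dist (u x) (u y) \<le> norm (u z - u x) + norm (u z - u y)"
      using dist_triangle3[of "u x" "u y" "u z"] by (simp add: dist_norm norm_minus_commute)
    moreover have "2 * L * d \<le> e" using L \<open>0 < e\<close> by (simp add: d_def field_simps)
    ultimately show "dist (u x) (u y) \<le> L * dist x y + e" by (simp add: algebra_simps)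
  qed
  then have "L-lipschitz_on S u" using L by (auto simp: lipschitz_on_def)
  then obtain v where v: "L-lipschitz_on (closure S) v" "\<And>x. x \<in> S \<Longrightarrow> v x = u x"
    using lipschitz_extend_closure by metis
  have "ball c R \<subseteq> closure S"
  proof
    fix x assume x: "x \<in> ball c R"
    show "x \<in> closure S"
      unfolding closure_approachable
    proof (intro allI impI)
      fix e :: real assume "0 < e"
      then have "open (ball c R \<inter> ball x e)" "ball c R \<inter> ball x e \<noteq> {}" using x by force+
      from AE_lborel_meets_open[OF aeS this]
      obtain z where "z \<in> ball c R \<inter> ball x e" "z \<in> ball c R \<longrightarrow> z \<in> S" .
      then show "\<exists>y\<in>S. dist y x < e" by (auto simp: dist_commute)
    qed
  qed
  then have "L-lipschitz_on (ball c R) v" using v(1) lipschitz_on_subset by blast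
  moreover have "AE x in lborel. x \<in> ball c R \<longrightarrow> v x = u x"
    using aeS by eventually_elim (use v(2) in auto)
  ultimately show thesis by (rule that)
qed

text \<open>The difference quotient is the mean of \<open>G x *v e\<close> over a segment of length proportional to the step
  size, and along a blow-up sequence these means converge almost everywhere. The step sizes
  may depend on the direction \<open>e\<close>.\<close>

lemma difference_quotients_converge:
  assumes "ball c R \<subseteq> \<Omega>" and v: "AE x in lborel. x \<in> ball c R \<longrightarrow> v x = u x"
  obtains h where "\<And>l::nat. 0 < h l" "h \<longlonglongrightarrow> 0"
    "AE x in lborel. x \<in> ball c R \<longrightarrow> (\<lambda>l. (v (x + h l *\<^sub>R e) - v x) /\<^sub>R h l) \<longlonglongrightarrow> G x *v e"
proof -
  let ?i = "indicator {0..1} :: real \<Rightarrow> real"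
  let ?\<mu> = "restrict_space lborel {0..1::real}"
  have "finite_measure ?\<mu>"
    by (intro finite_measureI) (simp add: space_restrict_space emeasure_restrict_space)
  moreover have "(\<lambda>t. t *\<^sub>R e) \<in> borel_measurable ?\<mu>"
    by (intro measurable_restrict_space1) simp
  ultimately obtain h where h: "\<And>l::nat. 0 < h l" "h \<longlonglongrightarrow> 0"
    and lim: "AE x in lborel. AE t in ?\<mu>. (\<lambda>l. G (x + h l *\<^sub>R (t *\<^sub>R e))) \<longlonglongrightarrow> G x"
    using AE_blow_up_sequence[OF G_measurable G_bound, of \<rho> ?\<mu> "\<lambda>t. t *\<^sub>R e"] G_support by blast
  have "AE x in lborel. \<forall>l. x + h l *\<^sub>R e \<in> ball c R \<longrightarrow> v (x + h l *\<^sub>R e) = u (x + h l *\<^sub>R e)"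
    unfolding AE_all_countable
  proof
    fix l
    show "AE x in lborel. x + h l *\<^sub>R e \<in> ball c R \<longrightarrow> v (x + h l *\<^sub>R e) = u (x + h l *\<^sub>R e)"
      using AE_lborel_affine[OF v, of 1 "h l *\<^sub>R e"] by (simp only: scaleR_one add.commute)
  qed
  moreover have "AE x in lborel. \<forall>l. x \<in> ball c R \<and> x + h l *\<^sub>R e \<in> ball c R \<longrightarrow>
    (\<forall>i. u (x + h l *\<^sub>R e) $ i - u x $ i = (\<integral>t. ?i t * (G (x + t *\<^sub>R (h l *\<^sub>R e)) $ i \<bullet> (h l *\<^sub>R e)) \<partial>lborel))"
    by (subst AE_all_countable) (intro allI increment[OF assms(1)])
  ultimately have "AE x in lborel. x \<in> ball c R \<longrightarrow> (\<lambda>l. (v (x + h l *\<^sub>R e) - v x) /\<^sub>R h l) \<longlonglongrightarrow> G x *v e"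
    using lim v
  proof eventually_elim
    case (elim x)
    show ?case
    proof
      assume x: "x \<in> ball c R"
      have "(\<lambda>l. x + h l *\<^sub>R e) \<longlonglongrightarrow> x + 0 *\<^sub>R e" by (intro tendsto_intros h)
      then have ev: "\<forall>\<^sub>F l in sequentially. x + h l *\<^sub>R e \<in> ball c R"
        by (rule topological_tendstoD) (use x in auto)
      show "(\<lambda>l. (v (x + h l *\<^sub>R e) - v x) /\<^sub>R h l) \<longlonglongrightarrow> G x *v e"
      proof (rule vec_tendstoI)
        fix i
        have lim_t: "AE t in lborel. t \<in> {0..1} \<longrightarrow> (\<lambda>l. G (x + h l *\<^sub>R (t *\<^sub>R e))) \<longlonglongrightarrow> G x"
          using elim(3) by (subst (asm) AE_restrict_space_iff) auto
        have "(\<lambda>l. \<integral>t. ?i t * (G (x + h l *\<^sub>R (t *\<^sub>R e)) $ i \<bullet> e) \<partial>lborel)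
            \<longlonglongrightarrow> (\<integral>t. ?i t * (G x $ i \<bullet> e) \<partial>lborel)"
        proof (rule integral_dominated_convergence[where w="\<lambda>t. C * norm e * ?i t"])
          show "integrable lborel (\<lambda>t. C * norm e * ?i t)"
            by (intro integrable_mult_right integrable_real_indicator) auto
          show "AE t in lborel. (\<lambda>l. ?i t * (G (x + h l *\<^sub>R (t *\<^sub>R e)) $ i \<bullet> e))
              \<longlonglongrightarrow> ?i t * (G x $ i \<bullet> e)"
            using lim_t by eventually_elim (auto simp: indicator_def intro!: tendsto_intros)
          show "AE t in lborel. norm (?i t * (G (x + h l *\<^sub>R (t *\<^sub>R e)) $ i \<bullet> e))
              \<le> C * norm e * ?i t" for l
            using G_row_inner_bound[of _ i e] by (intro AE_I2) (auto simp: indicator_def)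
        qed measurable
        then have "(\<lambda>l. \<integral>t. ?i t * (G (x + h l *\<^sub>R (t *\<^sub>R e)) $ i \<bullet> e) \<partial>lborel) \<longlonglongrightarrow> (G x *v e) $ i"
          by (simp add: matrix_vector_mul_component)
        moreover have "\<forall>\<^sub>F l in sequentially.
            (\<integral>t. ?i t * (G (x + h l *\<^sub>R (t *\<^sub>R e)) $ i \<bullet> e) \<partial>lborel) = ((v (x + h l *\<^sub>R e) - v x) /\<^sub>R h l) $ i"
          using ev
        proof eventually_elim
          case (elim l)
          have "v (x + h l *\<^sub>R e) = u (x + h l *\<^sub>R e)" "v x = u x"
            using elim x \<open>x \<in> ball c R \<longrightarrow> v x = u x\<close>
              \<open>\<forall>l. x + h l *\<^sub>R e \<in> ball c R \<longrightarrow> v (x + h l *\<^sub>R e) = u (x + h l *\<^sub>R e)\<close> by auto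
          then have "v (x + h l *\<^sub>R e) $ i - v x $ i =
              (\<integral>t. ?i t * (G (x + t *\<^sub>R (h l *\<^sub>R e)) $ i \<bullet> (h l *\<^sub>R e)) \<partial>lborel)"
            using elim x \<open>\<forall>l. x \<in> ball c R \<and> x + h l *\<^sub>R e \<in> ball c R \<longrightarrow> _ l\<close> by auto
          also have "\<dots> = (\<integral>t. h l * (?i t * (G (x + h l *\<^sub>R (t *\<^sub>R e)) $ i \<bullet> e)) \<partial>lborel)"
            by (intro Bochner_Integration.integral_cong) (auto simp: mult_ac)
          also have "\<dots> = h l * (\<integral>t. ?i t * (G (x + h l *\<^sub>R (t *\<^sub>R e)) $ i \<bullet> e) \<partial>lborel)"
            by simp
          finally show ?case using h(1)[of l] by (simp add: field_simps)
        qed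
        ultimately show "(\<lambda>l. ((v (x + h l *\<^sub>R e) - v x) /\<^sub>R h l) $ i) \<longlonglongrightarrow> (G x *v e) $ i"
          by (rule Lim_transform_eventually)
      qed
    qed
  qed
  with h show thesis by (rule that)
qed

end

section \<open>The tent function and the excess\<close>

text \<open>The points \<open>y l\<close> may approach \<open>z\<close> along a curve that is only differentiable along the given step
  sizes. This is the form of the chain rule that applies to \<open>P\<close> composed with a representative whose
  difference quotients converge.\<close>

lemma has_derivative_imp_difference_quotients:
  assumes f: "(f has_derivative f') (at z)" and h: "\<And>l::nat. 0 < h l" "h \<longlonglongrightarrow> 0"
    and y: "(\<lambda>l. (y l - z) /\<^sub>R h l) \<longlonglongrightarrow> a"
  shows "(\<lambda>l. (f (y l) - f z) /\<^sub>R h l) \<longlonglongrightarrow> f' a"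
proof -
  interpret f': bounded_linear f' using f by (rule has_derivative_bounded_linear)
  define err where "err v = (if v = z then 0 else (f v - f z - f' (v - z)) /\<^sub>R norm (v - z))" for v
  have "((\<lambda>v. (f v - f z - f' (v - z)) /\<^sub>R norm (v - z)) \<longlongrightarrow> 0) (at z)"
  proof (rule tendsto_norm_zero_cancel)
    have "((\<lambda>v. norm (f v - f z - f' (v - z)) / norm (v - z)) \<longlongrightarrow> 0) (at z)"
      using f by (simp add: has_derivative_iff_norm)
    then show "((\<lambda>v. norm ((f v - f z - f' (v - z)) /\<^sub>R norm (v - z))) \<longlongrightarrow> 0) (at z)"
      unfolding norm_scaleR by (simp add: divide_inverse_commute)
  qed
  then have "(err \<longlongrightarrow> 0) (at z)"
    by (rule Lim_transform_eventually) (auto simp: err_def eventually_at_filter)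
  then have err: "isCont err z" by (simp add: isCont_def err_def)
  have "(\<lambda>l. z + h l *\<^sub>R ((y l - z) /\<^sub>R h l)) \<longlonglongrightarrow> z + 0 *\<^sub>R a"
    by (intro tendsto_intros h y)
  then have "y \<longlonglongrightarrow> z" using h(1) by (simp add: less_imp_neq[THEN not_sym])
  then have "(\<lambda>l. err (y l)) \<longlonglongrightarrow> 0"
    using isCont_tendsto_compose[OF err] by (simp add: err_def)
  then have "(\<lambda>l. f' ((y l - z) /\<^sub>R h l) + norm ((y l - z) /\<^sub>R h l) *\<^sub>R err (y l)) \<longlonglongrightarrow> f' a + norm a *\<^sub>R 0"
    by (intro tendsto_intros f'.tendsto y)
  moreover have "f' ((y l - z) /\<^sub>R h l) + norm ((y l - z) /\<^sub>R h l) *\<^sub>R err (y l) = (f (y l) - f z) /\<^sub>R h l" for l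
  proof -
    have "norm ((y l - z) /\<^sub>R h l) *\<^sub>R err (y l) = (f (y l) - f z - f' (y l - z)) /\<^sub>R h l"
      unfolding norm_scaleR using h(1)[of l] by (cases "y l = z") (simp_all add: err_def f'.zero)
    then show ?thesis by (simp only: f'.scaleR) (simp add: scaleR_diff_right)
  qed
  ultimately show ?thesis by simp
qed

text \<open>The cone \<open>\<kappa> * (1 - norm x)\<close> cuts the linear function \<open>x \<bullet> \<eta>\<close> down to a function supported in the
  unit ball, at the cost of gradients of length \<open>\<kappa>\<close> only.\<close>

definition tent :: "'a::euclidean_space \<Rightarrow> real \<Rightarrow> 'a \<Rightarrow> real" where
  "tent \<eta> \<kappa> x = max 0 (min (x \<bullet> \<eta>) (\<kappa> * (1 - norm x)))"

text \<open>The value \<open>0\<close> covers the complement of the support as well as the null set of kinks.\<close>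

definition tent_grad :: "'a::euclidean_space \<Rightarrow> real \<Rightarrow> 'a \<Rightarrow> 'a" where
  "tent_grad \<eta> \<kappa> x =
    (if 0 < x \<bullet> \<eta> \<and> x \<bullet> \<eta> < \<kappa> * (1 - norm x) then \<eta>
     else if norm x < 1 \<and> \<kappa> * (1 - norm x) < x \<bullet> \<eta> then - \<kappa> *\<^sub>R sgn x else 0)"

context
  fixes \<eta> :: "'a::euclidean_space" and \<kappa> :: real
  assumes \<eta>: "\<eta> \<noteq> 0" and \<kappa>: "0 < \<kappa>"
begin

lemma tent_outside: "1 \<le> norm x \<Longrightarrow> tent \<eta> \<kappa> x = 0"
proof -
  assume "1 \<le> norm x"
  then have "\<kappa> * (1 - norm x) \<le> 0" using \<kappa> by (simp add: mult_le_0_iff)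
  then show ?thesis by (simp add: tent_def)
qed

lemma tent_bounds: "0 \<le> tent \<eta> \<kappa> x" "tent \<eta> \<kappa> x \<le> \<kappa>"
proof -
  have "\<kappa> * (1 - norm x) \<le> \<kappa>" using \<kappa> by (simp add: algebra_simps)
  then show "0 \<le> tent \<eta> \<kappa> x" "tent \<eta> \<kappa> x \<le> \<kappa>" using \<kappa> by (auto simp: tent_def min_le_iff_disj)
qed

lemma tent_lipschitz: "\<bar>tent \<eta> \<kappa> x - tent \<eta> \<kappa> y\<bar> \<le> (norm \<eta> + \<kappa>) * norm (x - y)"
proof -
  have 1: "\<bar>x \<bullet> \<eta> - y \<bullet> \<eta>\<bar> \<le> norm \<eta> * norm (x - y)"
    using Cauchy_Schwarz_ineq2[of "x - y" \<eta>] by (simp add: inner_diff_left mult.commute)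
  have "\<bar>\<kappa> * (1 - norm x) - \<kappa> * (1 - norm y)\<bar> = \<kappa> * \<bar>norm x - norm y\<bar>"
    using \<kappa> by (simp add: abs_mult flip: right_diff_distrib)
  also have "\<dots> \<le> \<kappa> * norm (x - y)"
    using \<kappa> by (intro mult_left_mono norm_triangle_ineq3) auto
  finally have 2: "\<bar>\<kappa> * (1 - norm x) - \<kappa> * (1 - norm y)\<bar> \<le> \<kappa> * norm (x - y)" .
  have 3: "0 \<le> norm \<eta> * norm (x - y)" "0 \<le> \<kappa> * norm (x - y)" using \<kappa> by auto
  have "\<bar>max 0 (min a b) - max 0 (min a' b')\<bar> \<le> A + B"
    if "\<bar>a - a'\<bar> \<le> A" "\<bar>b - b'\<bar> \<le> B" "0 \<le> A" "0 \<le> B" for a a' b b' A B :: real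
    using that unfolding max_def min_def by (smt (verit))
  from this[OF 1 2 3] show ?thesis unfolding tent_def distrib_right .
qed

lemma tent_grad_measurable[measurable]: "tent_grad \<eta> \<kappa> \<in> borel_measurable borel"
  unfolding tent_grad_def[abs_def] by measurable

lemma tent_grad_bound: "norm (tent_grad \<eta> \<kappa> x) \<le> norm \<eta> + \<kappa>"
  using \<kappa> by (auto simp: tent_grad_def norm_sgn)

lemma tent_grad_outside: "1 \<le> norm x \<Longrightarrow> tent_grad \<eta> \<kappa> x = 0"
proof -
  assume "1 \<le> norm x"
  then have "\<kappa> * (1 - norm x) \<le> 0" using \<kappa> by (simp add: mult_le_0_iff)
  then show ?thesis using \<open>1 \<le> norm x\<close> by (auto simp: tent_grad_def)
qed

text \<open>The tent is smooth off a hyperplane, a sphere, and the surface where the linear function meets the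
  cone. Every ray from the origin meets the latter at most once, so that it is negligible.\<close>

lemma tent_has_derivative:
  "AE x in lborel. (tent \<eta> \<kappa> has_derivative (\<lambda>h. tent_grad \<eta> \<kappa> x \<bullet> h)) (at x)"
proof -
  let ?S = "{x. x \<bullet> \<eta> = \<kappa> * (1 - norm x)}"
  have "negligible ?S"
  proof (rule starlike_negligible[where a=0])
    show "closed ?S" by (intro closed_Collect_eq continuous_intros)
    fix c x assume c: "0 + c *\<^sub>R x \<in> ?S" "0 \<le> c" "0 + x \<in> ?S"
    from c(1,2) have 1: "c * (x \<bullet> \<eta> + \<kappa> * norm x) = \<kappa>" by (simp add: algebra_simps)
    from c(3) have 2: "x \<bullet> \<eta> + \<kappa> * norm x = \<kappa>" by (simp add: algebra_simps)
    show "c = 1" using 1 \<kappa> unfolding 2 by simp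
  qed
  then have "AE x in lborel. x \<notin> ?S" by (rule AE_lborel_notin_negligible)
  moreover have "AE x in lborel. x \<notin> {x. \<eta> \<bullet> x = 0}"
    using \<eta> by (intro AE_lborel_notin_negligible negligible_hyperplane) auto
  moreover have "AE x in lborel. x \<notin> sphere (0::'a) 1"
    by (rule AE_lborel_notin_negligible[OF negligible_sphere])
  ultimately show ?thesis
  proof eventually_elim
    case (elim x)
    have ne: "x \<bullet> \<eta> \<noteq> \<kappa> * (1 - norm x)" "x \<bullet> \<eta> \<noteq> 0" "norm x \<noteq> 1"
      using elim by (auto simp: inner_commute)
    consider "x \<bullet> \<eta> < 0 \<or> 1 < norm x" | "0 < x \<bullet> \<eta>" "x \<bullet> \<eta> < \<kappa> * (1 - norm x)"
      | "norm x < 1" "\<kappa> * (1 - norm x) < x \<bullet> \<eta>"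
      using ne \<kappa> by (auto simp: neq_iff)
    then show ?case
    proof cases
      case 1
      have g: "tent_grad \<eta> \<kappa> x = 0"
        using 1 \<kappa> tent_grad_outside[of x] by (auto simp: tent_grad_def) (smt (verit) mult_nonneg_nonneg)
      show ?thesis unfolding g
        by (rule has_derivative_transform_within_open[of "\<lambda>_. 0" _ _ _ "{x. x \<bullet> \<eta> < 0 \<or> 1 < norm x}"])
           (use 1 tent_outside in \<open>auto simp: tent_def intro!: open_Collect_disj open_Collect_less continuous_intros\<close>)
    next
      case 2
      then have g: "tent_grad \<eta> \<kappa> x = \<eta>" by (simp add: tent_grad_def)
      show ?thesis unfolding g
        by (rule has_derivative_transform_within_open[of "\<lambda>x. x \<bullet> \<eta>" _ _ _
              "{x. 0 < x \<bullet> \<eta> \<and> x \<bullet> \<eta> < \<kappa> * (1 - norm x)}"])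
           (use 2 in \<open>auto simp: tent_def inner_commute
              intro!: derivative_eq_intros open_Collect_conj open_Collect_less continuous_intros\<close>)
    next
      case 3
      then have g: "tent_grad \<eta> \<kappa> x = - \<kappa> *\<^sub>R sgn x" by (simp add: tent_grad_def)
      have "0 < \<kappa> * (1 - norm x)" using 3 \<kappa> by simp
      then have "x \<noteq> 0" using 3 by auto
      then have "((\<lambda>x. \<kappa> * (1 - norm x)) has_derivative (\<lambda>h. (- \<kappa> *\<^sub>R sgn x) \<bullet> h)) (at x)"
        by (auto intro!: derivative_eq_intros has_derivative_norm simp: inner_commute)
      then show ?thesis unfolding g
        by (rule has_derivative_transform_within_open[of _ _ _ _
              "{x. norm x < 1 \<and> \<kappa> * (1 - norm x) < x \<bullet> \<eta>}"])
           (use 3 \<kappa> in \<open>auto simp: tent_def intro!: open_Collect_conj open_Collect_less continuous_intros\<close>)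
    qed
  qed
qed

text \<open>By translation invariance the difference quotients of a Lipschitz function with compact support
  have integral zero.\<close>

lemma integral_tent_grad: "(\<integral>x. tent_grad \<eta> \<kappa> x \<bullet> v \<partial>lborel) = 0"
proof -
  have "continuous_on UNIV (tent \<eta> \<kappa>)"
    unfolding tent_def[abs_def] by (intro continuous_intros)
  then have [measurable]: "tent \<eta> \<kappa> \<in> borel_measurable borel" by (rule borel_measurable_continuous_onI)
  define h where "h l = inverse (real (Suc l))" for l
  have h: "0 < h l" "h l \<le> 1" "h \<longlonglongrightarrow> 0" for l
    unfolding h_def using LIMSEQ_inverse_real_of_nat by (auto simp: field_simps)
  have ti: "integrable lborel (tent \<eta> \<kappa>)"
    by (rule integrable_bounded_support[of _ \<kappa> 1]) (use tent_bounds tent_outside in auto)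
  have "(\<integral>x. (tent \<eta> \<kappa> (x + h l *\<^sub>R v) - tent \<eta> \<kappa> x) / h l \<partial>lborel) = 0" for l
    using lborel_integral_translate[of "tent \<eta> \<kappa>" "h l *\<^sub>R v"] ti by simp
  moreover have "(\<lambda>l. \<integral>x. (tent \<eta> \<kappa> (x + h l *\<^sub>R v) - tent \<eta> \<kappa> x) / h l \<partial>lborel)
      \<longlonglongrightarrow> (\<integral>x. tent_grad \<eta> \<kappa> x \<bullet> v \<partial>lborel)"
  proof (rule integral_dominated_convergence[where
      w="\<lambda>x. (norm \<eta> + \<kappa>) * norm v * indicator (cball 0 (1 + norm v)) x"])
    show "integrable lborel (\<lambda>x. (norm \<eta> + \<kappa>) * norm v * indicat_real (cball 0 (1 + norm v)) x)"
      by (intro integrable_mult_right integrable_real_indicator emeasure_lborel_cball_finite) simp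
    show "AE x in lborel. (\<lambda>l. (tent \<eta> \<kappa> (x + h l *\<^sub>R v) - tent \<eta> \<kappa> x) / h l) \<longlonglongrightarrow> tent_grad \<eta> \<kappa> x \<bullet> v"
      using tent_has_derivative
    proof eventually_elim
      case (elim x)
      have "(\<lambda>l. (x + h l *\<^sub>R v - x) /\<^sub>R h l) \<longlonglongrightarrow> v"
        using h(1) by (simp add: less_imp_neq[THEN not_sym])
      from has_derivative_imp_difference_quotients[OF elim h(1,3) this]
      show ?case by (simp add: divide_inverse mult.commute)
    qed
    show "AE x in lborel. norm ((tent \<eta> \<kappa> (x + h l *\<^sub>R v) - tent \<eta> \<kappa> x) / h l)
        \<le> (norm \<eta> + \<kappa>) * norm v * indicator (cball 0 (1 + norm v)) x" for l
    proof (rule AE_I2)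
      fix x
      show "norm ((tent \<eta> \<kappa> (x + h l *\<^sub>R v) - tent \<eta> \<kappa> x) / h l)
        \<le> (norm \<eta> + \<kappa>) * norm v * indicator (cball 0 (1 + norm v)) x"
      proof (cases "x \<in> cball 0 (1 + norm v)")
        case True
        have "\<bar>tent \<eta> \<kappa> (x + h l *\<^sub>R v) - tent \<eta> \<kappa> x\<bar> \<le> (norm \<eta> + \<kappa>) * (h l * norm v)"
          using tent_lipschitz[of "x + h l *\<^sub>R v" x] h(1)[of l] by simp
        then show ?thesis using True h(1)[of l] by (simp add: abs_divide divide_le_eq mult_ac)
      next
        case False
        have "norm (h l *\<^sub>R v) \<le> norm v" using h(1,2)[of l] by (simp add: mult_left_le_one_le)
        then have "1 \<le> norm (x + h l *\<^sub>R v)" "1 \<le> norm x"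
          using False norm_triangle_ineq4[of "x + h l *\<^sub>R v" "h l *\<^sub>R v"] norm_ge_zero[of v]
          by (auto simp del: norm_ge_zero norm_scaleR)
        then show ?thesis using tent_outside \<kappa> by simp
      qed
    qed
  qed measurable
  ultimately show ?thesis by (simp only: LIMSEQ_const_iff)
qed

end

text \<open>Write \<open>g v = f v - f 0 - f' v\<close>. Since \<open>f'\<close> of the gradient of the tent integrates to zero, the integral
  of \<open>g\<close> along this gradient is nonnegative. On the region \<open>R \<kappa>\<close>, where the gradient is \<open>\<eta>\<close>, the integrand is the
  constant \<open>g \<eta>\<close>; elsewhere it is \<open>o(\<kappa>)\<close>. If \<open>g \<eta>\<close> were negative, it would have to be compensated by the
  error, but the measure of \<open>R \<kappa>\<close> is at least a constant times \<open>\<kappa>\<close>. For this bound the vanishing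
  integral is tested with \<open>\<eta>\<close>: what \<open>R \<kappa>\<close> contributes must balance the contribution of the region
  \<open>S \<kappa>\<close> under the cone, where the gradient is \<open>- \<kappa> *\<^sub>R sgn x\<close>, and that region only grows as \<open>\<kappa>\<close> decreases.\<close>

lemma excess_nonneg_if_tent_integrals_nonneg:
  fixes f :: "'a::euclidean_space \<Rightarrow> real"
  assumes f': "(f has_derivative f') (at 0)" and cont: "continuous_on UNIV f" and \<eta>: "\<eta> \<noteq> 0"
    and int: "\<And>\<kappa>. 0 < \<kappa> \<Longrightarrow> \<kappa> < 1 \<Longrightarrow>
      0 \<le> (\<integral>x. indicator (ball 0 1) x * (f (tent_grad \<eta> \<kappa> x) - f 0) \<partial>lborel)"
  shows "0 \<le> f \<eta> - f 0 - f' \<eta>"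
proof (rule ccontr)
  define g where "g v = f v - f 0 - f' v" for v
  assume "\<not> 0 \<le> f \<eta> - f 0 - f' \<eta>"
  then have neg: "g \<eta> < 0" by (simp add: g_def)
  interpret f': bounded_linear f' using f' by (rule has_derivative_bounded_linear)
  have [measurable]: "f \<in> borel_measurable borel" using cont by (rule borel_measurable_continuous_onI)
  have [measurable]: "f' \<in> borel_measurable borel"
    by (intro borel_measurable_continuous_onI f'.continuous_on continuous_intros)
  have [measurable]: "g \<in> borel_measurable borel" unfolding g_def[abs_def] by measurable
  have [measurable]: "ball (0::'a) 1 \<in> sets borel" by simp
  define S where "S \<kappa> = {x. norm x < 1 \<and> \<kappa> * (1 - norm x) < x \<bullet> \<eta>}" for \<kappa>
  define R where "R \<kappa> = {x. 0 < x \<bullet> \<eta> \<and> x \<bullet> \<eta> < \<kappa> * (1 - norm x)}" for \<kappa>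
  have openS: "open (S \<kappa>)" and openR: "open (R \<kappa>)" for \<kappa>
    unfolding S_def R_def by (intro open_Collect_conj open_Collect_less continuous_intros)+
  have [measurable]: "S \<kappa> \<in> sets borel" "R \<kappa> \<in> sets borel" for \<kappa>
    using openS openR by auto
  have Sball: "S \<kappa> \<subseteq> ball 0 1" for \<kappa> by (auto simp: S_def)
  have Rball: "R \<kappa> \<subseteq> ball 0 1" if "0 < \<kappa>" for \<kappa>
  proof
    fix x assume "x \<in> R \<kappa>"
    then have "0 < \<kappa> * (1 - norm x)" by (auto simp: R_def)
    then show "x \<in> ball 0 1" using that by (simp add: zero_less_mult_iff)
  qed
  have intb: "integrable lborel (\<lambda>x. indicator A x * k x)"
    if [measurable]: "A \<in> sets borel" "k \<in> borel_measurable borel" and "A \<subseteq> ball 0 1" "\<And>x. \<bar>k x\<bar> \<le> E"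
    for A and k :: "'a \<Rightarrow> real" and E
  proof (rule integrable_bounded_support[of _ E 1])
    show "norm (indicator A x * k x) \<le> E" for x
      using that(4)[of x] abs_ge_zero[of "k x"] by (auto simp: indicator_def)
  qed (use that(3) in \<open>auto simp: indicator_def\<close>)
  define V where "V = measure lborel (ball (0::'a) 1)"
  have V: "(\<integral>x. indicator (ball (0::'a) 1) x * a \<partial>lborel) = a * V" for a :: real
    by (simp add: V_def)
  have "0 \<le> V" by (simp add: V_def)
  have sgnb: "\<bar>sgn x \<bullet> \<eta>\<bar> \<le> norm \<eta>" for x
    using Cauchy_Schwarz_ineq2[of "sgn x" \<eta>] by (auto simp: norm_sgn split: if_splits)
  have sgnS: "0 < sgn x \<bullet> \<eta>" if "x \<in> S \<kappa>" "0 < \<kappa>" for x \<kappa>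
  proof -
    have "0 < \<kappa> * (1 - norm x)" "\<kappa> * (1 - norm x) < x \<bullet> \<eta>" using that by (auto simp: S_def)
    then have "0 < x \<bullet> \<eta>" "x \<noteq> 0" by auto
    then show ?thesis by (simp add: sgn_div_norm)
  qed
  define c where "c = (\<integral>x. indicator (S (1/2)) x * (sgn x \<bullet> \<eta>) \<partial>lborel)"
  have ci: "integrable lborel (\<lambda>x. indicator (S \<kappa>) x * (sgn x \<bullet> \<eta>))" for \<kappa>
    by (rule intb[OF _ _ Sball sgnb]) measurable
  have nn: "0 \<le> indicator (S \<kappa>) x * (sgn x \<bullet> \<eta>)" if "0 < \<kappa>" for x \<kappa>
    using sgnS[of x \<kappa>] that by (auto simp: indicator_def)
  have "0 < c"
  proof -
    have "0 \<le> c" unfolding c_def by (rule Bochner_Integration.integral_nonneg) (simp add: nn)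
    moreover have "c \<noteq> 0"
    proof
      assume "c = 0"
      then have "AE x in lborel. indicator (S (1/2)) x * (sgn x \<bullet> \<eta>) = 0"
        using integral_nonneg_eq_0_iff_AE[OF ci] nn by (auto simp: c_def)
      moreover have "S (1/2) \<noteq> {}"
      proof -
        have "\<exists>t. 0 < t \<and> t < 1 \<and> 1/2 * (1 - t) < t * a" if "0 < a" for a :: real
          using that by (intro exI[of _ "(1 + a) / (1 + 2 * a)"]) (simp add: field_simps add_pos_pos)
        then obtain t where t: "0 < t" "t < 1" and "1/2 * (1 - t) < t * norm \<eta>"
          using \<eta> zero_less_norm_iff by blast
        moreover have "sgn \<eta> \<bullet> \<eta> = norm \<eta>" using \<eta> by (simp add: sgn_div_norm dot_square_norm power2_eq_square)
        ultimately have "t *\<^sub>R sgn \<eta> \<in> S (1/2)" using t \<eta> by (simp add: S_def norm_sgn)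
        then show ?thesis by blast
      qed
      ultimately obtain x where "x \<in> S (1/2)" "indicator (S (1/2)) x * (sgn x \<bullet> \<eta>) = 0"
        using AE_lborel_meets_open[OF _ openS, of "\<lambda>x. indicator (S (1/2)) x * (sgn x \<bullet> \<eta>) = 0" "1/2"] by blast
      then show False using sgnS[of x "1/2"] by simp
    qed
    ultimately show ?thesis by simp
  qed
  \<comment> \<open>so small that \<open>\<epsilon> * V\<close>, the error per \<open>\<kappa>\<close>, is less than \<open>- c * g \<eta> / (norm \<eta>)\<^sup>2\<close>\<close>
  define \<epsilon> where "\<epsilon> = - (c * g \<eta> / (norm \<eta>)\<^sup>2) / (2 * (V + 1))"
  have "0 < \<epsilon>" unfolding \<epsilon>_def using \<open>0 < c\<close> neg \<eta> \<open>0 \<le> V\<close>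
    by (intro divide_pos_pos) (auto simp: divide_neg_pos mult_pos_neg)
  obtain \<delta> where \<delta>: "0 < \<delta>" "\<And>v. norm v < \<delta> \<Longrightarrow> \<bar>g v\<bar> \<le> \<epsilon> * norm v"
    using f' \<open>0 < \<epsilon>\<close> unfolding has_derivative_at_alt by (force simp: g_def)
  \<comment> \<open>the bound \<open>1/2\<close> ensures that \<open>S (1/2)\<close> is contained in \<open>S \<kappa>\<close>\<close>
  define \<kappa> where "\<kappa> = min (1/2) (\<delta> / 2)"
  have \<kappa>: "0 < \<kappa>" "\<kappa> \<le> 1/2" "\<kappa> < \<delta>" using \<delta>(1) by (auto simp: \<kappa>_def)
  let ?t = "tent_grad \<eta> \<kappa>" and ?b = "indicator (ball (0::'a) 1) :: 'a \<Rightarrow> real"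
  let ?s = "\<lambda>\<kappa> x. indicator (S \<kappa>) x * (sgn x \<bullet> \<eta>)"
  note tg = tent_grad_measurable[OF \<eta> \<kappa>(1)]
  have grad: "?t x = (if x \<in> R \<kappa> then \<eta> else if x \<in> S \<kappa> then - \<kappa> *\<^sub>R sgn x else 0)" for x
    by (simp add: tent_grad_def R_def S_def)
  have "\<kappa> * c \<le> measure lborel (R \<kappa>) * (norm \<eta>)\<^sup>2"
  proof -
    have "0 = (\<integral>x. ?t x \<bullet> \<eta> \<partial>lborel)" using integral_tent_grad[OF \<eta> \<kappa>(1)] by simp
    also have "\<dots> = (\<integral>x. indicator (R \<kappa>) x * (norm \<eta>)\<^sup>2 - \<kappa> * (?s \<kappa> x) \<partial>lborel)"
    proof (rule Bochner_Integration.integral_cong[OF refl])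
      fix x
      show "?t x \<bullet> \<eta> = indicator (R \<kappa>) x * (norm \<eta>)\<^sup>2 - \<kappa> * (?s \<kappa> x)"
        unfolding grad by (auto simp: indicator_def R_def S_def dot_square_norm)
    qed
    also have "\<dots> = measure lborel (R \<kappa>) * (norm \<eta>)\<^sup>2 - \<kappa> * (\<integral>x. ?s \<kappa> x \<partial>lborel)"
      using ci[of \<kappa>] intb[of "R \<kappa>" "\<lambda>_. (norm \<eta>)\<^sup>2" "(norm \<eta>)\<^sup>2"] Rball[OF \<kappa>(1)] by simp
    finally have "measure lborel (R \<kappa>) * (norm \<eta>)\<^sup>2 = \<kappa> * (\<integral>x. ?s \<kappa> x \<partial>lborel)"
      by simp
    moreover have "c \<le> (\<integral>x. ?s \<kappa> x \<partial>lborel)"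
      unfolding c_def
    proof (rule integral_mono[OF ci ci])
      fix x
      have "x \<in> S \<kappa>" if "x \<in> S (1/2)"
      proof -
        have "\<kappa> * (1 - norm x) \<le> 1/2 * (1 - norm x)" using that \<kappa> by (intro mult_right_mono) (auto simp: S_def)
        then show ?thesis using that unfolding S_def mem_Collect_eq by (blast intro: order.strict_trans1)
      qed
      then show "?s (1/2) x \<le> ?s \<kappa> x"
        using nn[of \<kappa> x] \<kappa> by (auto simp: indicator_def)
    qed
    ultimately show ?thesis using \<kappa>(1) by (simp add: mult_left_mono)
  qed
  then have low: "\<kappa> * (c / (norm \<eta>)\<^sup>2) \<le> measure lborel (R \<kappa>)"
    using \<eta> by (simp add: field_simps)
  have gb: "\<bar>?b x * k (?t x)\<bar> \<le> Sup ((\<lambda>v. \<bar>k v\<bar>) ` cball 0 (norm \<eta> + \<kappa>))"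
    if "continuous_on UNIV k" for k :: "'a \<Rightarrow> real" and x
  proof -
    have "bdd_above ((\<lambda>v. \<bar>k v\<bar>) ` cball 0 (norm \<eta> + \<kappa>))"
      using that by (intro bounded_imp_bdd_above compact_imp_bounded compact_continuous_image)
        (auto intro!: continuous_intros intro: continuous_on_subset)
    then have "\<bar>k (?t x)\<bar> \<le> Sup ((\<lambda>v. \<bar>k v\<bar>) ` cball 0 (norm \<eta> + \<kappa>))"
      using tent_grad_bound[OF \<eta> \<kappa>(1), of x] by (intro cSUP_upper) auto
    then show ?thesis using abs_ge_zero[of "k (?t x)"] by (auto simp: indicator_def)
  qed
  have gi: "integrable lborel (\<lambda>x. ?b x * k (?t x))"
    if "continuous_on UNIV k" for k :: "'a \<Rightarrow> real"
  proof (rule integrable_bounded_support[where \<rho>=1])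
    have [measurable]: "k \<in> borel_measurable borel" using that by (rule borel_measurable_continuous_onI)
    show "(\<lambda>x. ?b x * k (?t x)) \<in> borel_measurable borel"
      using tg by measurable
    show "norm (?b x * k (?t x)) \<le> Sup ((\<lambda>v. \<bar>k v\<bar>) ` cball 0 (norm \<eta> + \<kappa>))" for x
      using gb[OF that] by simp
  qed (auto simp: indicator_def)
  have f'c: "continuous_on UNIV f'" by (intro f'.continuous_on continuous_intros)
  have "f' (?t x) = (\<Sum>b\<in>Basis. f' b * (?t x \<bullet> b))" for x
    by (subst euclidean_representation[of "?t x", symmetric])
       (simp add: f'.sum f'.scaleR mult.commute)
  moreover have "integrable lborel (\<lambda>x. ?t x \<bullet> b)" for b
  proof -
    have "integrable lborel (\<lambda>x. ?b x * (?t x \<bullet> b))"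
      by (rule gi) (intro continuous_intros)
    also have "(\<lambda>x. ?b x * (?t x \<bullet> b)) = (\<lambda>x. ?t x \<bullet> b)"
      using tent_grad_outside[OF \<eta> \<kappa>(1)] by (auto simp: indicator_def fun_eq_iff)
    finally show ?thesis .
  qed
  ultimately have "(\<integral>x. f' (?t x) \<partial>lborel) = 0"
    using integral_tent_grad[OF \<eta> \<kappa>(1)] by (simp add: Bochner_Integration.integral_sum)
  moreover have "(\<lambda>x. ?b x * f' (?t x)) = (\<lambda>x. f' (?t x))"
    using tent_grad_outside[OF \<eta> \<kappa>(1)] by (auto simp: indicator_def fun_eq_iff f'.zero)
  ultimately have f'0: "(\<integral>x. ?b x * f' (?t x) \<partial>lborel) = 0" by simp
  have gc: "continuous_on UNIV g" unfolding g_def[abs_def] by (intro continuous_intros cont f'c)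
  have "0 \<le> (\<integral>x. ?b x * (f (?t x) - f 0) \<partial>lborel)"
    using \<kappa> by (intro int) auto
  also have "\<dots> = (\<integral>x. ?b x * g (?t x)
      + ?b x * f' (?t x) \<partial>lborel)"
    by (intro Bochner_Integration.integral_cong) (auto simp: g_def algebra_simps)
  also have "\<dots> = (\<integral>x. ?b x * g (?t x) \<partial>lborel)"
    using gi[OF gc] gi[OF f'c] f'0 by simp
  also have "\<dots> \<le> (\<integral>x. indicator (R \<kappa>) x * g \<eta> + ?b x * (\<epsilon> * \<kappa>) \<partial>lborel)"
  proof (rule integral_mono[OF gi[OF gc]])
    show "integrable lborel (\<lambda>x. indicator (R \<kappa>) x * g \<eta> + ?b x * (\<epsilon> * \<kappa>))"
      using intb[of "R \<kappa>" "\<lambda>_. g \<eta>" "\<bar>g \<eta>\<bar>"] intb[of "ball 0 1" "\<lambda>_. \<epsilon> * \<kappa>" "\<bar>\<epsilon> * \<kappa>\<bar>"] Rball[OF \<kappa>(1)]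
      by (intro Bochner_Integration.integrable_add) auto
    fix x
    show "?b x * g (?t x) \<le> indicator (R \<kappa>) x * g \<eta> + ?b x * (\<epsilon> * \<kappa>)"
    proof (cases "x \<in> R \<kappa>")
      case True
      then show ?thesis using Rball[OF \<kappa>(1)] \<open>0 < \<epsilon>\<close> \<kappa> by (auto simp: grad indicator_def)
    next
      case False
      then have "norm (?t x) \<le> \<kappa>" using \<kappa> by (simp add: grad norm_sgn)
      then have "\<bar>g (?t x)\<bar> \<le> \<epsilon> * \<kappa>"
        using \<delta>(2)[of "?t x"] \<kappa> \<open>0 < \<epsilon>\<close> by (smt (verit) mult_left_mono)
      then show ?thesis using False by (auto simp: indicator_def)
    qed
  qed
  also have "\<dots> = measure lborel (R \<kappa>) * g \<eta> + \<epsilon> * \<kappa> * V"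
    using intb[of "R \<kappa>" "\<lambda>_. g \<eta>" "\<bar>g \<eta>\<bar>"] intb[of "ball 0 1" "\<lambda>_. \<epsilon> * \<kappa>" "\<bar>\<epsilon> * \<kappa>\<bar>"] Rball[OF \<kappa>(1)] V
    by simp
  also have "\<dots> \<le> \<kappa> * (c / (norm \<eta>)\<^sup>2) * g \<eta> + \<epsilon> * \<kappa> * V"
    using mult_right_mono_neg[OF low, of "g \<eta>"] neg by simp
  also have "\<dots> = \<kappa> * (c * g \<eta> / (norm \<eta>)\<^sup>2 + \<epsilon> * V)" by (simp add: algebra_simps)
  finally have "0 \<le> c * g \<eta> / (norm \<eta>)\<^sup>2 + \<epsilon> * V" using \<kappa>(1) by (simp add: zero_le_mult_iff)
  moreover have "c * g \<eta> / (norm \<eta>)\<^sup>2 = - \<epsilon> * (2 * (V + 1))"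
    using \<open>0 \<le> V\<close> by (simp add: \<epsilon>_def)
  ultimately have "\<epsilon> * (V + 2) \<le> 0" by (simp add: algebra_simps)
  then show False using \<open>0 < \<epsilon>\<close> \<open>0 \<le> V\<close> by (simp add: mult_le_0_iff)
qed

section \<open>Weak gradients from difference quotients\<close>

lemma borel_measurable_vecI:
  fixes f :: "'a \<Rightarrow> 'b::euclidean_space ^ 'n"
  assumes "\<And>i. (\<lambda>x. f x $ i) \<in> borel_measurable M"
  shows "f \<in> borel_measurable M"
proof (subst borel_measurable_euclidean_space, rule ballI)
  fix b :: "'b ^ 'n" assume "b \<in> Basis"
  then obtain i c where "b = axis i c" by (auto simp: Basis_vec_def)
  then show "(\<lambda>x. f x \<bullet> b) \<in> borel_measurable M" using assms[of i] by (simp add: inner_axis)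
qed

lemma bounded_bilinear_matrix_matrix_mult:
  "bounded_bilinear ((**) :: real^'m^'n \<Rightarrow> real^'p^'m \<Rightarrow> real^'p^'n)"
  unfolding bilinear_conv_bounded_bilinear[symmetric] bilinear_def
  by (auto intro!: linearI simp: vec_eq_iff
      matrix_matrix_mult_def sum_distrib_left sum.distrib algebra_simps)

lemma bounded_bilinear_matrix_vector_mult:
  "bounded_bilinear ((*v) :: real^'m^'n \<Rightarrow> real^'m \<Rightarrow> real^'n)"
  unfolding bilinear_conv_bounded_bilinear[symmetric] bilinear_def
  by (auto intro!: linearI simp: vec_eq_iff
      matrix_vector_mult_def sum_distrib_left sum.distrib algebra_simps)

lemma bounded_bilinear_outer_product:
  "bounded_bilinear (outer_product :: real^'k \<Rightarrow> real^'d \<Rightarrow> real^'d^'k)"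
  unfolding bilinear_conv_bounded_bilinear[symmetric] bilinear_def
  by (auto intro!: linearI simp: vec_eq_iff outer_product_def algebra_simps)

lemma borel_measurable_matrix_matrix_mult:
  fixes A :: "'a \<Rightarrow> real^'m^'n" and B :: "'a \<Rightarrow> real^'p^'m"
  assumes [measurable]: "A \<in> borel_measurable M" "B \<in> borel_measurable M"
  shows "(\<lambda>x. A x ** B x) \<in> borel_measurable M"
  by (intro borel_measurable_vecI) (simp add: matrix_matrix_mult_def)

lemma outer_product_mult_vector: "outer_product a b *v h = (b \<bullet> h) *\<^sub>R a"
  by (simp add: vec_eq_iff outer_product_def matrix_vector_mult_def inner_vec_def sum_distrib_right
      sum_distrib_left mult_ac)

lemma matrix_mult_outer_product: "A ** outer_product a b = outer_product (A *v a) b"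
  by (simp add: vec_eq_iff outer_product_def matrix_matrix_mult_def matrix_vector_mult_def
      sum_distrib_left mult_ac)

lemma integrable_lebesgue_on_bounded:
  fixes f :: "'a::euclidean_space \<Rightarrow> 'b::euclidean_space"
  assumes [measurable]: "f \<in> borel_measurable borel" "S \<in> sets borel" and "bounded S"
    and E: "\<And>x. x \<in> S \<Longrightarrow> norm (f x) \<le> E"
  shows "integrable (lebesgue_on S) f"
proof -
  obtain \<rho> where "S \<subseteq> cball 0 \<rho>" using \<open>bounded S\<close> by (auto simp: bounded_iff subset_iff)
  then have "integrable lborel (\<lambda>x. indicator S x *\<^sub>R f x)"
    by (intro integrable_bounded_support[of _ "max 0 E" \<rho>])
       (auto simp: indicator_def intro: le_max_iff_disj[THEN iffD2] dest: E)
  then have "integrable lebesgue (\<lambda>x. indicator S x *\<^sub>R f x)"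
    by (subst integrable_completion) auto
  then show ?thesis by (subst integrable_restrict_space) auto
qed

lemma locally_integrable_on_bounded:
  fixes f :: "'a::euclidean_space \<Rightarrow> 'b::euclidean_space"
  assumes "f \<in> borel_measurable borel" "\<And>x. norm (f x) \<le> E"
  shows "locally_integrable_on f \<Omega>"
  unfolding locally_integrable_on_def
  using assms by (auto intro!: integrable_lebesgue_on_bounded borel_compact compact_imp_bounded)

lemma lebesgue_on_integral_eq_lborel:
  fixes f g :: "'a::euclidean_space \<Rightarrow> real"
  assumes "open \<Omega>" "g \<in> borel_measurable (lebesgue_on \<Omega>)" and f: "f \<in> borel_measurable borel"
    and "AE x in lborel. x \<in> \<Omega> \<longrightarrow> g x = f x" "\<And>x. x \<notin> \<Omega> \<Longrightarrow> f x = 0"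
  shows "(LINT x|lebesgue_on \<Omega>. g x) = (\<integral>x. f x \<partial>lborel)"
proof -
  have [simp]: "\<Omega> \<in> sets lebesgue" using assms(1) by auto
  have "(LINT x|lebesgue_on \<Omega>. g x) = (\<integral>x. indicator \<Omega> x *\<^sub>R g x \<partial>lebesgue)"
    by (subst integral_restrict_space) auto
  also have "\<dots> = (\<integral>x. f x \<partial>lebesgue)"
  proof (rule integral_cong_AE)
    show "(\<lambda>x. indicator \<Omega> x *\<^sub>R g x) \<in> borel_measurable lebesgue"
      using assms(2) by (subst (asm) borel_measurable_restrict_space_iff) auto
    show "f \<in> borel_measurable lebesgue" by (rule measurable_completion) (simp add: f)
    show "AE x in lebesgue. indicator \<Omega> x *\<^sub>R g x = f x"
      using AE_completion[OF assms(4)] by eventually_elim (use assms(5) in \<open>auto simp: indicator_def\<close>)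
  qed
  also have "\<dots> = (\<integral>x. f x \<partial>lborel)" using f by (intro integral_completion) simp
  finally show ?thesis .
qed

text \<open>Summation by parts: by translation invariance, the backward difference quotient of the test
  function can be traded for the forward difference quotient of \<open>w\<close>, and both sides converge by
  dominated convergence. Each coordinate direction may come with its own step sizes.\<close>

lemma has_weak_gradient_if_difference_quotients_converge:
  fixes w :: "real^'d \<Rightarrow> real^'k" and D :: "real^'d \<Rightarrow> real^'d^'k"
  assumes "open \<Omega>" and K: "compact K" "K \<subseteq> \<Omega>"
    and w: "continuous_on UNIV w" "\<And>x. x \<notin> K \<Longrightarrow> w x = 0"
    and D[measurable]: "D \<in> borel_measurable borel" and E: "\<And>x. norm (D x) \<le> E"
    and DK: "\<And>x. x \<notin> K \<Longrightarrow> D x = 0"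
    and dq: "\<And>j. \<exists>h. (\<forall>l::nat. 0 < h l) \<and> h \<longlonglongrightarrow> 0 \<and>
      (\<forall>\<^sub>F l in sequentially. \<forall>x. norm (w (x + h l *\<^sub>R axis j 1) - w x) \<le> L * h l) \<and>
      (AE x in lborel. (\<lambda>l. (w (x + h l *\<^sub>R axis j 1) - w x) /\<^sub>R h l) \<longlonglongrightarrow> D x *v axis j 1)"
  shows "has_weak_gradient w D \<Omega>"
proof -
  have [measurable]: "w \<in> borel_measurable borel" using w(1) by (rule borel_measurable_continuous_onI)
  obtain B where B: "0 \<le> B" "\<And>x. \<bar>norm (w x)\<bar> \<le> B"
    using continuous_compact_support_bounded[of "\<lambda>x. norm (w x)" K] w K(1)
    by (metis continuous_on_norm norm_zero)
  obtain \<rho> where \<rho>: "K \<subseteq> cball 0 \<rho>" using compact_subset_centred_cball[OF K(1)] by blast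
  have "(LINT x|lebesgue_on \<Omega>. w x $ i * frechet_derivative \<psi> (at x) (axis j 1))
          = - (LINT x|lebesgue_on \<Omega>. D x $ i $ j * \<psi> x)" if \<psi>: "\<psi> \<in> test_functions \<Omega>" for \<psi> i j
  proof -
    let ?e = "axis j 1 :: real^'d"
    obtain h0 where "\<And>l::nat. 0 < h0 l" "h0 \<longlonglongrightarrow> 0"
      and ev: "\<forall>\<^sub>F l in sequentially. \<forall>x. norm (w (x + h0 l *\<^sub>R ?e) - w x) \<le> L * h0 l"
      and ae0: "AE x in lborel. (\<lambda>l. (w (x + h0 l *\<^sub>R ?e) - w x) /\<^sub>R h0 l) \<longlonglongrightarrow> D x *v ?e"
      using dq[of j] by blast
    \<comment> \<open>the Lipschitz bound holds for late step sizes only, so the first ones are dropped\<close>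
    obtain l0 where l0: "\<And>l x. l0 \<le> l \<Longrightarrow> norm (w (x + h0 l *\<^sub>R ?e) - w x) \<le> L * h0 l"
      using ev by (auto simp: eventually_sequentially)
    define h where "h = (\<lambda>l. h0 (l + l0))"
    have h: "0 < h l" "h \<longlonglongrightarrow> 0" and lip: "norm (w (x + h l *\<^sub>R ?e) - w x) \<le> L * h l" for l x
      using \<open>\<And>l. 0 < h0 l\<close> LIMSEQ_ignore_initial_segment[OF \<open>h0 \<longlonglongrightarrow> 0\<close>] l0 by (auto simp: h_def)
    have ae: "AE x in lborel. (\<lambda>l. (w (x + h l *\<^sub>R ?e) - w x) /\<^sub>R h l) \<longlonglongrightarrow> D x *v ?e"
      using ae0
    proof eventually_elim
      case (elim x)
      from LIMSEQ_ignore_initial_segment[OF this, of l0] show ?case by (simp add: h_def)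
    qed
    note \<psi>' = test_function_continuous[OF \<psi>]
    obtain K' where K': "compact K'" "K' \<subseteq> \<Omega>" "\<And>x. x \<notin> K' \<Longrightarrow> \<psi> x = 0"
      "\<And>x v. x \<notin> K' \<Longrightarrow> frechet_derivative \<psi> (at x) v = 0"
      using test_function_support[OF \<psi>] by metis
    obtain D1 where D1: "0 \<le> D1" "\<And>x. \<bar>\<psi> x\<bar> \<le> D1"
      using continuous_compact_support_bounded[OF \<psi>'(1) K'(1,3)] by metis
    obtain D2 where D2: "0 \<le> D2" "\<And>x. \<bar>frechet_derivative \<psi> (at x) ?e\<bar> \<le> D2"
      using continuous_compact_support_bounded[OF \<psi>'(2) K'(1,4)] by metis
    obtain \<rho>' where \<rho>': "K' \<subseteq> cball 0 \<rho>'" using compact_subset_centred_cball[OF K'(1)] by blast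
    have [measurable]: "\<psi> \<in> borel_measurable borel"
      "(\<lambda>x. frechet_derivative \<psi> (at x) ?e) \<in> borel_measurable borel"
      using \<psi>' by (auto intro: borel_measurable_continuous_onI)
    have \<psi>lip: "\<bar>\<psi> x - \<psi> (x - t *\<^sub>R ?e)\<bar> \<le> D2 * t" if "0 < t" for x t
    proof -
      have der: "((\<lambda>s. \<psi> (x - s *\<^sub>R ?e)) has_real_derivative - frechet_derivative \<psi> (at (x - s *\<^sub>R ?e)) ?e) (at s)" for s
      proof -
        have D: "((\<lambda>s. \<psi> (x - s *\<^sub>R ?e)) has_derivative
            (\<lambda>t. frechet_derivative \<psi> (at (x - s *\<^sub>R ?e)) (- (t *\<^sub>R ?e)))) (at s)"
          by (rule has_derivative_compose[OF _ \<psi>'(3), where f="\<lambda>s. x - s *\<^sub>R ?e"])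
             (auto intro!: derivative_eq_intros)
        have lin: "linear (frechet_derivative \<psi> (at (x - s *\<^sub>R ?e)))"
          using \<psi>'(3) has_derivative_linear by blast
        show ?thesis
          unfolding has_field_derivative_def
          by (rule has_derivative_eq_rhs[OF D]) (simp add: fun_eq_iff linear_neg[OF lin] linear_scale[OF lin])
      qed
      obtain s where "\<psi> (x - t *\<^sub>R ?e) - \<psi> (x - 0 *\<^sub>R ?e) = (t - 0) * - frechet_derivative \<psi> (at (x - s *\<^sub>R ?e)) ?e"
        using MVT2[OF \<open>0 < t\<close>, OF der] by blast
      then have "\<psi> x - \<psi> (x - t *\<^sub>R ?e) = t * frechet_derivative \<psi> (at (x - s *\<^sub>R ?e)) ?e"
        by (simp add: algebra_simps)
      then have "\<bar>\<psi> x - \<psi> (x - t *\<^sub>R ?e)\<bar> = t * \<bar>frechet_derivative \<psi> (at (x - s *\<^sub>R ?e)) ?e\<bar>"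
        using that by (simp add: abs_mult)
      then show ?thesis using D2(2)[of "x - s *\<^sub>R ?e"] that by (simp add: mult.commute)
    qed
    let ?q = "\<lambda>l x. (\<psi> x - \<psi> (x - h l *\<^sub>R ?e)) / h l" and ?d = "\<lambda>x. frechet_derivative \<psi> (at x) ?e"
    let ?p = "\<lambda>l x. (w (x + h l *\<^sub>R ?e) $ i - w x $ i) / h l"
    have wB: "\<bar>w x $ i\<bar> \<le> B * indicator (cball 0 \<rho>) x" for x
      using component_le_norm_cart[of "w x" i] B(2)[of x] w(2)[of x] \<rho> B(1)
      by (cases "x \<in> K") (auto simp: indicator_def)
    have ic: "integrable lborel (\<lambda>x. a * indicat_real (cball (0::real^'d) b) x)" for a b
      by (intro integrable_mult_right integrable_real_indicator emeasure_lborel_cball_finite) simp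
    have wi: "integrable lborel (\<lambda>x. w x $ i * k x)"
      if [measurable]: "k \<in> borel_measurable borel" and "\<And>x. \<bar>k x\<bar> \<le> c" for k c
    proof (rule Bochner_Integration.integrable_bound[OF ic[of "B * c" \<rho>]])
      show "AE x in lborel. norm (w x $ i * k x) \<le> norm (B * c * indicat_real (cball 0 \<rho>) x)"
      proof (rule AE_I2)
        fix x
        have "0 \<le> c" using that(2)[of x] abs_ge_zero order.trans by blast
        have "\<bar>w x $ i\<bar> * \<bar>k x\<bar> \<le> (B * indicator (cball 0 \<rho>) x) * c"
          by (rule mult_mono[OF wB that(2)]) (use B in auto)
        then show "norm (w x $ i * k x) \<le> norm (B * c * indicat_real (cball 0 \<rho>) x)"
          using B(1) \<open>0 \<le> c\<close> by (simp add: abs_mult mult_ac)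
      qed
    qed measurable
    have eqn: "(\<integral>x. w x $ i * ?q l x \<partial>lborel) =
        - (\<integral>x. ?p l x * \<psi> x \<partial>lborel)" for l
    proof -
      have i1: "integrable lborel (\<lambda>x. w x $ i * \<psi> x)" by (rule wi) (use D1 in auto)
      have i2: "integrable lborel (\<lambda>x. w x $ i * \<psi> (x - h l *\<^sub>R ?e))" by (rule wi[of _ D1]) (use D1 in auto)
      have m: "(\<lambda>x. w x $ i * \<psi> (x - h l *\<^sub>R ?e)) \<in> borel_measurable borel" by measurable
      note tr = lborel_integral_translate[OF m, of "h l *\<^sub>R ?e"]
      have i3: "integrable lborel (\<lambda>x. w (x + h l *\<^sub>R ?e) $ i * \<psi> x)" using tr(2) i2 by simp
      have "(\<integral>x. w x $ i * ?q l x \<partial>lborel) =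
          (\<integral>x. (w x $ i * \<psi> x - w x $ i * \<psi> (x - h l *\<^sub>R ?e)) / h l \<partial>lborel)"
        by (simp add: right_diff_distrib)
      also have "\<dots> = ((\<integral>x. w x $ i * \<psi> x \<partial>lborel) - (\<integral>x. w (x + h l *\<^sub>R ?e) $ i * \<psi> x \<partial>lborel)) / h l"
        using i1 i2 tr(1) by simp
      also have "\<dots> = - ((\<integral>x. w (x + h l *\<^sub>R ?e) $ i * \<psi> x - w x $ i * \<psi> x \<partial>lborel) / h l)"
        using i1 i3 by (simp add: minus_divide_left)
      also have "\<dots> = - (\<integral>x. (w (x + h l *\<^sub>R ?e) $ i * \<psi> x - w x $ i * \<psi> x) / h l \<partial>lborel)"
        by simp
      finally show ?thesis by (simp add: left_diff_distrib)
    qed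
    have lim1: "(\<lambda>l. \<integral>x. w x $ i * ?q l x \<partial>lborel)
        \<longlonglongrightarrow> (\<integral>x. w x $ i * ?d x \<partial>lborel)"
    proof (rule integral_dominated_convergence[OF _ _ ic[of "B * D2" \<rho>]])
      show "AE x in lborel. (\<lambda>l. w x $ i * ?q l x)
          \<longlonglongrightarrow> w x $ i * ?d x"
      proof (rule AE_I2)
        fix x
        have "(\<lambda>l. (x - h l *\<^sub>R ?e - x) /\<^sub>R h l) \<longlonglongrightarrow> - ?e"
          using h(1) by (simp add: less_imp_neq[THEN not_sym])
        from has_derivative_imp_difference_quotients[OF \<psi>'(3) h this]
        have "(\<lambda>l. (\<psi> (x - h l *\<^sub>R ?e) - \<psi> x) /\<^sub>R h l) \<longlonglongrightarrow> - ?d x"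
          using linear_neg[OF has_derivative_linear[OF \<psi>'(3)]] by simp
        from tendsto_minus[OF this]
        have "(\<lambda>l. ?q l x) \<longlonglongrightarrow> ?d x"
          by (simp add: divide_inverse algebra_simps)
        then show "(\<lambda>l. w x $ i * ?q l x)
          \<longlonglongrightarrow> w x $ i * ?d x" by (intro tendsto_intros)
      qed
      show "AE x in lborel. norm (w x $ i * ?q l x) \<le> B * D2 * indicat_real (cball 0 \<rho>) x" for l
      proof (rule AE_I2)
        fix x
        have "\<bar>?q l x\<bar> \<le> D2"
          using \<psi>lip[OF h(1), of x l] h(1)[of l] by (simp add: abs_divide divide_le_eq)
        then have "\<bar>w x $ i\<bar> * \<bar>?q l x\<bar> \<le> (B * indicator (cball 0 \<rho>) x) * D2"
          by (rule mult_mono[OF wB]) (use B in auto)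
        then show "norm (w x $ i * ?q l x) \<le> B * D2 * indicat_real (cball 0 \<rho>) x"
          by (simp only: real_norm_def abs_mult) (simp add: mult_ac)
      qed
    qed measurable
    have lim2: "(\<lambda>l. \<integral>x. ?p l x * \<psi> x \<partial>lborel)
        \<longlonglongrightarrow> (\<integral>x. D x $ i $ j * \<psi> x \<partial>lborel)"
    proof (rule integral_dominated_convergence[OF _ _ ic[of "L * D1" \<rho>']])
      show "AE x in lborel. (\<lambda>l. ?p l x * \<psi> x) \<longlonglongrightarrow> D x $ i $ j * \<psi> x"
        using ae
      proof eventually_elim
        case (elim x)
        from tendsto_vec_nth[OF elim, of i]
        have "(\<lambda>l. ?p l x) \<longlonglongrightarrow> D x $ i $ j"
          by (simp add: divide_inverse mult.commute matrix_vector_mul_component inner_axis)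
        then show ?case by (intro tendsto_intros)
      qed
      show "AE x in lborel. norm (?p l x * \<psi> x) \<le> L * D1 * indicat_real (cball 0 \<rho>') x" for l
      proof (rule AE_I2)
        fix x
        have "\<bar>w (x + h l *\<^sub>R ?e) $ i - w x $ i\<bar> \<le> L * h l"
          using component_le_norm_cart[of "w (x + h l *\<^sub>R ?e) - w x" i] lip[of x l] by simp
        then have 1: "\<bar>?p l x\<bar> \<le> L"
          using h(1)[of l] by (simp add: abs_divide divide_le_eq)
        have 2: "\<bar>\<psi> x\<bar> \<le> D1 * indicat_real (cball 0 \<rho>') x"
          using D1 K'(3) \<rho>' by (cases "x \<in> K'") (auto simp: indicator_def)
        have "\<bar>?p l x\<bar> * \<bar>\<psi> x\<bar> \<le> L * (D1 * indicat_real (cball 0 \<rho>') x)"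
          by (rule mult_mono[OF 1 2]) (use order.trans[OF abs_ge_zero 1] in auto)
        then show "norm (?p l x * \<psi> x) \<le> L * D1 * indicat_real (cball 0 \<rho>') x"
          by (simp only: real_norm_def abs_mult mult.assoc)
      qed
    qed measurable
    have out: "w x = 0" "D x = 0" if "x \<notin> \<Omega>" for x
      using that K(2) w(2) DK by blast+
    have meas: "k \<in> borel_measurable (lebesgue_on \<Omega>)"
      if "k \<in> borel_measurable borel" for k :: "real^'d \<Rightarrow> real"
      using that by (intro measurable_restrict_space1 measurable_completion) simp
    have "(\<integral>x. w x $ i * ?d x \<partial>lborel) = - (\<integral>x. D x $ i $ j * \<psi> x \<partial>lborel)"
      using LIMSEQ_unique[OF lim1[unfolded eqn] tendsto_minus[OF lim2]] .
    moreover have "(LINT x|lebesgue_on \<Omega>. w x $ i * ?d x) =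
        (\<integral>x. w x $ i * ?d x \<partial>lborel)"
      using out by (intro lebesgue_on_integral_eq_lborel[OF \<open>open \<Omega>\<close>] meas) auto
    moreover have "(LINT x|lebesgue_on \<Omega>. D x $ i $ j * \<psi> x) = (\<integral>x. D x $ i $ j * \<psi> x \<partial>lborel)"
      using out by (intro lebesgue_on_integral_eq_lborel[OF \<open>open \<Omega>\<close>] meas) auto
    ultimately show ?thesis by simp
  qed
  then show ?thesis
    unfolding has_weak_gradient_def
    using locally_integrable_on_bounded[of w B] locally_integrable_on_bounded[OF D E] B(2) by auto
qed

lemma Linf_norm_finite_imp_AE_bounded:
  assumes "Linf_norm \<Omega> f < \<infinity>"
  obtains C where "AE x in lebesgue_on \<Omega>. norm (f x) \<le> C"
proof -
  obtain C where "Linf_norm \<Omega> f \<le> ereal C"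
    using assms by (cases "Linf_norm \<Omega> f") (auto intro: that)
  moreover have "AE x in lebesgue_on \<Omega>. ereal (norm (f x)) \<le> Linf_norm \<Omega> f"
    unfolding Linf_norm_def by (rule esssup_AE)
  ultimately have "AE x in lebesgue_on \<Omega>. norm (f x) \<le> C"
    by (auto elim!: eventually_mono dest: order.trans)
  then show thesis by (rule that)
qed

lemma bounded_borel_representative:
  fixes f :: "'a::euclidean_space \<Rightarrow> 'b::euclidean_space"
  assumes "open \<Omega>" "f \<in> Lp_space \<infinity> \<Omega>"
  obtains g C where "g \<in> borel_measurable borel" "\<And>x. norm (g x) \<le> C" "\<And>x. x \<notin> \<Omega> \<Longrightarrow> g x = 0"
    "AE x in lborel. x \<in> \<Omega> \<longrightarrow> f x = g x"
proof -
  have [simp]: "\<Omega> \<in> sets lebesgue" and [measurable]: "\<Omega> \<in> sets borel" using assms(1) by auto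
  have "f \<in> borel_measurable (lebesgue_on \<Omega>)" using assms(2) by (simp add: Lp_space_def)
  then have "(\<lambda>x. indicator \<Omega> x *\<^sub>R f x) \<in> borel_measurable lebesgue"
    by (subst (asm) borel_measurable_restrict_space_iff) auto
  then obtain g0 where [measurable]: "g0 \<in> borel_measurable borel"
    and g0: "AE x in lborel. indicator \<Omega> x *\<^sub>R f x = g0 x"
    by (rule lebesgue_borel_representative)
  obtain C where "AE x in lebesgue_on \<Omega>. norm (f x) \<le> C"
    using Linf_norm_finite_imp_AE_bounded[of \<Omega> f] assms(2) by (auto simp: Lp_space_def)
  then have "AE x in lebesgue. x \<in> \<Omega> \<longrightarrow> norm (f x) \<le> C"
    by (subst (asm) AE_restrict_space_iff) auto
  then have C: "AE x in lborel. x \<in> \<Omega> \<longrightarrow> norm (f x) \<le> C" by (simp add: AE_completion_iff)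
  let ?g = "\<lambda>x. if x \<in> \<Omega> \<and> norm (g0 x) \<le> C then g0 x else 0"
  show thesis
  proof
    show "?g \<in> borel_measurable borel" by measurable
    show "norm (?g x) \<le> max 0 C" for x by auto
    show "AE x in lborel. x \<in> \<Omega> \<longrightarrow> f x = ?g x"
      using g0 C by eventually_elim auto
  qed auto
qed

text \<open>Entrance to the locale \<open>bounded_weak_gradient\<close>: on null sets and outside of \<open>\<Omega>\<close> the Sobolev
  function and its gradient are changed to bounded Borel functions.\<close>

lemma bounded_weak_gradient_representatives:
  fixes n :: "real^'d \<Rightarrow> real^'k"
  assumes "open \<Omega>" "bounded \<Omega>" "n \<in> sobolev_space \<infinity> \<Omega>"
  obtains u G C \<rho> where "bounded_weak_gradient \<Omega> u G C \<rho>"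
    "AE x in lborel. x \<in> \<Omega> \<longrightarrow> n x = u x" "AE x in lborel. x \<in> \<Omega> \<longrightarrow> weak_gradient \<Omega> n x = G x"
proof -
  have [simp]: "\<Omega> \<in> sets lebesgue" using assms(1) by auto
  obtain H where H: "has_weak_gradient n H \<Omega>" "H \<in> Lp_space \<infinity> \<Omega>" and n: "n \<in> Lp_space \<infinity> \<Omega>"
    using assms(3) by (auto simp: sobolev_space_def)
  obtain u C1 where [measurable]: "u \<in> borel_measurable borel" and u: "\<And>x. norm (u x) \<le> C1"
      "\<And>x. x \<notin> \<Omega> \<Longrightarrow> u x = 0" and nu: "AE x in lborel. x \<in> \<Omega> \<longrightarrow> n x = u x"
    using bounded_borel_representative[OF assms(1) n] by blast
  obtain G C2 where [measurable]: "G \<in> borel_measurable borel" and G: "\<And>x. norm (G x) \<le> C2"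
      "\<And>x. x \<notin> \<Omega> \<Longrightarrow> G x = 0" and HG: "AE x in lborel. x \<in> \<Omega> \<longrightarrow> H x = G x"
    using bounded_borel_representative[OF assms(1) H(2)] by blast
  obtain \<rho> where \<rho>: "\<Omega> \<subseteq> cball 0 \<rho>" using assms(2) by (auto simp: bounded_iff subset_iff)
  have "AE x in lebesgue_on \<Omega>. weak_gradient \<Omega> n x = H x"
    using weak_gradient_unique[OF assms(1) has_weak_gradient_weak_gradient[OF H(1)] H(1)] .
  then have "AE x in lebesgue. x \<in> \<Omega> \<longrightarrow> weak_gradient \<Omega> n x = H x"
    by (subst (asm) AE_restrict_space_iff) auto
  then have wH: "AE x in lborel. x \<in> \<Omega> \<longrightarrow> weak_gradient \<Omega> n x = H x" by (simp add: AE_completion_iff)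
  show thesis
  proof (rule that[OF _ nu])
    show "AE x in lborel. x \<in> \<Omega> \<longrightarrow> weak_gradient \<Omega> n x = G x"
      using wH HG by eventually_elim auto
    show "bounded_weak_gradient \<Omega> u G (max C1 C2) \<rho>"
    proof
      show "norm (u x) \<le> max C1 C2" "norm (G x) \<le> max C1 C2" for x
        using u(1)[of x] G(1)[of x] by auto
      show "G x = 0" if "x \<notin> cball 0 \<rho>" for x using that \<rho> G(2) by blast
      fix \<psi> :: "real^'d \<Rightarrow> real" and i v assume \<psi>: "\<psi> \<in> test_functions \<Omega>"
      note \<psi>' = test_function_continuous[OF \<psi>]
      obtain K where K: "compact K" "K \<subseteq> \<Omega>" "\<And>x. x \<notin> K \<Longrightarrow> \<psi> x = 0"
        "\<And>x v. x \<notin> K \<Longrightarrow> frechet_derivative \<psi> (at x) v = 0"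
        using test_function_support[OF \<psi>] by metis
      have out: "\<psi> x = 0" "frechet_derivative \<psi> (at x) v = 0" if "x \<notin> \<Omega>" for x v
        using that K by blast+
      have [measurable]: "\<psi> \<in> borel_measurable borel"
        "\<And>v. (\<lambda>x. frechet_derivative \<psi> (at x) v) \<in> borel_measurable borel"
        using \<psi>' by (auto intro: borel_measurable_continuous_onI)
      have meas: "(\<lambda>x. a x \<bullet> b * k x) \<in> borel_measurable (lebesgue_on \<Omega>)"
        if "a \<in> borel_measurable (lebesgue_on \<Omega>)" "k \<in> borel_measurable borel" for a :: "real^'d \<Rightarrow> 'z::euclidean_space" and b k
      proof -
        have "k \<in> borel_measurable (lebesgue_on \<Omega>)"
          using that(2) by (intro measurable_restrict_space1 measurable_completion) simp
        then show ?thesis using that(1) by (intro borel_measurable_times borel_measurable_inner) auto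
      qed
      have nm: "n \<in> borel_measurable (lebesgue_on \<Omega>)" and Hm: "H \<in> borel_measurable (lebesgue_on \<Omega>)"
        using n H(2) by (auto simp: Lp_space_def)
      have j: "(\<integral>x. u x $ i * frechet_derivative \<psi> (at x) (axis j 1) \<partial>lborel) = - (\<integral>x. G x $ i $ j * \<psi> x \<partial>lborel)" for j
      proof -
        have "(LINT x|lebesgue_on \<Omega>. n x $ i * frechet_derivative \<psi> (at x) (axis j 1)) =
            (\<integral>x. u x $ i * frechet_derivative \<psi> (at x) (axis j 1) \<partial>lborel)"
        proof (rule lebesgue_on_integral_eq_lborel[OF assms(1)])
          show "(\<lambda>x. n x $ i * frechet_derivative \<psi> (at x) (axis j 1)) \<in> borel_measurable (lebesgue_on \<Omega>)"
            using meas[OF nm, of "\<lambda>x. frechet_derivative \<psi> (at x) (axis j 1)" "axis i 1"] by (simp add: inner_axis)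
          show "AE x in lborel. x \<in> \<Omega> \<longrightarrow> n x $ i * frechet_derivative \<psi> (at x) (axis j 1) =
              u x $ i * frechet_derivative \<psi> (at x) (axis j 1)" using nu by eventually_elim auto
        qed (use out in auto)
        moreover have "(LINT x|lebesgue_on \<Omega>. H x $ i $ j * \<psi> x) = (\<integral>x. G x $ i $ j * \<psi> x \<partial>lborel)"
        proof (rule lebesgue_on_integral_eq_lborel[OF assms(1)])
          show "(\<lambda>x. H x $ i $ j * \<psi> x) \<in> borel_measurable (lebesgue_on \<Omega>)"
            using meas[OF Hm, of \<psi> "axis i (axis j 1)"] by (simp add: inner_axis)
          show "AE x in lborel. x \<in> \<Omega> \<longrightarrow> H x $ i $ j * \<psi> x = G x $ i $ j * \<psi> x"
            using HG by eventually_elim auto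
        qed (use out in auto)
        moreover have "(LINT x|lebesgue_on \<Omega>. n x $ i * frechet_derivative \<psi> (at x) (axis j 1))
            = - (LINT x|lebesgue_on \<Omega>. H x $ i $ j * \<psi> x)"
          using H(1) \<psi> unfolding has_weak_gradient_def by blast
        ultimately show ?thesis by simp
      qed
      have bi: "integrable lborel (\<lambda>x. a x * k x)"
        if [measurable]: "a \<in> borel_measurable borel" and "\<And>x. \<bar>a x\<bar> \<le> c" and k: "continuous_on UNIV k"
          "\<And>x. x \<notin> K \<Longrightarrow> k x = 0" for a k :: "real^'d \<Rightarrow> real" and c
      proof -
        obtain E where E: "0 \<le> E" "\<And>x. \<bar>k x\<bar> \<le> E"
          using continuous_compact_support_bounded[OF k(1) K(1) k(2)] by metis
        have [measurable]: "k \<in> borel_measurable borel" using k(1) by (rule borel_measurable_continuous_onI)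
        have "norm (a x * k x) \<le> c * E" for x
          using that(2)[of x] E(2)[of x] by (auto simp: abs_mult intro!: mult_mono)
        moreover have "a x * k x = 0" if "x \<notin> cball 0 \<rho>" for x using that \<rho> K(2) k(2) by (metis mult_zero_right subset_iff)
        ultimately show ?thesis by (intro integrable_bounded_support[of _ "c * E" \<rho>]) auto
      qed
      have uc: "\<bar>u x $ i\<bar> \<le> C1" and Gc: "\<bar>G x $ i $ j\<bar> \<le> C2" for x j
        using component_le_norm_cart[of "u x" i] u(1)[of x] component_le_norm_cart[of "G x $ i" j]
          Finite_Cartesian_Product.norm_nth_le[of "G x" i] G(1)[of x] by linarith+
      have D\<psi>: "frechet_derivative \<psi> (at x) v = (\<Sum>j\<in>UNIV. v $ j * frechet_derivative \<psi> (at x) (axis j 1))" for x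
      proof -
        have lin: "linear (frechet_derivative \<psi> (at x))" using \<psi>'(3) has_derivative_linear by blast
        have "v = (\<Sum>j\<in>UNIV. v $ j *\<^sub>R axis j 1)"
          by (simp add: vec_eq_iff axis_def if_distrib sum.delta' cong: if_cong)
        then have "frechet_derivative \<psi> (at x) v = frechet_derivative \<psi> (at x) (\<Sum>j\<in>UNIV. v $ j *\<^sub>R axis j 1)" by simp
        then show ?thesis by (simp add: linear_sum[OF lin] linear_scale[OF lin])
      qed
      have "(\<integral>x. u x $ i * frechet_derivative \<psi> (at x) v \<partial>lborel) =
          (\<integral>x. (\<Sum>j\<in>UNIV. v $ j * (u x $ i * frechet_derivative \<psi> (at x) (axis j 1))) \<partial>lborel)"
        by (subst D\<psi>) (simp add: sum_distrib_left mult_ac)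
      also have "\<dots> = (\<Sum>j\<in>UNIV. v $ j * (\<integral>x. u x $ i * frechet_derivative \<psi> (at x) (axis j 1) \<partial>lborel))"
        using bi[OF _ uc \<psi>'(2) K(4)] by (subst Bochner_Integration.integral_sum) auto
      also have "\<dots> = - (\<Sum>j\<in>UNIV. v $ j * (\<integral>x. G x $ i $ j * \<psi> x \<partial>lborel))"
        by (simp add: j sum_negf)
      also have "\<dots> = - (\<integral>x. (\<Sum>j\<in>UNIV. v $ j * (G x $ i $ j * \<psi> x)) \<partial>lborel)"
        using bi[OF _ Gc \<psi>'(1) K(3)] by (subst Bochner_Integration.integral_sum) auto
      also have "\<dots> = - (\<integral>x. (G x $ i \<bullet> v) * \<psi> x \<partial>lborel)"
        by (simp add: inner_vec_def sum_distrib_left sum_distrib_right mult_ac)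
      finally show "(\<integral>x. u x $ i * frechet_derivative \<psi> (at x) v \<partial>lborel) = - (\<integral>x. (G x $ i \<bullet> v) * \<psi> x \<partial>lborel)" .
    qed measurable
  qed
qed

section \<open>Variations by projection\<close>

text \<open>The tube consists of the closed balls of radius \<open>\<delta>\<close> around the points of \<open>M\<close>. There \<open>P'\<close> and \<open>J'\<close> agree
  with \<open>P\<close> and its Jacobian; they are continuous on the whole space, which keeps all
  compositions measurable.\<close>

locale projection_tube =
  fixes M :: "(real^'k) set" and P :: "real^'k \<Rightarrow> real^'k" and \<delta> \<Lambda> :: real
    and P' :: "real^'k \<Rightarrow> real^'k" and J' :: "real^'k \<Rightarrow> real^'k^'k"
  assumes \<delta>: "0 < \<delta>" and \<Lambda>: "0 \<le> \<Lambda>"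
    and P'_continuous: "continuous_on UNIV P'" and J'_continuous: "continuous_on UNIV J'"
    and P'_eq: "\<And>z y. z \<in> M \<Longrightarrow> dist z y \<le> \<delta> \<Longrightarrow> P' y = P y"
    and P_in: "\<And>z y. z \<in> M \<Longrightarrow> dist z y \<le> \<delta> \<Longrightarrow> P y \<in> M"
    and J'_eq: "\<And>z y. z \<in> M \<Longrightarrow> dist z y \<le> \<delta> \<Longrightarrow> J' y = jacobian P (at y)"
    and P_derivative: "\<And>z y. z \<in> M \<Longrightarrow> dist z y \<le> \<delta> \<Longrightarrow> (P has_derivative (\<lambda>h. J' y *v h)) (at y)"
    and P_lipschitz: "\<And>z y y'. z \<in> M \<Longrightarrow> dist z y \<le> \<delta> \<Longrightarrow> dist z y' \<le> \<delta> \<Longrightarrow>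
      norm (P y - P y') \<le> \<Lambda> * norm (y - y')"
    and P_fix: "\<And>z. z \<in> M \<Longrightarrow> P z = z"

text \<open>By compactness of \<open>M\<close> some tube is a compact subset of \<open>U\<close>. The Lipschitz estimate is confined to
  single balls because the tube itself need not be convex.\<close>

lemma projection_tube_exists:
  fixes M U :: "(real^'k) set"
  assumes "closed M" "bounded M" "open U" "M \<subseteq> U" and np: "nearest_point_projection M U P"
    and C: "class_C_on 3 U P"
  obtains \<delta> \<Lambda> P' J' where "projection_tube M P \<delta> \<Lambda> P' J'"
proof -
  have cM: "compact M" using assms by (simp add: compact_eq_bounded_closed)
  obtain \<delta> where \<delta>: "0 < \<delta>" "(\<Union>z\<in>M. cball z \<delta>) \<subseteq> U"
    using compact_subset_open_imp_cball_epsilon_subset[OF cM \<open>open U\<close> \<open>M \<subseteq> U\<close>] by metis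
  define K where "K = (\<Union>z\<in>M. cball z \<delta>)"
  have "K = {x + y | x y. x \<in> M \<and> y \<in> cball 0 \<delta>}"
  proof (intro set_eqI iffI)
    fix y assume "y \<in> K"
    then obtain z where "z \<in> M" "dist z y \<le> \<delta>" by (auto simp: K_def)
    then have "y = z + (y - z)" "z \<in> M" "y - z \<in> cball 0 \<delta>" by (auto simp: dist_norm norm_minus_commute)
    then show "y \<in> {x + y | x y. x \<in> M \<and> y \<in> cball 0 \<delta>}" by blast
  next
    fix y assume "y \<in> {x + y | x y. x \<in> M \<and> y \<in> cball 0 \<delta>}"
    then obtain z w where "y = z + w" "z \<in> M" "norm w \<le> \<delta>" by auto
    then show "y \<in> K" by (auto simp: K_def dist_norm intro!: bexI[of _ z])
  qed
  then have cK: "compact K" using compact_sums[OF cM compact_cball[of 0 \<delta>]] by simp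
  have KU: "K \<subseteq> U" using \<delta> by (simp add: K_def)
  have C1: "class_C_on (Suc (Suc (Suc 0))) U P" using C by (simp add: numeral_3_eq_3)
  then have diff: "P differentiable (at y)" if "y \<in> U" for y using that by simp
  have "class_C_on (Suc 0) U P" by (rule class_C_on_Suc_imp[OF class_C_on_Suc_imp[OF C1]])
  then have "continuous_on U (\<lambda>x. frechet_derivative P (at x) v)" for v by simp
  then have Jc: "continuous_on U (\<lambda>y. jacobian P (at y))"
    unfolding jacobian_def matrix_def by (intro continuous_intros)
  have Pc: "continuous_on U P"
    using diff by (intro continuous_at_imp_continuous_on ballI differentiable_imp_continuous_within)
  obtain P' where P': "continuous_on UNIV P'" "\<And>y. y \<in> K \<Longrightarrow> P' y = P y"
    using Tietze_unbounded[of K P UNIV] continuous_on_subset[OF Pc KU] cK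
    by (auto intro: compact_imp_closed)
  obtain J' where J': "continuous_on UNIV J'" "\<And>y. y \<in> K \<Longrightarrow> J' y = jacobian P (at y)"
    using Tietze_unbounded[of K "\<lambda>y. jacobian P (at y)" UNIV] continuous_on_subset[OF Jc KU] cK
    by (auto intro: compact_imp_closed)
  interpret mv: bounded_bilinear "(*v) :: real^'k^'k \<Rightarrow> real^'k \<Rightarrow> real^'k"
    by (rule bounded_bilinear_matrix_vector_mult)
  obtain B where B: "0 \<le> B" "\<And>a b. norm ((a :: real^'k^'k) *v b) \<le> norm a * norm b * B"
    using mv.nonneg_bounded by blast
  have "bounded (J' ` K)"
    using cK J'(1) by (intro compact_imp_bounded compact_continuous_image) (auto intro: continuous_on_subset)
  then obtain E where E: "0 < E" "\<And>y. y \<in> K \<Longrightarrow> norm (J' y) \<le> E" by (auto simp: bounded_pos)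
  have der: "(P has_derivative (\<lambda>h. J' y *v h)) (at y)" if "y \<in> K" for y
    using diff[of y] that KU J'(2)[OF that] by (auto simp: jacobian_works)
  have inK: "y \<in> K" if "z \<in> M" "dist z y \<le> \<delta>" for z y using that by (auto simp: K_def)
  have "projection_tube M P \<delta> (E * B) P' J'"
  proof
    fix z y y' assume z: "z \<in> M" "dist z y \<le> \<delta>"
    show "P' y = P y" "J' y = jacobian P (at y)" "(P has_derivative (\<lambda>h. J' y *v h)) (at y)"
      using inK[OF z] P'(2) J'(2) der by auto
    show "P y \<in> M" using np inK[OF z] KU by (auto simp: nearest_point_projection_def)
    assume z': "dist z y' \<le> \<delta>"
    show "norm (P y - P y') \<le> E * B * norm (y - y')"
    proof (rule differentiable_bound[of "cball z \<delta>"])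
      fix x assume x: "x \<in> cball z \<delta>"
      then have xK: "x \<in> K" using inK z(1) by simp
      then show "(P has_derivative (\<lambda>h. J' x *v h)) (at x within cball z \<delta>)"
        using der has_derivative_at_withinI by blast
      show "onorm (\<lambda>h. J' x *v h) \<le> E * B"
      proof (rule onorm_le)
        fix h :: "real^'k"
        have "norm (J' x) * norm h * B \<le> E * norm h * B"
          using E(2)[OF xK] B(1) by (intro mult_right_mono) auto
        then show "norm (J' x *v h) \<le> E * B * norm h" using B(2)[of "J' x" h] by (simp add: mult_ac)
      qed
    qed (use z z' in auto)
  next
    fix z assume z: "z \<in> M"
    then have "z \<in> U" using \<open>M \<subseteq> U\<close> by auto
    show "P z = z"
    proof (rule ccontr)
      assume "P z \<noteq> z"
      moreover have "\<forall>w\<in>M. w \<noteq> P z \<longrightarrow> dist z (P z) < dist z w"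
        using np \<open>z \<in> U\<close> unfolding nearest_point_projection_def by blast
      ultimately have "dist z (P z) < dist z z" using z by metis
      then show False using zero_le_dist[of z "P z"] by (simp del: zero_le_dist)
    qed
  qed (use \<delta> E B P' J' in auto)
  then show thesis by (rule that)
qed

lemma matrix_eqI_columns:
  fixes A B :: "real^'d^'k"
  assumes "\<And>j. A *v axis j 1 = B *v axis j 1"
  shows "A = B"
proof -
  have "A $ i $ j = B $ i $ j" for i j
    using arg_cong[OF assms[of j], of "\<lambda>x. x $ i"] by (simp add: matrix_vector_mul_component inner_axis)
  then show ?thesis by (simp add: vec_eq_iff)
qed

text \<open>Since the values of \<open>v\<close> lie in \<open>M\<close> at every point of the ball, and not just almost everywhere, \<open>P\<close> can
  be evaluated and differentiated pointwise along \<open>v\<close>.\<close>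

locale lipschitz_chart = bounded_weak_gradient \<Omega> u G C \<rho> + projection_tube M P \<delta> \<Lambda> P' J'
  for \<Omega> :: "(real^'d) set" and u :: "real^'d \<Rightarrow> real^'k" and G C \<rho> M P \<delta> \<Lambda> P' J' +
  fixes c :: "real^'d" and R L :: real and v :: "real^'d \<Rightarrow> real^'k"
  assumes ball_\<Omega>: "ball c R \<subseteq> \<Omega>" and open_\<Omega>: "open \<Omega>"
    and v_lipschitz: "L-lipschitz_on (ball c R) v"
    and v_eq: "AE x in lborel. x \<in> ball c R \<longrightarrow> v x = u x"
    and v_in: "\<And>x. x \<in> ball c R \<Longrightarrow> v x \<in> M"
begin

lemma L_nonneg: "0 \<le> L" using v_lipschitz by (rule lipschitz_on_nonneg)

lemma v_continuous: "continuous_on (ball c R) v" using v_lipschitz by (rule lipschitz_on_continuous_on)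

text \<open>The identity \<open>P (v x) = v x\<close> holds throughout the ball and can be differentiated along step sizes
  for which the difference quotients of \<open>v\<close> converge.\<close>

lemma projected_gradient: "AE x in lborel. x \<in> ball c R \<longrightarrow> J' (v x) ** G x = G x"
proof -
  have "AE x in lborel. x \<in> ball c R \<longrightarrow> (J' (v x) ** G x) *v axis j 1 = G x *v axis j 1" for j
  proof -
    obtain h where h: "\<And>l::nat. 0 < h l" "h \<longlonglongrightarrow> 0"
      and dq: "AE x in lborel. x \<in> ball c R \<longrightarrow>
        (\<lambda>l. (v (x + h l *\<^sub>R axis j 1) - v x) /\<^sub>R h l) \<longlonglongrightarrow> G x *v axis j 1"
      using difference_quotients_converge[OF ball_\<Omega> v_eq] by blast
    show ?thesis using dq
    proof eventually_elim
      case (elim x)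
      show ?case
      proof
        assume x: "x \<in> ball c R"
        then have lim: "(\<lambda>l. (v (x + h l *\<^sub>R axis j 1) - v x) /\<^sub>R h l) \<longlonglongrightarrow> G x *v axis j 1"
          using elim by simp
        have "(P has_derivative (\<lambda>h. J' (v x) *v h)) (at (v x))"
          using P_derivative[OF v_in[OF x], of "v x"] \<delta> by simp
        from has_derivative_imp_difference_quotients[OF this h lim]
        have 1: "(\<lambda>l. (P (v (x + h l *\<^sub>R axis j 1)) - P (v x)) /\<^sub>R h l) \<longlonglongrightarrow> J' (v x) *v (G x *v axis j 1)" .
        have "(\<lambda>l. x + h l *\<^sub>R axis j 1) \<longlonglongrightarrow> x + 0 *\<^sub>R axis j 1" by (intro tendsto_intros h)
        then have "\<forall>\<^sub>F l in sequentially. x + h l *\<^sub>R axis j 1 \<in> ball c R"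
          by (rule topological_tendstoD) (use x in auto)
        then have "\<forall>\<^sub>F l in sequentially. (P (v (x + h l *\<^sub>R axis j 1)) - P (v x)) /\<^sub>R h l =
            (v (x + h l *\<^sub>R axis j 1) - v x) /\<^sub>R h l"
          by eventually_elim (use x v_in P_fix in simp)
        from Lim_transform_eventually[OF 1 this] LIMSEQ_unique[OF lim]
        show "(J' (v x) ** G x) *v axis j 1 = G x *v axis j 1"
          by (simp add: matrix_vector_mul_assoc)
      qed
    qed
  qed
  then have "AE x in lborel. \<forall>j. x \<in> ball c R \<longrightarrow> (J' (v x) ** G x) *v axis j 1 = G x *v axis j 1"
    unfolding AE_all_countable by blast
  then show ?thesis by eventually_elim (auto intro: matrix_eqI_columns)
qed

text \<open>The difference between the projected perturbation of \<open>v\<close> and \<open>v\<close>, for a perturbation \<open>\<phi>\<close> supported in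
  \<open>cball a r\<close>. Elsewhere in the chart the formula would also give \<open>0\<close>, since \<open>P\<close> fixes the values of \<open>v\<close>.\<close>

definition variation :: "real^'d \<Rightarrow> real \<Rightarrow> (real^'d \<Rightarrow> real^'k) \<Rightarrow> real^'d \<Rightarrow> real^'k" where
  "variation a r \<phi> x = (if x \<in> cball a r then P (v x + \<phi> x) - v x else 0)"

definition variation_gradient ::
    "real^'d \<Rightarrow> real \<Rightarrow> (real^'d \<Rightarrow> real^'k) \<Rightarrow> (real^'d \<Rightarrow> real^'d^'k) \<Rightarrow> real^'d \<Rightarrow> real^'d^'k" where
  "variation_gradient a r \<phi> D x = (if x \<in> cball a r then J' (v x + \<phi> x) ** (G x + D x) - G x else 0)"

context
  fixes a :: "real^'d" and r K E :: real and \<phi> :: "real^'d \<Rightarrow> real^'k" and D :: "real^'d \<Rightarrow> real^'d^'k"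
  assumes r: "0 < r" "cball a (2 * r) \<subseteq> ball c R"
    and \<phi>_small: "\<And>x. norm (\<phi> x) \<le> \<delta> / 2"
    and \<phi>_lipschitz: "\<And>x y. norm (\<phi> x - \<phi> y) \<le> K * norm (x - y)"
    and \<phi>_outside: "\<And>x. x \<notin> cball a r \<Longrightarrow> \<phi> x = 0"
    and D_measurable: "D \<in> borel_measurable borel" and D_bound: "\<And>x. norm (D x) \<le> E"
    and \<phi>_derivative: "AE x in lborel. (\<phi> has_derivative (\<lambda>h. D x *v h)) (at x)"
begin

lemma cball_subset: "cball a r \<subseteq> ball c R"
  using r by (intro order.trans[OF subset_cball r(2)]) simp

lemma K_nonneg: "0 \<le> K"
proof -
  have "0 \<le> K * norm (axis undefined 1 - 0 :: real^'d)"
    by (rule order.trans[OF norm_ge_zero \<phi>_lipschitz])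
  then show ?thesis by (simp add: norm_axis_1)
qed

lemma near: "x \<in> ball c R \<Longrightarrow> dist (v x) (v x + \<phi> x) \<le> \<delta>"
  using \<phi>_small[of x] \<delta> by (simp add: dist_norm)

lemma variation_eq: "x \<in> ball c R \<Longrightarrow> variation a r \<phi> x = P (v x + \<phi> x) - v x"
  using \<phi>_outside[of x] P_fix[OF v_in] by (simp add: variation_def)

lemma variation_bound: "norm (variation a r \<phi> x) \<le> \<Lambda> * norm (\<phi> x)"
proof (cases "x \<in> cball a r")
  case True
  then have x: "x \<in> ball c R" using cball_subset by auto
  have "norm (P (v x + \<phi> x) - P (v x)) \<le> \<Lambda> * norm (v x + \<phi> x - v x)"
    using near[OF x] \<delta> by (intro P_lipschitz[OF v_in[OF x]]) auto
  then show ?thesis using x by (simp add: variation_eq P_fix v_in)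
next
  case False
  then show ?thesis using \<Lambda> by (simp add: variation_def)
qed

lemma variation_in: "x \<in> ball c R \<Longrightarrow> v x + variation a r \<phi> x \<in> M"
  using P_in[OF v_in near] by (simp add: variation_eq)

text \<open>If \<open>x\<close> or \<open>x + h\<close> lies in the support and \<open>h\<close> is small, then both lie in the chart, and both perturbed
  values lie in the ball of the tube around \<open>v x\<close>, where \<open>P\<close> is Lipschitz.\<close>

lemma variation_increment:
  obtains \<eta> where "0 < \<eta>"
    "\<And>x h. norm h < \<eta> \<Longrightarrow> norm (variation a r \<phi> (x + h) - variation a r \<phi> x) \<le> (\<Lambda> * (L + K) + L) * norm h"
proof -
  let ?w = "variation a r \<phi>"
  \<comment> \<open>\<open>r\<close> keeps both points in the chart, the second bound keeps the perturbed values in the tube\<close>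
  define \<eta> where "\<eta> = min r (\<delta> / 2 / (L + K + 1))"
  have "0 < \<eta>" using r \<delta> L_nonneg K_nonneg by (simp add: \<eta>_def)
  have both: "norm (?w (x + h) - ?w x) \<le> (\<Lambda> * (L + K) + L) * norm h"
    if "norm h < \<eta>" "x \<in> ball c R" "x + h \<in> ball c R" for x h
  proof -
    have 1: "norm (v (x + h) - v x) \<le> L * norm h"
      using lipschitz_onD[OF v_lipschitz that(3,2)] by (simp add: dist_norm)
    have 2: "norm (\<phi> (x + h) - \<phi> x) \<le> K * norm h" using \<phi>_lipschitz[of "x + h" x] by simp
    have 3: "norm ((v (x + h) + \<phi> (x + h)) - (v x + \<phi> x)) \<le> (L + K) * norm h"
      using norm_triangle_ineq[of "v (x + h) - v x" "\<phi> (x + h) - \<phi> x"] 1 2 by (simp add: algebra_simps)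
    have "(L + K) * norm h \<le> (L + K + 1) * (\<delta> / 2 / (L + K + 1))"
      using that(1) L_nonneg K_nonneg by (intro mult_mono) (auto simp: \<eta>_def)
    also have "\<dots> = \<delta> / 2" using L_nonneg K_nonneg by (simp add: field_simps)
    finally have "norm ((v (x + h) + \<phi> (x + h)) - (v x + \<phi> x)) \<le> \<delta> / 2" using 3 by simp
    then have "dist (v x) (v (x + h) + \<phi> (x + h)) \<le> \<delta>"
      using dist_triangle[of "v x" "v (x + h) + \<phi> (x + h)" "v x + \<phi> x"] \<phi>_small[of x]
      by (simp add: dist_norm norm_minus_commute)
    then have "norm (P (v (x + h) + \<phi> (x + h)) - P (v x + \<phi> x)) \<le> \<Lambda> * norm ((v (x + h) + \<phi> (x + h)) - (v x + \<phi> x))"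
      using near[OF that(2)] by (intro P_lipschitz[OF v_in[OF that(2)]]) auto
    also have "\<dots> \<le> \<Lambda> * ((L + K) * norm h)" using 3 \<Lambda> by (intro mult_left_mono)
    finally have 4: "norm (P (v (x + h) + \<phi> (x + h)) - P (v x + \<phi> x)) \<le> \<Lambda> * ((L + K) * norm h)" .
    have "?w (x + h) - ?w x =
        (P (v (x + h) + \<phi> (x + h)) - P (v x + \<phi> x)) - (v (x + h) - v x)"
      using that by (simp add: variation_eq)
    then have "norm (?w (x + h) - ?w x) \<le> \<Lambda> * ((L + K) * norm h) + L * norm h"
      using norm_triangle_ineq4[of "P (v (x + h) + \<phi> (x + h)) - P (v x + \<phi> x)" "v (x + h) - v x"] 1 4
      by simp
    then show ?thesis by (simp add: algebra_simps)
  qed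
  show thesis
  proof (rule that[OF \<open>0 < \<eta>\<close>])
    fix x h :: "real^'d" assume h: "norm h < \<eta>"
    then have "norm h < r" by (simp add: \<eta>_def)
    consider "x \<in> cball a r \<or> x + h \<in> cball a r" | "x \<notin> cball a r" "x + h \<notin> cball a r" by blast
    then show "norm (?w (x + h) - ?w x) \<le> (\<Lambda> * (L + K) + L) * norm h"
    proof cases
      case 1
      have "x \<in> cball a (2 * r) \<and> x + h \<in> cball a (2 * r)"
        using 1
      proof
        assume "x \<in> cball a r"
        then show ?thesis using r(1) \<open>norm h < r\<close> norm_triangle_ineq[of "x - a" h]
          by (simp add: dist_norm norm_minus_commute algebra_simps)
      next
        assume "x + h \<in> cball a r"
        then show ?thesis using r(1) \<open>norm h < r\<close> norm_triangle_ineq4[of "x + h - a" h]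
          by (simp add: dist_norm norm_minus_commute algebra_simps)
      qed
      then show ?thesis using r(2) by (intro both[OF h]) auto
    next
      case 2
      then show ?thesis using \<Lambda> L_nonneg K_nonneg by (simp add: variation_def)
    qed
  qed
qed

lemma variation_continuous: "continuous_on UNIV (variation a r \<phi>)"
proof -
  let ?w = "variation a r \<phi>"
  obtain \<eta> where \<eta>: "0 < \<eta>"
    "\<And>x h. norm h < \<eta> \<Longrightarrow> norm (?w (x + h) - ?w x) \<le> (\<Lambda> * (L + K) + L) * norm h"
    using variation_increment by blast
  define B where "B = \<Lambda> * (L + K) + L"
  have B: "0 \<le> B" using \<Lambda> L_nonneg K_nonneg by (simp add: B_def)
  show ?thesis
    unfolding continuous_on_iff
  proof (intro ballI allI impI)
    fix x and e :: real assume "0 < e"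
    show "\<exists>d>0. \<forall>x'\<in>UNIV. dist x' x < d \<longrightarrow> dist (?w x') (?w x) < e"
    proof (intro exI conjI ballI impI)
      show "0 < min \<eta> (e / (B + 1))" using \<eta>(1) \<open>0 < e\<close> B by simp
      fix x' assume d: "dist x' x < min \<eta> (e / (B + 1))"
      have "dist (?w x') (?w x) \<le> B * dist x' x"
        using \<eta>(2)[of "x' - x" x] d by (simp add: dist_norm B_def)
      also have "\<dots> \<le> (B + 1) * dist x' x" by (intro mult_right_mono) auto
      also have "\<dots> < e" using d B by (simp add: field_simps)
      finally show "dist (?w x') (?w x) < e" .
    qed
  qed
qed

lemma \<phi>_continuous: "continuous_on UNIV \<phi>"
proof (rule lipschitz_on_continuous_on)
  show "K-lipschitz_on UNIV \<phi>" using \<phi>_lipschitz K_nonneg by (simp add: lipschitz_on_def dist_norm)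
qed

lemma jacobian_continuous: "continuous_on (cball a r) (\<lambda>x. J' (v x + \<phi> x))"
  using continuous_on_subset[OF v_continuous cball_subset] \<phi>_continuous
  by (intro continuous_on_compose2[OF J'_continuous] continuous_intros) (auto intro: continuous_on_subset)

lemma variation_gradient_measurable: "variation_gradient a r \<phi> D \<in> borel_measurable borel"
proof -
  have [measurable]: "(\<lambda>x. indicator (cball a r) x *\<^sub>R J' (v x + \<phi> x)) \<in> borel_measurable borel"
    using jacobian_continuous by (intro borel_measurable_continuous_on_indicator) auto
  note [measurable] = D_measurable
  have [measurable]: "cball a r \<in> sets borel" by simp
  have "(\<lambda>x. (indicator (cball a r) x *\<^sub>R J' (v x + \<phi> x)) ** (G x + D x) - indicator (cball a r) x *\<^sub>R G x)
    \<in> borel_measurable borel"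
    by (intro borel_measurable_diff borel_measurable_matrix_matrix_mult) measurable
  also have "(\<lambda>x. (indicator (cball a r) x *\<^sub>R J' (v x + \<phi> x)) ** (G x + D x) - indicator (cball a r) x *\<^sub>R G x)
      = variation_gradient a r \<phi> D"
    by (auto simp: variation_gradient_def fun_eq_iff indicator_def
        bounded_bilinear.zero_left[OF bounded_bilinear_matrix_matrix_mult])
  finally show ?thesis .
qed

lemma variation_gradient_bounded: obtains B where "\<And>x. norm (variation_gradient a r \<phi> D x) \<le> B"
proof -
  have "bounded ((\<lambda>x. J' (v x + \<phi> x)) ` cball a r)"
    using jacobian_continuous by (intro compact_imp_bounded compact_continuous_image) auto
  then obtain B1 where B1: "0 < B1" "\<And>x. x \<in> cball a r \<Longrightarrow> norm (J' (v x + \<phi> x)) \<le> B1"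
    by (auto simp: bounded_pos)
  obtain B2 where B2: "0 \<le> B2" "\<And>A B. norm ((A :: real^'k^'k) ** (B :: real^'d^'k)) \<le> norm A * norm B * B2"
    using bounded_bilinear.nonneg_bounded[OF bounded_bilinear_matrix_matrix_mult] by blast
  have E: "0 \<le> E" using D_bound[of 0] norm_ge_zero order.trans by blast
  show thesis
  proof (rule that)
    fix x
    show "norm (variation_gradient a r \<phi> D x) \<le> B1 * (C + E) * B2 + C"
    proof (cases "x \<in> cball a r")
      case True
      have GD: "norm (G x + D x) \<le> C + E"
        using norm_triangle_ineq[of "G x" "D x"] G_bound[of x] D_bound[of x] by simp
      have "norm (J' (v x + \<phi> x) ** (G x + D x)) \<le> norm (J' (v x + \<phi> x)) * norm (G x + D x) * B2" by (rule B2(2))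
      also have "\<dots> \<le> B1 * (C + E) * B2"
        using GD B1 True B2(1) by (intro mult_right_mono mult_mono) auto
      finally show ?thesis
        using True norm_triangle_ineq4[of "J' (v x + \<phi> x) ** (G x + D x)" "G x"] G_bound[of x]
        by (simp add: variation_gradient_def)
    next
      case False
      then show ?thesis using B1 B2 E C_nonneg by (simp add: variation_gradient_def)
    qed
  qed
qed

text \<open>The chain rule for \<open>P (v x + \<phi> x)\<close>, taken along step sizes for which the difference
  quotients of \<open>v\<close> converge. The sphere \<open>sphere a r\<close>, where the two cases of the definition meet, is a null set.\<close>

lemma variation_has_weak_gradient:
  "has_weak_gradient (variation a r \<phi>) (variation_gradient a r \<phi> D) \<Omega>"
proof -
  let ?w = "variation a r \<phi>" and ?W = "variation_gradient a r \<phi> D"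
  obtain B where B: "\<And>x. norm (?W x) \<le> B" using variation_gradient_bounded by blast
  obtain \<eta> where \<eta>: "0 < \<eta>"
    "\<And>x h. norm h < \<eta> \<Longrightarrow> norm (?w (x + h) - ?w x) \<le> (\<Lambda> * (L + K) + L) * norm h"
    using variation_increment by blast
  show ?thesis
  proof (rule has_weak_gradient_if_difference_quotients_converge[OF open_\<Omega> compact_cball _
        variation_continuous _ variation_gradient_measurable B, of a r "\<Lambda> * (L + K) + L"])
    show "cball a r \<subseteq> \<Omega>" using cball_subset ball_\<Omega> by blast
    fix j :: 'd
    let ?e = "axis j 1 :: real^'d"
    obtain h where h: "\<And>l::nat. 0 < h l" "h \<longlonglongrightarrow> 0"
      and dq: "AE x in lborel. x \<in> ball c R \<longrightarrow> (\<lambda>l. (v (x + h l *\<^sub>R ?e) - v x) /\<^sub>R h l) \<longlonglongrightarrow> G x *v ?e"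
      using difference_quotients_converge[OF ball_\<Omega> v_eq] by blast
    have "\<forall>\<^sub>F l in sequentially. h l < \<eta>" using order_tendstoD(2)[OF h(2) \<eta>(1)] .
    then have ev: "\<forall>\<^sub>F l in sequentially. \<forall>x. norm (?w (x + h l *\<^sub>R ?e) - ?w x)
        \<le> (\<Lambda> * (L + K) + L) * h l"
    proof eventually_elim
      case (elim l)
      then show ?case using \<eta>(2)[of "h l *\<^sub>R ?e"] h(1)[of l] by (simp add: norm_axis_1)
    qed
    have "AE x in lborel. (\<lambda>l. (?w (x + h l *\<^sub>R ?e) - ?w x) /\<^sub>R h l)
        \<longlonglongrightarrow> ?W x *v ?e"
      using AE_lborel_notin_negligible[OF negligible_sphere, of a r] dq \<phi>_derivative
    proof eventually_elim
      case (elim x)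
      have "(\<lambda>l. x + h l *\<^sub>R ?e) \<longlonglongrightarrow> x + 0 *\<^sub>R ?e" by (intro tendsto_intros h)
      then have near_x: "\<forall>\<^sub>F l in sequentially. x + h l *\<^sub>R ?e \<in> S" if "open S" "x \<in> S" for S
        by (rule topological_tendstoD) (use that in auto)
      show ?case
      proof (cases "x \<in> cball a r")
        case True
        then have x: "x \<in> ball c R" using cball_subset by auto
        have "(\<lambda>l. (x + h l *\<^sub>R ?e - x) /\<^sub>R h l) \<longlonglongrightarrow> ?e"
          using h(1) by (simp add: less_imp_neq[THEN not_sym])
        from has_derivative_imp_difference_quotients[OF elim(3) h this]
        have d\<phi>: "(\<lambda>l. (\<phi> (x + h l *\<^sub>R ?e) - \<phi> x) /\<^sub>R h l) \<longlonglongrightarrow> D x *v ?e" .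
        have dv: "(\<lambda>l. (v (x + h l *\<^sub>R ?e) - v x) /\<^sub>R h l) \<longlonglongrightarrow> G x *v ?e" using elim(2) x by simp
        have "(\<lambda>l. ((v (x + h l *\<^sub>R ?e) + \<phi> (x + h l *\<^sub>R ?e)) - (v x + \<phi> x)) /\<^sub>R h l) \<longlonglongrightarrow> G x *v ?e + D x *v ?e"
          using tendsto_add[OF dv d\<phi>] by (simp add: algebra_simps)
        from tendsto_diff[OF has_derivative_imp_difference_quotients[OF P_derivative[OF v_in[OF x] near[OF x]] h this] dv]
        have "(\<lambda>l. (P (v (x + h l *\<^sub>R ?e) + \<phi> (x + h l *\<^sub>R ?e)) - P (v x + \<phi> x)) /\<^sub>R h l - (v (x + h l *\<^sub>R ?e) - v x) /\<^sub>R h l)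
          \<longlonglongrightarrow> J' (v x + \<phi> x) *v (G x *v ?e + D x *v ?e) - G x *v ?e" .
        also have "J' (v x + \<phi> x) *v (G x *v ?e + D x *v ?e) - G x *v ?e = ?W x *v ?e"
          using True by (simp add: variation_gradient_def matrix_vector_mul_assoc[symmetric]
              matrix_vector_mult_diff_rdistrib matrix_vector_mult_add_rdistrib)
        finally show ?thesis
        proof (rule Lim_transform_eventually)
          show "\<forall>\<^sub>F l in sequentially. (P (v (x + h l *\<^sub>R ?e) + \<phi> (x + h l *\<^sub>R ?e)) - P (v x + \<phi> x)) /\<^sub>R h l
              - (v (x + h l *\<^sub>R ?e) - v x) /\<^sub>R h l = (?w (x + h l *\<^sub>R ?e) - ?w x) /\<^sub>R h l"
            using near_x[OF open_ball x]
            by eventually_elim (use x in \<open>simp add: variation_eq algebra_simps\<close>)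
        qed
      next
        case False
        have "\<forall>\<^sub>F l in sequentially. x + h l *\<^sub>R ?e \<in> - cball a r"
          using False by (intro near_x) auto
        then have "\<forall>\<^sub>F l in sequentially. 0 = (?w (x + h l *\<^sub>R ?e) - ?w x) /\<^sub>R h l"
          by eventually_elim (use False in \<open>auto simp: variation_def\<close>)
        from Lim_transform_eventually[OF tendsto_const this] show ?thesis
          using False by (simp add: variation_gradient_def)
      qed
    qed
    then show "\<exists>h. (\<forall>l::nat. 0 < h l) \<and> h \<longlonglongrightarrow> 0 \<and>
      (\<forall>\<^sub>F l in sequentially. \<forall>x. norm (?w (x + h l *\<^sub>R ?e) - ?w x) \<le> (\<Lambda> * (L + K) + L) * h l) \<and>
      (AE x in lborel. (\<lambda>l. (?w (x + h l *\<^sub>R ?e) - ?w x) /\<^sub>R h l)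
        \<longlonglongrightarrow> ?W x *v ?e)"
      using h ev by blast
  qed (auto simp: variation_def variation_gradient_def)
qed

end

end

section \<open>Admissibility and energy of variations\<close>

text \<open>Completeness of Lebesgue measure.\<close>

lemma borel_measurable_lebesgue_on_AE:
  fixes f g :: "'a::euclidean_space \<Rightarrow> 'b::euclidean_space"
  assumes "S \<in> sets lebesgue" "f \<in> borel_measurable (lebesgue_on S)" "AE x in lebesgue_on S. f x = g x"
  shows "g \<in> borel_measurable (lebesgue_on S)"
proof -
  have "(\<lambda>x. indicator S x *\<^sub>R f x) \<in> borel_measurable lebesgue"
    using assms(1,2) by (subst (asm) borel_measurable_restrict_space_iff) auto
  moreover have "AE x in lebesgue. x \<in> S \<longrightarrow> f x = g x"
    using assms(1,3) by (subst (asm) AE_restrict_space_iff) auto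
  then have "AE x in lebesgue. indicator S x *\<^sub>R f x = indicator S x *\<^sub>R g x"
    by eventually_elim (auto simp: indicator_def)
  ultimately have "(\<lambda>x. indicator S x *\<^sub>R g x) \<in> borel_measurable lebesgue" by (rule borel_measurable_AE)
  then show ?thesis using assms(1) by (subst borel_measurable_restrict_space_iff) auto
qed

lemma Lp_space_one: "f \<in> Lp_space 1 \<Omega> \<longleftrightarrow> integrable (lebesgue_on \<Omega>) f"
proof
  assume "f \<in> Lp_space 1 \<Omega>"
  then have "f \<in> borel_measurable (lebesgue_on \<Omega>)" "integrable (lebesgue_on \<Omega>) (\<lambda>x. norm (f x))"
    by (auto simp: Lp_space_def)
  then show "integrable (lebesgue_on \<Omega>) f" by (simp add: integrable_norm_iff)
next
  assume "integrable (lebesgue_on \<Omega>) f"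
  then show "f \<in> Lp_space 1 \<Omega>" by (auto simp: Lp_space_def)
qed

lemma weak_gradient_add:
  fixes u w :: "real^'d \<Rightarrow> real^'k"
  assumes "open \<Omega>" "has_weak_gradient u A \<Omega>" "has_weak_gradient w B \<Omega>"
  shows "has_weak_gradient (\<lambda>x. u x + w x) (\<lambda>x. A x + B x) \<Omega>"
  unfolding has_weak_gradient_def
proof (intro conjI ballI allI)
  show "locally_integrable_on (\<lambda>x. u x + w x) \<Omega>" "locally_integrable_on (\<lambda>x. A x + B x) \<Omega>"
    using assms(2,3) by (auto simp: has_weak_gradient_def locally_integrable_on_def)
  fix \<psi> :: "real^'d \<Rightarrow> real" and i :: 'k and j :: 'd
  assume \<psi>: "\<psi> \<in> test_functions \<Omega>"
  note \<psi>' = test_function_continuous[OF \<psi>]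
  obtain K where K: "compact K" "K \<subseteq> \<Omega>" "\<And>x. x \<notin> K \<Longrightarrow> \<psi> x = 0"
    "\<And>x v. x \<notin> K \<Longrightarrow> frechet_derivative \<psi> (at x) v = 0"
    using test_function_support[OF \<psi>] by metis
  have component: "locally_integrable_on (\<lambda>x. f x $ i) \<Omega>" if "locally_integrable_on f \<Omega>" for f :: "real^'d \<Rightarrow> real^'k"
  proof -
    have "(\<lambda>x. f x $ i) = (\<lambda>x. f x \<bullet> axis i 1)" by (simp add: inner_axis)
    then show ?thesis using that by (auto simp: locally_integrable_on_def)
  qed
  have "integrable (lebesgue_on \<Omega>) (\<lambda>x. u x $ i * frechet_derivative \<psi> (at x) (axis j 1))"
    "integrable (lebesgue_on \<Omega>) (\<lambda>x. w x $ i * frechet_derivative \<psi> (at x) (axis j 1))"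
    using assms(2,3) by (intro integrable_mult_compact_support[OF \<open>open \<Omega>\<close> component \<psi>'(2) K(1,2,4)];
      simp add: has_weak_gradient_def)+
  moreover have "integrable (lebesgue_on \<Omega>) (\<lambda>x. A x $ i $ j * \<psi> x)" "integrable (lebesgue_on \<Omega>) (\<lambda>x. B x $ i $ j * \<psi> x)"
    using assms(2,3) by (intro integrable_mult_compact_support[OF \<open>open \<Omega>\<close> locally_integrable_on_component \<psi>'(1) K(1,2,3)];
      simp add: has_weak_gradient_def)+
  moreover have "(LINT x|lebesgue_on \<Omega>. u x $ i * frechet_derivative \<psi> (at x) (axis j 1)) = - (LINT x|lebesgue_on \<Omega>. A x $ i $ j * \<psi> x)"
    "(LINT x|lebesgue_on \<Omega>. w x $ i * frechet_derivative \<psi> (at x) (axis j 1)) = - (LINT x|lebesgue_on \<Omega>. B x $ i $ j * \<psi> x)"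
    using assms(2,3) \<psi> unfolding has_weak_gradient_def by blast+
  ultimately show "(LINT x|lebesgue_on \<Omega>. (u x + w x) $ i * frechet_derivative \<psi> (at x) (axis j 1))
      = - (LINT x|lebesgue_on \<Omega>. (A x + B x) $ i $ j * \<psi> x)"
    by (simp add: distrib_right)
qed

lemma weak_gradient_add_AE:
  assumes "open \<Omega>" "has_weak_gradient u A \<Omega>" "has_weak_gradient w B \<Omega>"
  shows "AE x in lebesgue_on \<Omega>. weak_gradient \<Omega> (\<lambda>x. u x + w x) x = weak_gradient \<Omega> u x + B x"
  using weak_gradient_unique[OF assms(1) has_weak_gradient_weak_gradient[OF weak_gradient_add[OF assms]]
      weak_gradient_add[OF assms(1) has_weak_gradient_weak_gradient[OF assms(2)] assms(3)]] .

lemma weak_gradient_measurable: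
  assumes "open \<Omega>" "u \<in> sobolev_space 1 \<Omega>"
  shows "weak_gradient \<Omega> u \<in> borel_measurable (lebesgue_on \<Omega>)"
proof -
  obtain G where G: "has_weak_gradient u G \<Omega>" "G \<in> Lp_space 1 \<Omega>"
    using assms(2) by (auto simp: sobolev_space_def)
  show ?thesis
  proof (rule borel_measurable_lebesgue_on_AE)
    show "AE x in lebesgue_on \<Omega>. G x = weak_gradient \<Omega> u x"
      by (rule weak_gradient_unique[OF assms(1) G(1) has_weak_gradient_weak_gradient[OF G(1)]])
  qed (use assms(1) G(2) in \<open>auto simp: Lp_space_def\<close>)
qed

text \<open>A sequence of continuous functions that defines the trace of \<open>n\<close> becomes, after adding \<open>w\<close> to each of
  its members, a sequence that defines the same trace for \<open>n + w\<close>, since \<open>w\<close> is zero on the boundary.\<close>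

lemma admissible_maps_add_compactly_supported:
  fixes n w :: "real^'d \<Rightarrow> real^'k"
  assumes \<Omega>: "open \<Omega>" "bounded \<Omega>" and n: "n \<in> admissible_maps \<Omega> \<Gamma> M n\<^sub>0"
    and w: "continuous_on UNIV w" and K: "compact K" "K \<subseteq> \<Omega>" "\<And>x. x \<notin> K \<Longrightarrow> w x = 0"
    and D: "has_weak_gradient w D \<Omega>" "D \<in> borel_measurable borel" "\<And>x. norm (D x) \<le> E"
    and M: "AE x in lebesgue_on \<Omega>. n x + w x \<in> M"
  shows "(\<lambda>x. n x + w x) \<in> admissible_maps \<Omega> \<Gamma> M n\<^sub>0"
proof -
  have Ob: "\<Omega> \<in> sets borel" using \<Omega>(1) by auto
  obtain B where B: "\<And>x. \<bar>norm (w x)\<bar> \<le> B"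
    using continuous_compact_support_bounded[of "\<lambda>x. norm (w x)" K] w K(1,3)
    by (metis continuous_on_norm norm_zero)
  have wL: "w \<in> Lp_space 1 \<Omega>" and DL: "D \<in> Lp_space 1 \<Omega>"
    unfolding Lp_space_one using B D \<Omega> w Ob
    by (auto intro!: integrable_lebesgue_on_bounded borel_measurable_continuous_onI)
  have add: "(\<lambda>x. u x + w x) \<in> sobolev_space 1 \<Omega>" if "u \<in> sobolev_space 1 \<Omega>" for u
  proof -
    obtain A where "has_weak_gradient u A \<Omega>" "A \<in> Lp_space 1 \<Omega>" "u \<in> Lp_space 1 \<Omega>"
      using \<open>u \<in> sobolev_space 1 \<Omega>\<close> by (auto simp: sobolev_space_def)
    then show ?thesis using weak_gradient_add[OF \<Omega>(1) _ D(1)] wL DL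
      by (auto simp: sobolev_space_def Lp_space_one)
  qed
  have n1: "n \<in> sobolev_space 1 \<Omega>" using n by (auto simp: admissible_maps_def sobolev_maps_def)
  obtain g h where g: "has_trace \<Omega> n g" and h: "has_trace \<Omega> n\<^sub>0 h"
    and gh: "AE x in surface_measure. x \<in> \<Gamma> \<longrightarrow> g x = h x"
    using n by (auto simp: admissible_maps_def trace_eq_on_def)
  obtain v :: "nat \<Rightarrow> real^'d \<Rightarrow> real^'k" where v: "\<And>i. v i \<in> sobolev_space 1 \<Omega>"
      "\<And>i. continuous_on (closure \<Omega>) (v i)"
    and v1: "(\<lambda>i. LINT x|lebesgue_on \<Omega>. norm (v i x - n x)) \<longlonglongrightarrow> 0"
    and v2: "(\<lambda>i. LINT x|lebesgue_on \<Omega>. norm (weak_gradient \<Omega> (v i) x - weak_gradient \<Omega> n x)) \<longlonglongrightarrow> 0"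
    and v3: "(\<lambda>i. \<integral>\<^sup>+x\<in>frontier \<Omega>. ennreal (norm (v i x - g x)) \<partial>surface_measure) \<longlonglongrightarrow> 0"
    and gb: "g \<in> borel_measurable borel"
    using g by (auto simp: has_trace_def)
  have grad: "AE x in lebesgue_on \<Omega>. weak_gradient \<Omega> (\<lambda>x. u x + w x) x = weak_gradient \<Omega> u x + D x"
    if "u \<in> sobolev_space 1 \<Omega>" for u
  proof -
    obtain A where "has_weak_gradient u A \<Omega>" using \<open>u \<in> sobolev_space 1 \<Omega>\<close> by (auto simp: sobolev_space_def)
    then show ?thesis using weak_gradient_add_AE[OF \<Omega>(1) _ D(1)] by blast
  qed
  have "has_trace \<Omega> (\<lambda>x. n x + w x) g"
    unfolding has_trace_def
  proof (intro conjI exI[of _ "\<lambda>i x. v i x + w x"] allI)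
    show "(\<lambda>x. n x + w x) \<in> sobolev_space 1 \<Omega>" "(\<lambda>x. v i x + w x) \<in> sobolev_space 1 \<Omega>" for i
      using add n1 v(1) by auto
    show "continuous_on (closure \<Omega>) (\<lambda>x. v i x + w x)" for i
      by (intro continuous_intros v continuous_on_subset[OF w]) auto
    show "(\<lambda>i. LINT x|lebesgue_on \<Omega>. norm (v i x + w x - (n x + w x))) \<longlonglongrightarrow> 0" using v1 by simp
    have "(LINT x|lebesgue_on \<Omega>. norm (weak_gradient \<Omega> (\<lambda>x. v i x + w x) x - weak_gradient \<Omega> (\<lambda>x. n x + w x) x))
        = (LINT x|lebesgue_on \<Omega>. norm (weak_gradient \<Omega> (v i) x - weak_gradient \<Omega> n x))" for i
    proof (rule integral_cong_AE)
      show "AE x in lebesgue_on \<Omega>. norm (weak_gradient \<Omega> (\<lambda>x. v i x + w x) x - weak_gradient \<Omega> (\<lambda>x. n x + w x) x)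
          = norm (weak_gradient \<Omega> (v i) x - weak_gradient \<Omega> n x)"
        using grad[OF v(1)[of i]] grad[OF n1] by eventually_elim simp
      note [measurable] = weak_gradient_measurable[OF \<Omega>(1) add[OF v(1)[of i]]] weak_gradient_measurable[OF \<Omega>(1) add[OF n1]]
        weak_gradient_measurable[OF \<Omega>(1) v(1)[of i]] weak_gradient_measurable[OF \<Omega>(1) n1]
      show "(\<lambda>x. norm (weak_gradient \<Omega> (\<lambda>x. v i x + w x) x - weak_gradient \<Omega> (\<lambda>x. n x + w x) x))
        \<in> borel_measurable (lebesgue_on \<Omega>)"
        "(\<lambda>x. norm (weak_gradient \<Omega> (v i) x - weak_gradient \<Omega> n x)) \<in> borel_measurable (lebesgue_on \<Omega>)"
        by measurable
    qed
    then show "(\<lambda>i. LINT x|lebesgue_on \<Omega>. norm (weak_gradient \<Omega> (\<lambda>x. v i x + w x) x - weak_gradient \<Omega> (\<lambda>x. n x + w x) x)) \<longlonglongrightarrow> 0"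
      using v2 by simp
    have w0: "w x = 0" if "x \<in> frontier \<Omega>" for x
      using that \<Omega>(1) K(2,3) by (auto simp: frontier_def interior_open)
    have "(\<integral>\<^sup>+x\<in>frontier \<Omega>. ennreal (norm (v i x + w x - g x)) \<partial>surface_measure) =
        (\<integral>\<^sup>+x\<in>frontier \<Omega>. ennreal (norm (v i x - g x)) \<partial>surface_measure)" for i
      by (intro nn_integral_cong) (auto simp: indicator_def w0)
    then show "(\<lambda>i. \<integral>\<^sup>+x\<in>frontier \<Omega>. ennreal (norm (v i x + w x - g x)) \<partial>surface_measure) \<longlonglongrightarrow> 0"
      using v3 by simp
  qed (fact gb)
  then show ?thesis
    using add[OF n1] M h gh by (auto simp: admissible_maps_def sobolev_maps_def trace_eq_on_def)
qed

text \<open>For an integrable integrand both parts of the energy are finite, and no difference of infinities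
  occurs.\<close>

lemma energy_eq_integral:
  assumes "integrable (lebesgue_on \<Omega>) h" "AE x in lebesgue_on \<Omega>. F x (u x) (weak_gradient \<Omega> u x) = h x"
  shows "energy F \<Omega> u = ereal (LINT x|lebesgue_on \<Omega>. h x)"
proof -
  let ?p = "\<integral>\<^sup>+x. ennreal (h x) \<partial>lebesgue_on \<Omega>" and ?m = "\<integral>\<^sup>+x. ennreal (- h x) \<partial>lebesgue_on \<Omega>"
  have "(\<integral>\<^sup>+x. ennreal (F x (u x) (weak_gradient \<Omega> u x)) \<partial>lebesgue_on \<Omega>) = ?p"
    "(\<integral>\<^sup>+x. ennreal (- F x (u x) (weak_gradient \<Omega> u x)) \<partial>lebesgue_on \<Omega>) = ?m"
    using assms(2) by (auto intro!: nn_integral_cong_AE)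
  moreover have "?p < \<infinity>" "?m < \<infinity>" using assms(1) by (auto simp: real_integrable_def less_top)
  then have "enn2ereal ?p = ereal (enn2real ?p)" "enn2ereal ?m = ereal (enn2real ?m)"
    by (metis enn2ereal_ennreal enn2real_nonneg ennreal_enn2real infinity_ennreal_def)+
  ultimately show ?thesis
    by (simp add: energy_def real_lebesgue_integral_def[OF assms(1)])
qed

lemma frechet_derivative_eq_matrix_gradient_inner:
  fixes f :: "real^'d^'k \<Rightarrow> real"
  assumes "f differentiable (at p)"
  shows "(f has_derivative (\<lambda>A. matrix_gradient f p \<bullet> A)) (at p)"
proof -
  have D: "(f has_derivative frechet_derivative f (at p)) (at p)"
    using assms by (simp add: frechet_derivative_works)
  have lin: "linear (frechet_derivative f (at p))" using D by (rule has_derivative_linear)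
  have "frechet_derivative f (at p) A = matrix_gradient f p \<bullet> A" for A
  proof -
    have "A = (\<Sum>i\<in>UNIV. \<Sum>j\<in>UNIV. A $ i $ j *\<^sub>R axis i (axis j 1))"
    proof -
      have "(\<Sum>i\<in>UNIV. \<Sum>j\<in>UNIV. A $ i $ j *\<^sub>R axis i (axis j 1)) $ a $ b = A $ a $ b" for a b
      proof -
        have ax: "(axis i (axis j 1) :: real^'d^'k) $ a $ b = (if i = a then if j = b then 1 else 0 else 0)" for i j
          by (auto simp: axis_def)
        have "(\<Sum>i\<in>UNIV. \<Sum>j\<in>UNIV. A $ i $ j *\<^sub>R axis i (axis j 1)) $ a $ b =
            (\<Sum>i\<in>UNIV. \<Sum>j\<in>UNIV. A $ i $ j * (if i = a then if j = b then 1 else 0 else 0))"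
          by (simp only: sum_component vector_scaleR_component ax real_scaleR_def)
        also have "\<dots> = (\<Sum>i\<in>UNIV. if i = a then A $ i $ b else 0)"
          by (intro sum.cong refl) (auto simp: if_distrib[of "(*) _"] cong: if_cong)
        finally show ?thesis by simp
      qed
      then show ?thesis by (simp add: vec_eq_iff)
    qed
    then have "frechet_derivative f (at p) A =
        frechet_derivative f (at p) (\<Sum>i\<in>UNIV. \<Sum>j\<in>UNIV. A $ i $ j *\<^sub>R axis i (axis j 1))" by simp
    also have "\<dots> = matrix_gradient f p \<bullet> A"
      by (simp add: linear_sum[OF lin] linear_scale[OF lin] matrix_gradient_def inner_vec_def mult.commute)
    finally show ?thesis .
  qed
  then have "frechet_derivative f (at p) = (\<lambda>A. matrix_gradient f p \<bullet> A)" by (rule ext)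
  with D show ?thesis by simp
qed

lemma integral_affine_nonneg:
  fixes f :: "'a::euclidean_space \<Rightarrow> real"
  assumes f[measurable]: "f \<in> borel_measurable borel" and "0 < r" "0 \<le> (\<integral>x. f x \<partial>lborel)"
  shows "0 \<le> (\<integral>y. f (a + r *\<^sub>R y) \<partial>lborel)"
proof -
  have "(\<integral>x. f x \<partial>lborel) = (\<integral>x. f x \<partial>density (distr lborel borel (\<lambda>x. a + r *\<^sub>R x)) (\<lambda>_. ennreal (\<bar>r\<bar> ^ DIM('a))))"
    using lborel_affine[of r a] \<open>0 < r\<close> by (simp add: ennreal_power)
  also have "\<dots> = (\<integral>x. \<bar>r\<bar> ^ DIM('a) * f x \<partial>distr lborel borel (\<lambda>x. a + r *\<^sub>R x))"
    by (subst integral_density) auto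
  also have "\<dots> = \<bar>r\<bar> ^ DIM('a) * (\<integral>y. f (a + r *\<^sub>R y) \<partial>lborel)"
    by (subst integral_distr) auto
  finally show ?thesis using assms(3) zero_less_power[OF \<open>0 < r\<close>, of "DIM('a)"] \<open>0 < r\<close>
    by (auto simp: zero_le_mult_iff)
qed

section \<open>The blow-up argument\<close>

lemma continuous_triple_bounded:
  fixes f :: "'a::euclidean_space \<Rightarrow> 'b::euclidean_space \<Rightarrow> 'c::euclidean_space \<Rightarrow> real"
  assumes "continuous_on UNIV (\<lambda>(x, z, p). f x z p)"
  obtains B where "\<And>x z p. norm x \<le> A \<Longrightarrow> norm z \<le> A \<Longrightarrow> norm p \<le> A \<Longrightarrow> \<bar>f x z p\<bar> \<le> B"
proof -
  let ?K = "cball (0::'a) A \<times> cball (0::'b) A \<times> cball (0::'c) A"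
  have "bounded ((\<lambda>(x, z, p). f x z p) ` ?K)"
    using assms by (intro compact_imp_bounded compact_continuous_image compact_Times compact_cball)
      (auto intro: continuous_on_subset)
  then obtain B where B: "\<And>y. y \<in> (\<lambda>(x, z, p). f x z p) ` ?K \<Longrightarrow> norm y \<le> B"
    unfolding bounded_iff by blast
  show thesis
  proof (rule that)
    fix x :: 'a and z :: 'b and p :: 'c assume "norm x \<le> A" "norm z \<le> A" "norm p \<le> A"
    then have "f x z p \<in> (\<lambda>(x, z, p). f x z p) ` ?K" by (intro image_eqI[of _ _ "(x, z, p)"]) auto
    from B[OF this] show "\<bar>f x z p\<bar> \<le> B" by simp
  qed
qed

text \<open>Under the scaling \<open>x \<mapsto> a + r *\<^sub>R x\<close> with the factor \<open>r\<close> in front the values shrink with \<open>r\<close>, while the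
  gradients keep their size.\<close>

lemma scaled_tent:
  fixes a \<eta> :: "real^'d" and \<zeta> :: "real^'k"
  assumes \<eta>: "\<eta> \<noteq> 0" and \<kappa>: "0 < \<kappa>" and r: "0 < r"
  defines "\<phi> \<equiv> \<lambda>x. (r * tent \<eta> \<kappa> ((x - a) /\<^sub>R r)) *\<^sub>R \<zeta>"
    and "D \<equiv> \<lambda>x. outer_product \<zeta> (tent_grad \<eta> \<kappa> ((x - a) /\<^sub>R r))"
  shows "norm (\<phi> x) \<le> r * \<kappa> * norm \<zeta>"
    and "norm (\<phi> x - \<phi> y) \<le> (norm \<eta> + \<kappa>) * norm \<zeta> * norm (x - y)"
    and "x \<notin> cball a r \<Longrightarrow> \<phi> x = 0"
    and "D \<in> borel_measurable borel"
    and "AE x in lborel. (\<phi> has_derivative (\<lambda>h. D x *v h)) (at x)"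
proof -
  show "norm (\<phi> x) \<le> r * \<kappa> * norm \<zeta>"
    using tent_bounds[OF \<eta> \<kappa>, of "(x - a) /\<^sub>R r"] r
    by (simp add: \<phi>_def abs_mult mult_right_mono)
  have "\<phi> x - \<phi> y = (r * (tent \<eta> \<kappa> ((x - a) /\<^sub>R r) - tent \<eta> \<kappa> ((y - a) /\<^sub>R r))) *\<^sub>R \<zeta>"
    by (simp add: \<phi>_def algebra_simps)
  moreover have "\<bar>tent \<eta> \<kappa> ((x - a) /\<^sub>R r) - tent \<eta> \<kappa> ((y - a) /\<^sub>R r)\<bar> \<le> (norm \<eta> + \<kappa>) * norm (x - y) / r"
    using tent_lipschitz[OF \<eta> \<kappa>, of "(x - a) /\<^sub>R r" "(y - a) /\<^sub>R r"] r
    by (simp add: scaleR_diff_right[symmetric] divide_inverse mult_ac)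
  then have "r * \<bar>tent \<eta> \<kappa> ((x - a) /\<^sub>R r) - tent \<eta> \<kappa> ((y - a) /\<^sub>R r)\<bar> \<le> (norm \<eta> + \<kappa>) * norm (x - y)"
    using r by (simp add: field_simps)
  then have "r * \<bar>tent \<eta> \<kappa> ((x - a) /\<^sub>R r) - tent \<eta> \<kappa> ((y - a) /\<^sub>R r)\<bar> * norm \<zeta> \<le> (norm \<eta> + \<kappa>) * norm (x - y) * norm \<zeta>"
    by (rule mult_right_mono) simp
  ultimately show "norm (\<phi> x - \<phi> y) \<le> (norm \<eta> + \<kappa>) * norm \<zeta> * norm (x - y)"
    using r by (simp add: abs_mult mult_ac)
  show "\<phi> x = 0" if "x \<notin> cball a r"
  proof -
    have "1 \<le> norm ((x - a) /\<^sub>R r)"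
      using that r unfolding norm_scaleR by (simp add: dist_norm norm_minus_commute inverse_eq_divide)
    then show ?thesis using tent_outside[OF \<eta> \<kappa>] by (simp add: \<phi>_def)
  qed
  have "continuous_on UNIV (outer_product \<zeta> :: real^'d \<Rightarrow> _)"
    using bounded_bilinear.bounded_linear_right[OF bounded_bilinear_outer_product]
    by (intro linear_continuous_on)
  then have [measurable]: "(outer_product \<zeta> :: real^'d \<Rightarrow> _) \<in> borel_measurable borel"
    by (rule borel_measurable_continuous_onI)
  note [measurable] = tent_grad_measurable[OF \<eta> \<kappa>]
  show "D \<in> borel_measurable borel" unfolding D_def by measurable
  have "AE x in lborel. (tent \<eta> \<kappa> has_derivative (\<lambda>h. tent_grad \<eta> \<kappa> ((x - a) /\<^sub>R r) \<bullet> h)) (at ((x - a) /\<^sub>R r))"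
    using AE_lborel_affine[OF tent_has_derivative[OF \<eta> \<kappa>], of "inverse r" "- (a /\<^sub>R r)"] r
    by (simp add: scaleR_diff_right)
  then show "AE x in lborel. (\<phi> has_derivative (\<lambda>h. D x *v h)) (at x)"
  proof eventually_elim
    case (elim x)
    have "((\<lambda>x. tent \<eta> \<kappa> ((x - a) /\<^sub>R r)) has_derivative
        (\<lambda>h. tent_grad \<eta> \<kappa> ((x - a) /\<^sub>R r) \<bullet> (h /\<^sub>R r))) (at x)"
      by (rule has_derivative_compose[where f="\<lambda>x. (x - a) /\<^sub>R r" and g="tent \<eta> \<kappa>", OF _ elim])
        (auto intro!: derivative_eq_intros)
    then have "(\<phi> has_derivative (\<lambda>h. (r * (tent_grad \<eta> \<kappa> ((x - a) /\<^sub>R r) \<bullet> (h /\<^sub>R r))) *\<^sub>R \<zeta>)) (at x)"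
      unfolding \<phi>_def by (intro derivative_intros)
    moreover have "r * (tent_grad \<eta> \<kappa> ((x - a) /\<^sub>R r) \<bullet> (h /\<^sub>R r)) = tent_grad \<eta> \<kappa> ((x - a) /\<^sub>R r) \<bullet> h" for h
      using r by simp
    ultimately show ?case
      by (simp only: D_def outer_product_mult_vector)
  qed
qed

text \<open>The map \<open>n + variation a r \<phi>\<close> competes with \<open>n\<close>. The two energies are finite, their integrands coincide outside
  of \<open>cball a r\<close>, and inside they can be expressed through the continuous functions \<open>\<Phi>\<close>, \<open>P'\<close> and \<open>J'\<close>.\<close>

lemma (in lipschitz_chart) variation_energy_nonneg:
  fixes F \<Phi> :: "real^'d \<Rightarrow> real^'k \<Rightarrow> real^'d^'k \<Rightarrow> real"
  assumes "bounded \<Omega>" and n: "n \<in> admissible_maps \<Omega> \<Gamma> M n\<^sub>0"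
    and nu: "AE x in lborel. x \<in> \<Omega> \<longrightarrow> n x = u x"
    and nG: "AE x in lborel. x \<in> \<Omega> \<longrightarrow> weak_gradient \<Omega> n x = G x"
    and \<Phi>: "continuous_on UNIV (\<lambda>(x, z, p). \<Phi> x z p)"
    and \<Phi>_eq: "\<And>x z p. x \<in> \<Omega> \<Longrightarrow> z \<in> M \<Longrightarrow> \<Phi> x z p = F x z p"
    and min: "\<And>m. m \<in> admissible_maps \<Omega> \<Gamma> M n\<^sub>0 \<Longrightarrow> Linf_norm \<Omega> (\<lambda>x. n x - m x) < ereal \<epsilon>
      \<Longrightarrow> energy F \<Omega> n \<le> energy F \<Omega> m"
    and v: "continuous_on UNIV v"
    and r: "0 < r" "cball a (2 * r) \<subseteq> ball c R"
    and \<phi>_small: "\<And>x. norm (\<phi> x) \<le> \<delta> / 2" "\<And>x. \<Lambda> * norm (\<phi> x) \<le> \<epsilon>'" and "\<epsilon>' < \<epsilon>"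
    and \<phi>_lipschitz: "\<And>x y. norm (\<phi> x - \<phi> y) \<le> K * norm (x - y)"
    and \<phi>_outside: "\<And>x. x \<notin> cball a r \<Longrightarrow> \<phi> x = 0"
    and D_measurable: "D \<in> borel_measurable borel" and D_bound: "\<And>x. norm (D x) \<le> E"
    and \<phi>_derivative: "AE x in lborel. (\<phi> has_derivative (\<lambda>h. D x *v h)) (at x)"
  defines "k \<equiv> \<lambda>x. indicator (cball a r) x *
    (\<Phi> x (P' (v x + \<phi> x)) (J' (v x + \<phi> x) ** (G x + D x)) - \<Phi> x (v x) (G x))"
  shows "k \<in> borel_measurable borel" and "0 \<le> (\<integral>x. k x \<partial>lborel)"
proof -
  note ctx = r \<phi>_small(1) \<phi>_lipschitz \<phi>_outside D_measurable D_bound \<phi>_derivative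
  have Ol: "\<Omega> \<in> sets lebesgue" and [measurable]: "\<Omega> \<in> sets borel" using open_\<Omega> by auto
  have cb: "cball a r \<subseteq> ball c R" by (rule cball_subset[OF ctx])
  define w where "w = variation a r \<phi>"
  define W where "W = variation_gradient a r \<phi> D"
  have w: "continuous_on UNIV w" unfolding w_def by (rule variation_continuous[OF ctx])
  have [measurable]: "w \<in> borel_measurable borel" using w by (rule borel_measurable_continuous_onI)
  have [measurable]: "W \<in> borel_measurable borel" unfolding W_def by (rule variation_gradient_measurable[OF ctx])
  obtain B where B: "\<And>x. norm (W x) \<le> B" unfolding W_def using variation_gradient_bounded[OF ctx] by blast
  have wW: "has_weak_gradient w W \<Omega>" unfolding w_def W_def by (rule variation_has_weak_gradient[OF ctx])
  have w0: "w x = 0" "W x = 0" if "x \<notin> cball a r" for x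
    using that by (auto simp: w_def W_def variation_def variation_gradient_def)
  have wb: "norm (w x) \<le> \<epsilon>'" for x
    using variation_bound[OF ctx, of x] \<phi>_small(2)[of x] by (simp add: w_def)
  have to_lebesgue: "AE x in lebesgue_on \<Omega>. Q x" if "AE x in lborel. x \<in> \<Omega> \<longrightarrow> Q x" for Q
    using AE_completion[OF that] Ol by (subst AE_restrict_space_iff) auto
  have "AE x in lebesgue_on \<Omega>. n x \<in> M" using n by (auto simp: admissible_maps_def sobolev_maps_def)
  then have nM: "AE x in lborel. x \<in> \<Omega> \<longrightarrow> n x \<in> M"
    using Ol by (subst (asm) AE_restrict_space_iff) (auto simp: AE_completion_iff)
  have mM: "AE x in lborel. x \<in> \<Omega> \<longrightarrow> n x + w x \<in> M"
    using nu nM v_eq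
  proof eventually_elim
    case (elim x)
    show ?case
    proof (cases "x \<in> cball a r")
      case True
      then have "x \<in> ball c R" "x \<in> \<Omega>" using cb ball_\<Omega> by auto
      then show ?thesis using elim variation_in[OF ctx, of x] by (simp add: w_def)
    qed (use elim w0 in auto)
  qed
  define m where "m = (\<lambda>x. n x + w x)"
  have mA: "m \<in> admissible_maps \<Omega> \<Gamma> M n\<^sub>0"
    unfolding m_def
    by (rule admissible_maps_add_compactly_supported[OF open_\<Omega> \<open>bounded \<Omega>\<close> n w compact_cball _ w0(1) wW _ B
          to_lebesgue[OF mM]]) (use cb ball_\<Omega> in auto)
  have "Linf_norm \<Omega> (\<lambda>x. n x - m x) \<le> ereal \<epsilon>'"
    unfolding Linf_norm_def
  proof (rule esssup_I)
    have "w \<in> borel_measurable (lebesgue_on \<Omega>)"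
      by (intro measurable_restrict_space1 measurable_completion) simp
    then show "(\<lambda>x. ereal (norm (n x - m x))) \<in> borel_measurable (lebesgue_on \<Omega>)"
      by (simp add: m_def)
    show "AE x in lebesgue_on \<Omega>. ereal (norm (n x - m x)) \<le> ereal \<epsilon>'" using wb by (simp add: m_def)
  qed
  then have "energy F \<Omega> n \<le> energy F \<Omega> m" using mA \<open>\<epsilon>' < \<epsilon>\<close> by (intro min) (auto intro: le_less_trans)
  have \<Phi>m: "(\<lambda>x. \<Phi> (f x) (g x) (h x)) \<in> borel_measurable borel"
    if [measurable]: "f \<in> borel_measurable borel" "g \<in> borel_measurable borel" "h \<in> borel_measurable borel" for f g h
  proof -
    have [measurable]: "(\<lambda>(x, z, p). \<Phi> x z p) \<in> borel_measurable borel" using \<Phi> by (rule borel_measurable_continuous_onI)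
    have "(\<lambda>x. (\<lambda>(x, z, p). \<Phi> x z p) (f x, g x, h x)) \<in> borel_measurable borel" by measurable
    then show ?thesis by simp
  qed
  define h0 where "h0 x = \<Phi> x (u x) (G x)" for x
  define h1 where "h1 x = \<Phi> x (u x + w x) (G x + W x)" for x
  have [measurable]: "h0 \<in> borel_measurable borel" "h1 \<in> borel_measurable borel"
    unfolding h0_def h1_def by (intro \<Phi>m; measurable)+
  obtain \<rho>' where \<rho>': "\<And>x. x \<in> \<Omega> \<Longrightarrow> norm x \<le> \<rho>'" using \<open>bounded \<Omega>\<close> by (auto simp: bounded_iff)
  define A where "A = max \<rho>' (C + max \<epsilon>' B)"
  obtain Q where Q: "\<And>x z p. norm x \<le> A \<Longrightarrow> norm z \<le> A \<Longrightarrow> norm p \<le> A \<Longrightarrow> \<bar>\<Phi> x z p\<bar> \<le> Q"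
    using continuous_triple_bounded[OF \<Phi>] by blast
  have "0 \<le> \<epsilon>'" "0 \<le> B" using wb[of 0] B[of 0] norm_ge_zero order.trans by blast+
  then have in_A: "norm (u x) \<le> A" "norm (G x) \<le> A" "norm (u x + w x) \<le> A" "norm (G x + W x) \<le> A" for x
    using u_bound[of x] G_bound[of x] wb[of x] B[of x] norm_triangle_ineq[of "u x" "w x"]
      norm_triangle_ineq[of "G x" "W x"] by (auto simp: A_def)
  have xA: "norm x \<le> A" if "x \<in> \<Omega>" for x using \<rho>'[OF that] by (simp add: A_def)
  have i0: "integrable (lebesgue_on \<Omega>) h0"
    by (rule integrable_lebesgue_on_bounded[OF _ _ \<open>bounded \<Omega>\<close>, of _ Q])
      (simp_all add: h0_def Q xA in_A)
  have i1: "integrable (lebesgue_on \<Omega>) h1"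
    by (rule integrable_lebesgue_on_bounded[OF _ _ \<open>bounded \<Omega>\<close>, of _ Q])
      (simp_all add: h1_def Q xA in_A)
  have "energy F \<Omega> n = ereal (LINT x|lebesgue_on \<Omega>. h0 x)"
  proof (rule energy_eq_integral[OF i0 to_lebesgue])
    show "AE x in lborel. x \<in> \<Omega> \<longrightarrow> F x (n x) (weak_gradient \<Omega> n x) = h0 x"
      using nu nG nM by eventually_elim (auto simp: h0_def \<Phi>_eq)
  qed
  moreover have "energy F \<Omega> m = ereal (LINT x|lebesgue_on \<Omega>. h1 x)"
  proof (rule energy_eq_integral[OF i1])
    obtain H where "has_weak_gradient n H \<Omega>"
      using n by (auto simp: admissible_maps_def sobolev_maps_def sobolev_space_def)
    from weak_gradient_add_AE[OF open_\<Omega> this wW]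
    have "AE x in lebesgue_on \<Omega>. weak_gradient \<Omega> m x = weak_gradient \<Omega> n x + W x" by (simp add: m_def)
    then show "AE x in lebesgue_on \<Omega>. F x (m x) (weak_gradient \<Omega> m x) = h1 x"
      using to_lebesgue[OF nu] to_lebesgue[OF nG] to_lebesgue[OF mM] AE_space
      by eventually_elim (auto simp: h1_def m_def \<Phi>_eq space_restrict_space)
  qed
  ultimately have "(LINT x|lebesgue_on \<Omega>. h0 x) \<le> (LINT x|lebesgue_on \<Omega>. h1 x)"
    using \<open>energy F \<Omega> n \<le> energy F \<Omega> m\<close> by simp
  then have nonneg: "0 \<le> (LINT x|lebesgue_on \<Omega>. h1 x - h0 x)" using i0 i1 by simp
  have \<phi>c: "continuous_on UNIV \<phi>" by (rule \<phi>_continuous[OF ctx])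
  have [measurable]: "v \<in> borel_measurable borel" "\<phi> \<in> borel_measurable borel" "P' \<in> borel_measurable borel" "J' \<in> borel_measurable borel"
    using v \<phi>c P'_continuous J'_continuous by (auto intro: borel_measurable_continuous_onI)
  note [measurable] = D_measurable
  show km: "k \<in> borel_measurable borel"
  proof -
    have [measurable]: "cball a r \<in> sets borel" by simp
    have "(\<lambda>x. J' (v x + \<phi> x) ** (G x + D x)) \<in> borel_measurable borel"
      by (intro borel_measurable_matrix_matrix_mult; measurable)
    then have [measurable]: "(\<lambda>x. \<Phi> x (P' (v x + \<phi> x)) (J' (v x + \<phi> x) ** (G x + D x))) \<in> borel_measurable borel"
      by (intro \<Phi>m; measurable)
    have [measurable]: "(\<lambda>x. \<Phi> x (v x) (G x)) \<in> borel_measurable borel"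
      by (intro \<Phi>m; measurable)
    show ?thesis unfolding k_def by measurable
  qed
  have "(LINT x|lebesgue_on \<Omega>. h1 x - h0 x) = (\<integral>x. k x \<partial>lborel)"
  proof (rule lebesgue_on_integral_eq_lborel[OF open_\<Omega> _ km])
    show "(\<lambda>x. h1 x - h0 x) \<in> borel_measurable (lebesgue_on \<Omega>)" using i0 i1 by auto
    show "AE x in lborel. x \<in> \<Omega> \<longrightarrow> h1 x - h0 x = k x"
      using v_eq
    proof eventually_elim
      case (elim x)
      show ?case
      proof (cases "x \<in> cball a r")
        case True
        then have x: "x \<in> ball c R" using cb by auto
        have "P' (v x + \<phi> x) = P (v x + \<phi> x)" by (rule P'_eq[OF v_in[OF x] near[OF ctx x]])
        then show ?thesis using True elim x variation_eq[OF ctx x]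
          by (simp add: h1_def h0_def k_def w_def W_def variation_gradient_def)
      next
        case False
        then show ?thesis using w0[OF False] by (simp add: h1_def h0_def k_def)
      qed
    qed
    show "k x = 0" if "x \<notin> \<Omega>" for x
      using that cb ball_\<Omega> by (auto simp: k_def indicator_def)
  qed
  then show "0 \<le> (\<integral>x. k x \<partial>lborel)" using nonneg by simp
qed

text \<open>Rescaled to the unit ball, the energy inequalities for the scaled tents converge, by dominated
  convergence, to the integral inequalities that force the excess to be nonnegative. In the limit all
  arguments but the gradient of the tent are frozen at \<open>a\<close>, and \<open>J' (v a) ** G a = G a\<close> turns the limit of the
  gradients into \<open>G a\<close> plus a matrix of rank one.\<close>

lemma (in lipschitz_chart) excess_nonneg_at_blow_up_point:
  fixes F \<Phi> :: "real^'d \<Rightarrow> real^'k \<Rightarrow> real^'d^'k \<Rightarrow> real" and \<eta> :: "real^'d" and \<zeta> :: "real^'k"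
  assumes "bounded \<Omega>" and n: "n \<in> admissible_maps \<Omega> \<Gamma> M n\<^sub>0"
    and nu: "AE x in lborel. x \<in> \<Omega> \<longrightarrow> n x = u x"
    and nG: "AE x in lborel. x \<in> \<Omega> \<longrightarrow> weak_gradient \<Omega> n x = G x"
    and \<Phi>: "continuous_on UNIV (\<lambda>(x, z, p). \<Phi> x z p)"
    and \<Phi>_eq: "\<And>x z p. x \<in> \<Omega> \<Longrightarrow> z \<in> M \<Longrightarrow> \<Phi> x z p = F x z p"
    and "0 < \<epsilon>" and min: "\<And>m. m \<in> admissible_maps \<Omega> \<Gamma> M n\<^sub>0 \<Longrightarrow> Linf_norm \<Omega> (\<lambda>x. n x - m x) < ereal \<epsilon>
      \<Longrightarrow> energy F \<Omega> n \<le> energy F \<Omega> m"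
    and v: "continuous_on UNIV v"
    and a: "a \<in> ball c R" and diff: "F a (v a) differentiable (at (G a))"
    and s: "\<And>l::nat. 0 < s l" "s \<longlonglongrightarrow> 0"
    and blow_up: "AE y in lborel. y \<in> ball 0 1 \<longrightarrow> (\<lambda>l. G (a + s l *\<^sub>R y)) \<longlonglongrightarrow> G a"
    and tangential: "J' (v a) ** G a = G a"
  shows "0 \<le> weierstrass_excess F a (v a) (G a) (G a + outer_product (J' (v a) *v \<zeta>) \<eta>)"
proof (cases "\<eta> = 0")
  case True
  then have "outer_product (J' (v a) *v \<zeta>) \<eta> = 0" by (simp add: vec_eq_iff outer_product_def)
  then show ?thesis by (simp add: weierstrass_excess_def)
next
  case False
  define q where "q = J' (v a) *v \<zeta>"
  define f where "f t = F a (v a) (G a + outer_product q t)" for t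
  have a\<Omega>: "a \<in> \<Omega>" using a ball_\<Omega> by auto
  have f_eq: "f t = \<Phi> a (v a) (G a + outer_product q t)" for t
    unfolding f_def using \<Phi>_eq[OF a\<Omega> v_in[OF a]] by simp
  have lin: "bounded_linear (outer_product q :: real^'d \<Rightarrow> real^'d^'k)"
    by (rule bounded_bilinear.bounded_linear_right[OF bounded_bilinear_outer_product])
  then have op0: "outer_product q 0 = (0 :: real^'d^'k)" by (intro linear_0 bounded_linear.linear)
  have opc: "continuous_on S (outer_product q :: real^'d \<Rightarrow> real^'d^'k)" for S
    using lin by (rule linear_continuous_on)
  have f': "(f has_derivative (\<lambda>t. matrix_gradient (F a (v a)) (G a) \<bullet> outer_product q t)) (at 0)"
    unfolding f_def
  proof (rule has_derivative_compose[where f="\<lambda>t. G a + outer_product q t"])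
    show "((\<lambda>t. G a + outer_product q t) has_derivative outer_product q) (at 0)"
      using bounded_linear_imp_has_derivative[OF lin] by (auto intro!: derivative_eq_intros)
    show "(F a (v a) has_derivative (\<lambda>A. matrix_gradient (F a (v a)) (G a) \<bullet> A)) (at (G a + outer_product q 0))"
      using frechet_derivative_eq_matrix_gradient_inner[OF diff] by (simp add: op0)
  qed
  have "continuous_on UNIV (\<lambda>t. (\<lambda>(x, z, p). \<Phi> x z p) (a, v a, G a + outer_product q t))"
    by (rule continuous_on_compose2[OF \<Phi>]) (auto intro!: continuous_intros opc)
  then have fc: "continuous_on UNIV f" by (simp add: f_eq[abs_def])
  have "0 \<le> f \<eta> - f 0 - matrix_gradient (F a (v a)) (G a) \<bullet> outer_product q \<eta>"
  proof (rule excess_nonneg_if_tent_integrals_nonneg[OF f' fc False])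
    fix \<kappa> :: real assume \<kappa>: "0 < \<kappa>" "\<kappa> < 1"
    note \<eta> = \<open>\<eta> \<noteq> 0\<close>
    have zc: "(\<lambda>l. 2 * s l) \<longlonglongrightarrow> 2 * 0" "(\<lambda>l. s l * \<kappa> * norm \<zeta>) \<longlonglongrightarrow> 0 * \<kappa> * norm \<zeta>"
      "(\<lambda>l. \<Lambda> * (s l * \<kappa> * norm \<zeta>)) \<longlonglongrightarrow> \<Lambda> * (0 * \<kappa> * norm \<zeta>)"
      by (intro tendsto_intros s)+
    have "\<forall>\<^sub>F l in sequentially. 2 * s l < R - dist c a \<and> s l * \<kappa> * norm \<zeta> < \<delta> / 2 \<and>
        \<Lambda> * (s l * \<kappa> * norm \<zeta>) < \<epsilon> / 2 \<and> s l < 1"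
      using order_tendstoD(2)[OF zc(1), of "R - dist c a"] order_tendstoD(2)[OF zc(2), of "\<delta> / 2"]
        order_tendstoD(2)[OF zc(3), of "\<epsilon> / 2"] order_tendstoD(2)[OF s(2), of 1] a \<delta> \<open>0 < \<epsilon>\<close>
      by (auto intro!: eventually_conj)
    \<comment> \<open>from \<open>l0\<close> on, the ball lies in the chart and the perturbation is small enough for the tube and for minimality\<close>
    then obtain l0 where l0: "\<And>l. l0 \<le> l \<Longrightarrow> 2 * s l < R - dist c a \<and> s l * \<kappa> * norm \<zeta> < \<delta> / 2 \<and>
        \<Lambda> * (s l * \<kappa> * norm \<zeta>) < \<epsilon> / 2 \<and> s l < 1"
      by (auto simp: eventually_sequentially)
    define r where "r = (\<lambda>l. s (l + l0))"
    have r: "0 < r l" "2 * r l < R - dist c a" "r l * \<kappa> * norm \<zeta> < \<delta> / 2" "\<Lambda> * (r l * \<kappa> * norm \<zeta>) < \<epsilon> / 2" "r l < 1" for l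
      using s(1) l0[of "l + l0"] by (auto simp: r_def)
    have r0: "r \<longlonglongrightarrow> 0" unfolding r_def by (rule LIMSEQ_ignore_initial_segment[OF s(2)])
    let ?x = "\<lambda>l y. a + r l *\<^sub>R y"
    let ?z = "\<lambda>l y. v (?x l y) + (r l * tent \<eta> \<kappa> y) *\<^sub>R \<zeta>"
    let ?A = "\<lambda>l y. G (?x l y) + outer_product \<zeta> (tent_grad \<eta> \<kappa> y)"
    have Gr: "AE y in lborel. y \<in> ball 0 1 \<longrightarrow> (\<lambda>l. G (?x l y)) \<longlonglongrightarrow> G a"
      using blow_up
    proof eventually_elim
      case (elim y)
      then show ?case unfolding r_def using LIMSEQ_ignore_initial_segment by fastforce
    qed
    define \<phi> where "\<phi> l = (\<lambda>x. (r l * tent \<eta> \<kappa> ((x - a) /\<^sub>R r l)) *\<^sub>R \<zeta>)" for l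
    define D where "D l = (\<lambda>x. outer_product \<zeta> (tent_grad \<eta> \<kappa> ((x - a) /\<^sub>R r l)))" for l
    have tents: "norm (\<phi> l x) \<le> r l * \<kappa> * norm \<zeta>"
      "norm (\<phi> l x - \<phi> l y) \<le> (norm \<eta> + \<kappa>) * norm \<zeta> * norm (x - y)"
      "x \<notin> cball a (r l) \<Longrightarrow> \<phi> l x = 0" "D l \<in> borel_measurable borel"
      "AE x in lborel. (\<phi> l has_derivative (\<lambda>h. D l x *v h)) (at x)" for l x y
      unfolding \<phi>_def D_def by (rule scaled_tent[OF \<eta> \<kappa>(1) r(1)], assumption?)+
    obtain B2 where B2: "0 \<le> B2" "\<And>x y. norm (outer_product (x :: real^'k) (y :: real^'d)) \<le> norm x * norm y * B2"
      using bounded_bilinear.nonneg_bounded[OF bounded_bilinear_outer_product] by blast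
    define E where "E = norm \<zeta> * (norm \<eta> + \<kappa>) * B2"
    have opE: "norm (outer_product \<zeta> (tent_grad \<eta> \<kappa> y)) \<le> E" for y
    proof -
      have "norm \<zeta> * norm (tent_grad \<eta> \<kappa> y) * B2 \<le> E"
        unfolding E_def using tent_grad_bound[OF \<eta> \<kappa>(1), of y] B2(1) by (intro mult_right_mono mult_left_mono) auto
      then show ?thesis using B2(2)[of \<zeta> "tent_grad \<eta> \<kappa> y"] by simp
    qed
    have DE: "norm (D l x) \<le> E" for l x unfolding D_def by (rule opE)
    define k where "k l = (\<lambda>x. indicator (cball a (r l)) x *
      (\<Phi> x (P' (v x + \<phi> l x)) (J' (v x + \<phi> l x) ** (G x + D l x)) - \<Phi> x (v x) (G x)))" for l
    have k: "k l \<in> borel_measurable borel" "0 \<le> (\<integral>x. k l x \<partial>lborel)" for l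
    proof -
      have sub: "cball a (2 * r l) \<subseteq> ball c R"
      proof
        fix x assume "x \<in> cball a (2 * r l)"
        then show "x \<in> ball c R" using r(2)[of l] dist_triangle[of c x a] by auto
      qed
      have 1: "norm (\<phi> l x) \<le> \<delta> / 2" for x using order.trans[OF tents(1)[of l x] less_imp_le[OF r(3)[of l]]] by simp
      have 2: "\<Lambda> * norm (\<phi> l x) \<le> \<epsilon> / 2" for x
        using order.trans[OF mult_left_mono[OF tents(1)[of l x] \<Lambda>] less_imp_le[OF r(4)[of l]]] .
      have 3: "\<epsilon> / 2 < \<epsilon>" using \<open>0 < \<epsilon>\<close> by simp
      note * = variation_energy_nonneg[OF \<open>bounded \<Omega>\<close> n nu nG \<Phi> \<Phi>_eq min v r(1)[of l] sub 1 2 3 tents(2)[of l] tents(3)[where l=l] tents(4)[of l] DE[of l] tents(5)[of l]]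
      show "k l \<in> borel_measurable borel" unfolding k_def by (rule *(1))
      show "0 \<le> (\<integral>x. k l x \<partial>lborel)" unfolding k_def by (rule *(2))
    qed
    define H where "H l y = indicator (cball 0 1) y *
      (\<Phi> (?x l y) (P' (?z l y))
        (J' (?z l y) ** (?A l y))
       - \<Phi> (?x l y) (v (?x l y)) (G (?x l y)))" for l y
    have kH: "k l (?x l y) = H l y" for l y
    proof -
      have "?x l y \<in> cball a (r l) \<longleftrightarrow> y \<in> cball 0 1"
        using r(1)[of l] by (simp add: dist_norm)
      then have "indicat_real (cball a (r l)) (?x l y) = indicat_real (cball 0 1) y"
        by (simp only: indicator_def)
      then show ?thesis using r(1)[of l] by (simp add: k_def H_def \<phi>_def D_def)
    qed
    have Hm[measurable]: "H l \<in> borel_measurable borel" for l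
    proof -
      note [measurable] = k(1)
      have "(\<lambda>y. k l (?x l y)) \<in> borel_measurable borel" by measurable
      then show ?thesis by (simp add: kH)
    qed
    have Hnn: "0 \<le> (\<integral>y. H l y \<partial>lborel)" for l
      using integral_affine_nonneg[OF k(1) r(1) k(2), of l a l] by (simp add: kH)
    \<comment> \<open>one continuous function, so that bounds and limits need not treat \<open>P'\<close> and \<open>J'\<close> separately\<close>
    define \<Psi> where "\<Psi> x z B = \<Phi> x (P' z) (J' z ** B)" for x z B
    have \<Psi>: "continuous_on UNIV (\<lambda>(x, z, B). \<Psi> x z B)"
    proof -
      have "continuous_on UNIV (\<lambda>y :: (real^'d) \<times> (real^'k) \<times> (real^'d^'k).
          (\<lambda>(x, z, p). \<Phi> x z p) (fst y, P' (fst (snd y)), J' (fst (snd y)) ** snd (snd y)))"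
        by (rule continuous_on_compose2[OF \<Phi>])
          (auto intro!: continuous_intros continuous_on_compose2[OF P'_continuous] continuous_on_compose2[OF J'_continuous]
            bounded_bilinear.continuous_on[OF bounded_bilinear_matrix_matrix_mult])
      then show ?thesis by (simp add: \<Psi>_def case_prod_unfold)
    qed
    have lim: "(\<lambda>l. H l y) \<longlonglongrightarrow> indicator (ball 0 1) y * (f (tent_grad \<eta> \<kappa> y) - f 0)"
      if y: "y \<notin> sphere 0 1" "y \<in> ball 0 1 \<longrightarrow> (\<lambda>l. G (?x l y)) \<longlonglongrightarrow> G a" for y
    proof (cases "y \<in> ball 0 1")
      case True
      have x: "(\<lambda>l. ?x l y) \<longlonglongrightarrow> a" using tendsto_add[OF tendsto_const tendsto_scaleR[OF r0 tendsto_const]] by simp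
      have vx: "(\<lambda>l. v (?x l y)) \<longlonglongrightarrow> v a"
        using v by (intro isCont_tendsto_compose[OF _ x]) (auto simp: continuous_on_eq_continuous_at)
      have rt: "(\<lambda>l. (r l * tent \<eta> \<kappa> y) *\<^sub>R \<zeta>) \<longlonglongrightarrow> (0 * tent \<eta> \<kappa> y) *\<^sub>R \<zeta>" by (intro tendsto_intros r0)
      have z: "(\<lambda>l. ?z l y) \<longlonglongrightarrow> v a" using tendsto_add[OF vx rt] by simp
      have Gy: "(\<lambda>l. G (?x l y)) \<longlonglongrightarrow> G a" using y True by simp
      have A: "(\<lambda>l. ?A l y) \<longlonglongrightarrow> G a + outer_product \<zeta> (tent_grad \<eta> \<kappa> y)"
        by (intro tendsto_intros Gy)
      have comp: "(\<lambda>l. g (x1 l) (x2 l) (x3 l)) \<longlonglongrightarrow> g b1 b2 b3"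
        if "continuous_on UNIV (\<lambda>(x, z, p). g x z p)" "x1 \<longlonglongrightarrow> b1" "x2 \<longlonglongrightarrow> b2" "x3 \<longlonglongrightarrow> b3"
        for g :: "real^'d \<Rightarrow> real^'k \<Rightarrow> real^'d^'k \<Rightarrow> real" and x1 x2 x3 b1 b2 b3
      proof -
        have "isCont (\<lambda>(x, z, p). g x z p) (b1, b2, b3)" using that(1) by (simp add: continuous_on_eq_continuous_at)
        from isCont_tendsto_compose[OF this tendsto_Pair[OF that(2) tendsto_Pair[OF that(3,4)]]]
        show ?thesis by simp
      qed
      from tendsto_diff[OF comp[OF \<Psi> x z A] comp[OF \<Phi> x vx Gy]]
      have "(\<lambda>l. H l y) \<longlonglongrightarrow> \<Psi> a (v a) (G a + outer_product \<zeta> (tent_grad \<eta> \<kappa> y)) - \<Phi> a (v a) (G a)"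
        using True by (simp add: H_def \<Psi>_def)
      also have "\<Psi> a (v a) (G a + outer_product \<zeta> (tent_grad \<eta> \<kappa> y)) = f (tent_grad \<eta> \<kappa> y)"
      proof -
        have "P' (v a) = v a" using P'_eq[OF v_in[OF a], of "v a"] P_fix[OF v_in[OF a]] \<delta> by simp
        then show ?thesis
          by (simp add: \<Psi>_def f_eq matrix_add_ldistrib tangential matrix_mult_outer_product q_def)
      qed
      also have "\<Phi> a (v a) (G a) = f 0" by (simp add: f_eq op0)
      finally show ?thesis using True by simp
    next
      case False
      then have "y \<notin> cball 0 1" using y(1) by auto
      then show ?thesis using False by (simp add: H_def)
    qed
    have "bounded (v ` cball a 1)"
      using v by (intro compact_imp_bounded compact_continuous_image) (auto intro: continuous_on_subset)
    then obtain V where V: "\<And>x. x \<in> cball a 1 \<Longrightarrow> norm (v x) \<le> V"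
      unfolding bounded_iff by blast
    define A where "A = max (norm a + 1) (max (V + \<delta>) (C + E))"
    obtain Q1 where Q1: "\<And>x z p. norm x \<le> A \<Longrightarrow> norm z \<le> A \<Longrightarrow> norm p \<le> A \<Longrightarrow> \<bar>\<Phi> x z p\<bar> \<le> Q1"
      using continuous_triple_bounded[OF \<Phi>] by blast
    obtain Q2 where Q2: "\<And>x z p. norm x \<le> A \<Longrightarrow> norm z \<le> A \<Longrightarrow> norm p \<le> A \<Longrightarrow> \<bar>\<Psi> x z p\<bar> \<le> Q2"
      using continuous_triple_bounded[OF \<Psi>] by blast
    have "0 \<le> E" using opE[of 0] norm_ge_zero order.trans by blast
    have Hb: "norm (H l y) \<le> (Q2 + Q1) * indicator (cball 0 1) y" for l y
    proof (cases "y \<in> cball 0 1")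
      case True
      have ry: "norm (r l *\<^sub>R y) \<le> 1" using True r(1,5)[of l] by (simp add: mult_le_one)
      have xA: "norm (?x l y) \<le> A" using ry norm_triangle_ineq[of a "r l *\<^sub>R y"] by (simp add: A_def)
      have vV: "norm (v (?x l y)) \<le> V" using ry by (intro V) (simp add: dist_norm)
      have "norm ((r l * tent \<eta> \<kappa> y) *\<^sub>R \<zeta>) \<le> \<delta>"
      proof -
        have "norm ((r l * tent \<eta> \<kappa> y) *\<^sub>R \<zeta>) = norm (\<phi> l (?x l y))" using r(1)[of l] by (simp add: \<phi>_def)
        also have "\<dots> \<le> \<delta> / 2" by (rule order.trans[OF tents(1) less_imp_le[OF r(3)]])
        also have "\<dots> \<le> \<delta>" using \<delta> by simp
        finally show ?thesis .
      qed
      then have zA: "norm (?z l y) \<le> A"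
        using vV norm_triangle_ineq[of "v (?x l y)" "(r l * tent \<eta> \<kappa> y) *\<^sub>R \<zeta>"] by (simp add: A_def)
      have vA: "norm (v (?x l y)) \<le> A" using vV \<delta> by (simp add: A_def)
      have GA: "norm (G (?x l y)) \<le> A" using G_bound[of "?x l y"] \<open>0 \<le> E\<close> by (simp add: A_def)
      have BA: "norm (?A l y) \<le> A"
        using norm_triangle_ineq[of "G (?x l y)" "outer_product \<zeta> (tent_grad \<eta> \<kappa> y)"]
          G_bound[of "?x l y"] opE[of y] by (simp add: A_def)
      have "norm (H l y) = \<bar>\<Psi> (?x l y) (?z l y)
          (?A l y)
        - \<Phi> (?x l y) (v (?x l y)) (G (?x l y))\<bar>"
        using True by (simp add: H_def \<Psi>_def)
      also have "\<dots> \<le> Q2 + Q1"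
        by (rule order.trans[OF abs_triangle_ineq4 add_mono[OF Q2[OF xA zA BA] Q1[OF xA vA GA]]])
      finally show ?thesis using True by simp
    next
      case False
      then show ?thesis by (simp add: H_def)
    qed
    have AElim: "AE y in lborel. (\<lambda>l. H l y) \<longlonglongrightarrow> indicator (ball 0 1) y * (f (tent_grad \<eta> \<kappa> y) - f 0)"
      using AE_lborel_notin_negligible[OF negligible_sphere[of "0::real^'d" 1]] Gr by eventually_elim (rule lim)
    have "(\<lambda>l. \<integral>y. H l y \<partial>lborel) \<longlonglongrightarrow> (\<integral>y. indicator (ball 0 1) y * (f (tent_grad \<eta> \<kappa> y) - f 0) \<partial>lborel)"
    proof (rule integral_dominated_convergence[OF _ _ _ AElim])
      show "integrable lborel (\<lambda>y. (Q2 + Q1) * indicat_real (cball (0::real^'d) 1) y)"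
        by (intro integrable_mult_right integrable_real_indicator emeasure_lborel_cball_finite) simp
      note [measurable] = tent_grad_measurable[OF \<eta> \<kappa>(1)] borel_measurable_continuous_onI[OF fc]
      have [measurable]: "ball (0::real^'d) 1 \<in> sets borel" by simp
      show "(\<lambda>y. indicator (ball 0 1) y * (f (tent_grad \<eta> \<kappa> y) - f 0)) \<in> borel_measurable lborel" by measurable
    qed (use Hb in auto)
    then show "0 \<le> (\<integral>y. indicator (ball 0 1) y * (f (tent_grad \<eta> \<kappa> y) - f 0) \<partial>lborel)"
      by (rule LIMSEQ_le_const) (use Hnn in auto)
  qed
  then show ?thesis unfolding weierstrass_excess_def f_def op0 q_def[symmetric] by simp
qed

section \<open>The Weierstrass condition\<close>

theorem corollary16:
  fixes \<Omega> \<Gamma>\<^sub>1 \<Gamma>\<^sub>2 :: "(real^'d) set"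
    and M U N :: "(real^'k) set"
    and P :: "real^'k \<Rightarrow> real^'k"
    and F :: "real^'d \<Rightarrow> real^'k \<Rightarrow> real^'d^'k \<Rightarrow> real"
    and n\<^sub>0 n :: "real^'d \<Rightarrow> real^'k"
    and m :: nat
  assumes "bounded \<Omega>" and "lipschitz_domain \<Omega>"
    and "openin (top_of_set (frontier \<Omega>)) \<Gamma>\<^sub>1" and "openin (top_of_set (frontier \<Omega>)) \<Gamma>\<^sub>2"
    and "\<Gamma>\<^sub>1 \<in> sets surface_measure" and "\<Gamma>\<^sub>2 \<in> sets surface_measure"
    and "\<Gamma>\<^sub>1 \<inter> \<Gamma>\<^sub>2 = {}" and "frontier \<Omega> = closure \<Gamma>\<^sub>1 \<union> closure \<Gamma>\<^sub>2"
    and "closed M" and "bounded M" and "C_submanifold 4 m M"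
    and "open U" and "M \<subseteq> U" and "nearest_point_projection M U P" and "class_C_on 3 U P"
    and "continuous_on (closure \<Omega> \<times> M \<times> UNIV) (\<lambda>(x, z, p). F x z p)"
    and "open N" and "M \<subseteq> N" and "N \<subseteq> U"
    and "\<And>x. x \<in> \<Omega> \<Longrightarrow> class_C_on 2 (N \<times> UNIV) (\<lambda>(z, p). F x z p)"
    and "n\<^sub>0 \<in> sobolev_maps 1 \<Omega> M"
    and "n \<in> admissible_maps \<Omega> \<Gamma>\<^sub>1 M n\<^sub>0 \<inter> sobolev_maps \<infinity> \<Omega> M"
    and "strong_local_minimizer (energy F \<Omega>) \<Omega> (admissible_maps \<Omega> \<Gamma>\<^sub>1 M n\<^sub>0) n"
  shows "AE x in lebesgue_on \<Omega>. \<forall>(\<zeta> :: real^'k) (\<eta> :: real^'d).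
    weierstrass_excess F x (n x) (weak_gradient \<Omega> n x)
      (weak_gradient \<Omega> n x + outer_product (jacobian P (at (n x)) *v \<zeta>) \<eta>) \<ge> 0"
proof -
  have open_\<Omega>: "open \<Omega>" using \<open>lipschitz_domain \<Omega>\<close> by (simp add: lipschitz_domain_def)
  have Ol: "\<Omega> \<in> sets lebesgue" using open_\<Omega> by auto
  have n: "n \<in> admissible_maps \<Omega> \<Gamma>\<^sub>1 M n\<^sub>0" "n \<in> sobolev_space \<infinity> \<Omega>"
    using \<open>n \<in> admissible_maps \<Omega> \<Gamma>\<^sub>1 M n\<^sub>0 \<inter> sobolev_maps \<infinity> \<Omega> M\<close> by (auto simp: sobolev_maps_def)
  obtain \<epsilon> where \<epsilon>: "0 < \<epsilon>" "\<And>m. m \<in> admissible_maps \<Omega> \<Gamma>\<^sub>1 M n\<^sub>0 \<Longrightarrow>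
      Linf_norm \<Omega> (\<lambda>x. n x - m x) < ereal \<epsilon> \<Longrightarrow> energy F \<Omega> n \<le> energy F \<Omega> m"
    using \<open>strong_local_minimizer (energy F \<Omega>) \<Omega> (admissible_maps \<Omega> \<Gamma>\<^sub>1 M n\<^sub>0) n\<close>
    unfolding strong_local_minimizer_def by blast
  obtain \<delta> \<Lambda> P' J' where "projection_tube M P \<delta> \<Lambda> P' J'"
    by (rule projection_tube_exists[OF \<open>closed M\<close> \<open>bounded M\<close> \<open>open U\<close> \<open>M \<subseteq> U\<close>
          \<open>nearest_point_projection M U P\<close> \<open>class_C_on 3 U P\<close>])
  then interpret projection_tube M P \<delta> \<Lambda> P' J' .
  obtain u G C \<rho> where "bounded_weak_gradient \<Omega> u G C \<rho>"
    and nu: "AE x in lborel. x \<in> \<Omega> \<longrightarrow> n x = u x"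
    and nG: "AE x in lborel. x \<in> \<Omega> \<longrightarrow> weak_gradient \<Omega> n x = G x"
    by (rule bounded_weak_gradient_representatives[OF open_\<Omega> \<open>bounded \<Omega>\<close> n(2)])
  then interpret bounded_weak_gradient \<Omega> u G C \<rho> by simp
  have "AE x in lebesgue_on \<Omega>. n x \<in> M" using n(1) by (auto simp: admissible_maps_def sobolev_maps_def)
  then have nM: "AE x in lborel. x \<in> \<Omega> \<longrightarrow> n x \<in> M"
    using Ol by (subst (asm) AE_restrict_space_iff) (auto simp: AE_completion_iff)
  have "closedin (top_of_set UNIV) (closure \<Omega> \<times> M \<times> (UNIV :: (real^'d^'k) set))"
    using \<open>closed M\<close> by (simp add: closed_Times)
  from Tietze_unbounded[OF \<open>continuous_on (closure \<Omega> \<times> M \<times> UNIV) (\<lambda>(x, z, p). F x z p)\<close> this]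
  obtain g where g: "continuous_on UNIV g"
    "\<And>y. y \<in> closure \<Omega> \<times> M \<times> UNIV \<Longrightarrow> g y = (case y of (x, z, p) \<Rightarrow> F x z p)" by blast
  define \<Phi> where "\<Phi> x z p = g (x, z, p)" for x z p
  have \<Phi>: "continuous_on UNIV (\<lambda>(x, z, p). \<Phi> x z p)" using g(1) by (simp add: \<Phi>_def case_prod_unfold)
  have \<Phi>_eq: "\<Phi> x z p = F x z p" if "x \<in> \<Omega>" "z \<in> M" for x z p
    using g(2)[of "(x, z, p)"] that closure_subset[of \<Omega>] by (auto simp: \<Phi>_def)
  let ?\<mu> = "restrict_space lborel (ball (0::real^'d) 1)"
  have "finite_measure ?\<mu>"
    using emeasure_lborel_ball_finite[of "0 :: real^'d" 1]
    by (intro finite_measureI) (simp add: space_restrict_space emeasure_restrict_space)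
  moreover have "(\<lambda>y. y) \<in> borel_measurable ?\<mu>" by (intro measurable_restrict_space1) simp
  ultimately obtain s where s: "\<And>l::nat. 0 < s l" "s \<longlonglongrightarrow> 0"
    and blow_up: "AE x in lborel. AE y in ?\<mu>. (\<lambda>l. G (x + s l *\<^sub>R y)) \<longlonglongrightarrow> G x"
    using AE_blow_up_sequence[OF G_measurable G_bound, of \<rho> ?\<mu> "\<lambda>y. y"] G_support by blast
  let ?good = "\<lambda>x. \<forall>(\<zeta> :: real^'k) (\<eta> :: real^'d).
    weierstrass_excess F x (n x) (weak_gradient \<Omega> n x)
      (weak_gradient \<Omega> n x + outer_product (jacobian P (at (n x)) *v \<zeta>) \<eta>) \<ge> 0"
  have on_ball: "AE x in lborel. x \<in> ball c R \<longrightarrow> ?good x" if ball: "ball c R \<subseteq> \<Omega>" for c R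
  proof -
    obtain v0 L where v0: "L-lipschitz_on (ball c R) v0" "AE x in lborel. x \<in> ball c R \<longrightarrow> v0 x = u x"
      using lipschitz_representative[OF ball] by blast
    \<comment> \<open>extending \<open>v0\<close> to a continuous function on the whole space keeps all compositions measurable\<close>
    obtain v1 where v1: "L-lipschitz_on (closure (ball c R)) v1" "\<And>x. x \<in> ball c R \<Longrightarrow> v1 x = v0 x"
      using lipschitz_extend_closure[OF v0(1)] by blast
    obtain v where v: "continuous_on UNIV v" "\<And>x. x \<in> closure (ball c R) \<Longrightarrow> v x = v1 x"
      using Tietze_unbounded[OF lipschitz_on_continuous_on[OF v1(1)], of UNIV] by auto
    have vv0: "v x = v0 x" if "x \<in> ball c R" for x
      using v(2)[of x] v1(2)[OF that] that closure_subset[of "ball c R"] by auto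
    have v_lip: "L-lipschitz_on (ball c R) v"
      using v0(1) vv0 by (simp add: lipschitz_on_def)
    have v_eq: "AE x in lborel. x \<in> ball c R \<longrightarrow> v x = u x"
      using v0(2) by eventually_elim (simp add: vv0)
    have v_ae: "AE x in lborel. x \<in> ball c R \<longrightarrow> v x \<in> M"
      using v_eq nu nM by eventually_elim (use ball in auto)
    have v_in: "v x \<in> M" if "x \<in> ball c R" for x
    proof (rule ccontr)
      assume "v x \<notin> M"
      have "open (v -` (- M))" using \<open>closed M\<close> v(1) by (intro open_vimage) (auto simp: open_Compl)
      then have "open (ball c R \<inter> v -` (- M))" "ball c R \<inter> v -` (- M) \<noteq> {}"
        using that \<open>v x \<notin> M\<close> by (auto intro: open_Int)
      from AE_lborel_meets_open[OF v_ae this] show False by auto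
    qed
    interpret lipschitz_chart \<Omega> u G C \<rho> M P \<delta> \<Lambda> P' J' c R L v
      by unfold_locales (fact ball open_\<Omega> v_lip v_eq v_in)+
    show ?thesis
      using blow_up projected_gradient v_eq nu nG
    proof eventually_elim
      case (elim x)
      show ?case
      proof (intro impI allI)
        fix \<zeta> :: "real^'k" and \<eta> :: "real^'d"
        assume x: "x \<in> ball c R"
        then have x\<Omega>: "x \<in> \<Omega>" using ball by auto
        have eqs: "v x = n x" "weak_gradient \<Omega> n x = G x" using elim x x\<Omega> by auto
        have "(v x, G x) \<in> N \<times> UNIV" using v_in[OF x] \<open>M \<subseteq> N\<close> by auto
        moreover have "class_C_on (Suc (Suc 0)) (N \<times> UNIV) (\<lambda>(z, p). F x z p)"
          using assms(20)[OF x\<Omega>] by (simp add: numeral_2_eq_2)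
        ultimately have "(\<lambda>(z, p). F x z p) differentiable (at (v x, G x))" by simp
        then obtain F' where F': "((\<lambda>(z, p). F x z p) has_derivative F') (at (v x, G x))"
          by (auto simp: differentiable_def)
        have "((\<lambda>p. (v x, p)) has_derivative (\<lambda>h. (0, h))) (at (G x))"
          by (auto intro!: derivative_eq_intros)
        from has_derivative_compose[OF this F']
        have diff: "F x (v x) differentiable (at (G x))" by (auto simp: differentiable_def)
        have blow_up_x: "AE y in lborel. y \<in> ball 0 1 \<longrightarrow> (\<lambda>l. G (x + s l *\<^sub>R y)) \<longlonglongrightarrow> G x"
          using elim(1) by (subst (asm) AE_restrict_space_iff) auto
        have tangential: "J' (v x) ** G x = G x" using elim(2) x by simp
        have "0 \<le> weierstrass_excess F x (v x) (G x) (G x + outer_product (J' (v x) *v \<zeta>) \<eta>)"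
          by (rule excess_nonneg_at_blow_up_point[where n=n and \<Gamma>=\<Gamma>\<^sub>1 and n\<^sub>0=n\<^sub>0 and \<Phi>=\<Phi> and F=F
                and \<epsilon>=\<epsilon> and a=x and s=s])
            (fact \<open>bounded \<Omega>\<close> n(1) nu nG \<Phi> \<Phi>_eq \<epsilon> v(1) x diff s blow_up_x tangential)+
        moreover have "J' (v x) = jacobian P (at (v x))"
          using J'_eq[OF v_in[OF x], of "v x"] \<delta> by simp
        ultimately show "weierstrass_excess F x (n x) (weak_gradient \<Omega> n x)
            (weak_gradient \<Omega> n x + outer_product (jacobian P (at (n x)) *v \<zeta>) \<eta>) \<ge> 0"
          by (simp add: eqs)
      qed
    qed
  qed
  obtain B where B: "B \<subseteq> {ball c R | c R. ball c R \<subseteq> \<Omega>}" "countable B" "\<Union>B = \<Union>{ball c R | c R. ball c R \<subseteq> \<Omega>}"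
    by (rule Lindelof[of "{ball c R | c R. ball c R \<subseteq> \<Omega>}"]) auto
  have "\<Omega> \<subseteq> \<Union>B"
  proof
    fix x assume "x \<in> \<Omega>"
    then obtain R where "0 < R" "ball x R \<subseteq> \<Omega>" using open_\<Omega> open_contains_ball by blast
    then show "x \<in> \<Union>B" unfolding B(3) by (intro UnionI[of "ball x R"]) auto
  qed
  have "AE x in lborel. \<forall>S\<in>B. x \<in> S \<longrightarrow> ?good x"
    using B(1) on_ball by (intro AE_ball_countable'[OF _ B(2)]) blast
  then have "AE x in lborel. x \<in> \<Omega> \<longrightarrow> ?good x"
    by eventually_elim (use \<open>\<Omega> \<subseteq> \<Union>B\<close> in blast)
  from AE_completion[OF this] show ?thesis using Ol by (subst AE_restrict_space_iff) auto
qed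

end
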